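(* Let $M$ be a torus orbifold with $d(M)=1$. Let $I\in\Sigma(M)^{(k)}$, and let $x$ be a point in the principal stratum (as an orbifold) of $M_I$. Then the isotropy group $H_x$ of $x$ is isomorphic to the kernel of $\rho_I:\tilde T_I\to T$.
   Context: **Orbifolds.** Orbifolds are as usual given by atlases of charts $(U,V,H,p)$, $H$ a finite group acting (not necessarily effectively) on a manifold $V$, $p:V\to U$ inducing a homeomorphism $V/H\cong U$. A reduced chart $(U_x,V_x,H_x,p_x)$ around $x$ is one with $p_x^{-1}(x)$ a single point; the isomorphism class of $H_x$ depends only on $x$, $H_x$ is the isotropy group of $x$ and $d_x=|H_x|$ its multiplicity. For a connected orbifold $M$, $d(M)$ is the minimum of the $d_x$, and the principal stratum is the open dense set $\{x:d_x=d(M)\}$. ($d(M)=1$ iff all isotropy groups act effectively.) A suborbifold $M\subset M'$ is a subset such that $p'^{-1}(M\cap U')$ is an $H'$-invariant submanifold of $V'$ for each chart $(U',V',H',p')$ of $M'$; it is an orbifold with charts $(M\cap U',p'^{-1}(M\cap U'),H',p')$. The principal stratum of a possibly disconnected suborbifold is taken component by component. **Torus orbifolds.** Let $M$ be a connected oriented closed orbifold of dimension $2n$ with an effective action of an $n$-dimensional torus $T$ with $M^T\ne\emptyset$. A characteristic suborbifold is a codimension-two suborbifold which is a connected component of the fixed point set of a circle subgroup and contains a $T$-fixed point. Let $M_1,\dots,M_d$ be these, and $S_i$ the circle subgroup fixing $M_i$ pointwise. For $x\in M_i$ and a reduced chart with $V_x$ a disk in $\mathbb R^{2n}$ with linear $H_x$-action,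 the tangent space at $p_x^{-1}(x)$ splits as $V_{ix}\oplus V_{ix}^\perp$ with $V_{ix}^\perp$ tangent to $p_x^{-1}(U_x\cap M_i)$ and $V_{ix}$ the 2-dimensional normal fiber, on which $H_x$ acts. $M$ is a torus orbifold if it is equipped with a preferred orientation of the normal bundle of each $M_i$ such that $H_x$ preserves the orientation of $V_{ix}$ for all $i$ and $x\in M_i$. **$\tilde T_I$ and $\rho_I$.** For each $i$ there is a minimal finite covering group $\rho_i:\tilde S_i\to S_i$ such that the action of $S_i$ lifts to an action of $\tilde S_i$ on $V_x$ for every $x\in M_i$. $\Sigma(M)=\{I\subset\{1,\dots,d\}:(\bigcap_{i\in I}M_i)^T\neq\emptyset\}$ (together with $\emptyset$), $\Sigma(M)^{(k)}$ is the set of its members of cardinality $k$, and $M_I=\bigcap_{i\in I}M_i$. For $I\in\Sigma(M)^{(k)}$, $\tilde T_I=\prod_{i\in I}\tilde S_i$ and $\rho_I=\prod_{i\in I}\rho_i:\tilde T_I\to T$. $H_x$ is the isotropy group of $x$ in the orbifold $M$. *)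

theory Defs
  imports
    "HOL-Analysis.Analysis"
    "HOL-Algebra.Group_Action"
    "HOL-Algebra.FiniteProduct"
    "HOL-Algebra.Product_Groups"
begin

section \<open>Smooth maps and submanifolds of Euclidean space\<close>

text \<open>Only used for open \<open>S\<close>; on finite-dimensional spaces \<open>Ck_on k S f\<close> then says that
  all iterated directional derivatives of order at most \<open>k\<close> exist and are continuous.\<close>

primrec Ck_on :: "nat \<Rightarrow> 'a::real_normed_vector set \<Rightarrow> ('a \<Rightarrow> 'b::real_normed_vector) \<Rightarrow> bool"
where
  "Ck_on 0 S f \<longleftrightarrow> continuous_on S f"
| "Ck_on (Suc k) S f \<longleftrightarrow>
     (\<forall>x\<in>S. f differentiable at x) \<and> (\<forall>v. Ck_on k S (\<lambda>x. frechet_derivative f (at x) v))"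

definition smooth_map_on :: "'a::real_normed_vector set \<Rightarrow> ('a \<Rightarrow> 'b::real_normed_vector) \<Rightarrow> bool"
  where "smooth_map_on S f \<longleftrightarrow> (\<forall>k. Ck_on k S f)"

abbreviation deriv_at :: "('a::real_normed_vector \<Rightarrow> 'b::real_normed_vector) \<Rightarrow> 'a \<Rightarrow> 'a \<Rightarrow> 'b"
  where "deriv_at f v \<equiv> frechet_derivative f (at v)"

definition submanifold :: "nat \<Rightarrow> 'v::euclidean_space set \<Rightarrow> 'v set \<Rightarrow> bool"
  where "submanifold codim V N \<longleftrightarrow> N \<subseteq> V \<and>
    (\<forall>v\<in>N. \<exists>W (\<Phi> :: 'v \<Rightarrow> 'v) \<Psi> L.
       open W \<and> v \<in> W \<and> W \<subseteq> V \<and> open (\<Phi> ` W) \<and>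
       smooth_map_on W \<Phi> \<and> smooth_map_on (\<Phi> ` W) \<Psi> \<and> (\<forall>w\<in>W. \<Psi> (\<Phi> w) = w) \<and>
       subspace L \<and> dim L + codim = DIM('v) \<and> \<Phi> ` (N \<inter> W) = \<Phi> ` W \<inter> L)"

definition tangent_space :: "'v::real_normed_vector set \<Rightarrow> 'v \<Rightarrow> 'v set"
  where "tangent_space N v =
    {w. \<exists>\<gamma>. \<gamma> 0 = v \<and> (\<forall>\<^sub>F t in nhds 0. \<gamma> t \<in> N) \<and> (\<gamma> has_vector_derivative w) (at (0::real))}"


section \<open>The circle group and the torus\<close>

definition circle_group :: "complex monoid"
  where "circle_group = \<lparr>carrier = sphere 0 1, mult = (*), one = 1\<rparr>"

definition torus_group :: "(complex ^ 'n) monoid"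
  where "torus_group =
    \<lparr>carrier = {z. \<forall>j. z $ j \<in> sphere 0 1}, mult = (\<lambda>z w. \<chi> j. z $ j * w $ j), one = (\<chi> j. 1)\<rparr>"

definition torus_exp :: "real ^ 'n \<Rightarrow> complex ^ 'n"
  where "torus_exp \<theta> = (\<chi> j. cis (\<theta> $ j))"

definition circle_subgroup :: "(complex ^ 'n) set \<Rightarrow> bool"
  where "circle_subgroup S \<longleftrightarrow>
    (\<exists>f \<in> hom circle_group torus_group.
       continuous_on (sphere 0 1) f \<and> inj_on f (sphere 0 1) \<and> S = f ` sphere 0 1)"

text \<open>A connected finite covering group of a circle is again a circle, so the covering group is
  taken to be \<open>circle_group\<close> and only the covering homomorphism varies.\<close>

definition finite_covering_group :: "(complex ^ 'n) set \<Rightarrow> (complex \<Rightarrow> complex ^ 'n) \<Rightarrow> bool"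
  where "finite_covering_group S \<rho> \<longleftrightarrow>
    \<rho> \<in> hom circle_group torus_group \<and> covering_space (carrier circle_group) \<rho> S \<and>
    finite (kernel circle_group torus_group \<rho>)"


section \<open>Orbifolds\<close>

text \<open>A chart \<open>(U, V, H, p)\<close> with \<open>V\<close> an open subset of the Euclidean space \<open>'v\<close>.
  The group is not required to act effectively. The action is extensional (value \<open>undefined\<close>
  outside \<open>V\<close>), as demanded by \<^const>\<open>group_action\<close>.\<close>

record ('x, 'v, 'h) ochart =
  base :: "'x set"
  cover :: "'v set"
  chart_group :: "'h monoid"
  chart_act :: "'h \<Rightarrow> 'v \<Rightarrow> 'v"
  proj :: "'v \<Rightarrow> 'x"

definition orbifold_chart :: "('x::topological_space, 'v::euclidean_space, 'h) ochart \<Rightarrow> bool"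
  where "orbifold_chart c \<longleftrightarrow>
    open (base c) \<and> open (cover c) \<and> finite (carrier (chart_group c)) \<and>
    group_action (chart_group c) (cover c) (chart_act c) \<and>
    (\<forall>h \<in> carrier (chart_group c). smooth_map_on (cover c) (chart_act c h)) \<and>
    quotient_map (top_of_set (cover c)) (top_of_set (base c)) (proj c) \<and>
    (\<forall>v \<in> cover c. \<forall>w \<in> cover c.
       proj c v = proj c w \<longleftrightarrow> w \<in> orbit (chart_group c) (chart_act c) v)"

text \<open>\<open>(\<eta>, \<phi>)\<close> is an equivariant open embedding of the chart \<open>c\<close> into the chart \<open>c'\<close> lying over
  the map \<open>f\<close> of underlying spaces. The last condition is automatic for effective actions; in
  general it ensures that the isotropy groups computed in \<open>c\<close> and in \<open>c'\<close> agree.\<close>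

definition chart_embedding ::
  "('x \<Rightarrow> 'x) \<Rightarrow> ('x, 'v::euclidean_space, 'h) ochart \<Rightarrow> ('x, 'v, 'h) ochart \<Rightarrow>
   ('h \<Rightarrow> 'h) \<Rightarrow> ('v \<Rightarrow> 'v) \<Rightarrow> bool"
  where "chart_embedding f c c' \<eta> \<phi> \<longleftrightarrow>
    \<eta> \<in> hom (chart_group c) (chart_group c') \<and> inj_on \<eta> (carrier (chart_group c)) \<and>
    smooth_map_on (cover c) \<phi> \<and> inj_on \<phi> (cover c) \<and> \<phi> ` cover c \<subseteq> cover c' \<and>
    (\<forall>v \<in> cover c. inj (deriv_at \<phi> v)) \<and>
    (\<forall>v \<in> cover c. proj c' (\<phi> v) = f (proj c v)) \<and>
    (\<forall>h \<in> carrier (chart_group c). \<forall>v \<in> cover c.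
       \<phi> (chart_act c h v) = chart_act c' (\<eta> h) (\<phi> v)) \<and>
    (\<forall>v \<in> cover c. \<eta> ` stabilizer (chart_group c) (chart_act c) v =
       stabilizer (chart_group c') (chart_act c') (\<phi> v))"

definition compatible ::
  "('x::topological_space, 'v::euclidean_space, 'h) ochart \<Rightarrow> ('x, 'v, 'h) ochart \<Rightarrow> bool"
  where "compatible c c' \<longleftrightarrow>
    (\<forall>x \<in> base c \<inter> base c'. \<exists>b. orbifold_chart b \<and> x \<in> base b \<and>
       (\<exists>\<eta> \<phi>. chart_embedding id b c \<eta> \<phi>) \<and> (\<exists>\<eta> \<phi>. chart_embedding id b c' \<eta> \<phi>))"

definition orbifold :: "('x::t2_space, 'v::euclidean_space, 'h) ochart set \<Rightarrow> bool"
  where "orbifold A \<longleftrightarrow>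
    (\<forall>c\<in>A. orbifold_chart c) \<and> (\<Union>c\<in>A. base c) = UNIV \<and> (\<forall>c\<in>A. \<forall>c'\<in>A. compatible c c')"

text \<open>The charts of the orbifold: the maximal atlas determined by \<open>A\<close>.\<close>

definition charts ::
  "('x::topological_space, 'v::euclidean_space, 'h) ochart set \<Rightarrow> ('x, 'v, 'h) ochart set"
  where "charts A = {c. orbifold_chart c \<and> (\<forall>a\<in>A. compatible c a)}"

definition reduced_chart ::
  "('x::topological_space, 'v::euclidean_space, 'h) ochart set \<Rightarrow> 'x \<Rightarrow> ('x, 'v, 'h) ochart \<Rightarrow> bool"
  where "reduced_chart A x c \<longleftrightarrow>
    c \<in> charts A \<and> x \<in> base c \<and> (\<exists>v. {w \<in> cover c. proj c w = x} = {v})"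

text \<open>Well defined up to isomorphism: reduced charts around \<open>x\<close> exist, and any two of them have
  isomorphic groups.\<close>

definition isotropy_group ::
  "('x::topological_space, 'v::euclidean_space, 'h) ochart set \<Rightarrow> 'x \<Rightarrow> 'h monoid"
  where "isotropy_group A x = chart_group (SOME c. reduced_chart A x c)"

definition multiplicity ::
  "('x::topological_space, 'v::euclidean_space, 'h) ochart set \<Rightarrow> 'x \<Rightarrow> nat"
  where "multiplicity A x = order (isotropy_group A x)"

definition min_multiplicity ::
  "('x::topological_space, 'v::euclidean_space, 'h) ochart set \<Rightarrow> nat"
  where "min_multiplicity A = (INF x. multiplicity A x)"

definition chart_preimage :: "('x, 'v, 'h) ochart \<Rightarrow> 'x set \<Rightarrow> 'v set"
  where "chart_preimage c N = {v \<in> cover c. proj c v \<in> N}"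

definition suborbifold ::
  "('x::topological_space, 'v::euclidean_space, 'h) ochart set \<Rightarrow> nat \<Rightarrow> 'x set \<Rightarrow> bool"
  where "suborbifold A codim N \<longleftrightarrow>
    (\<forall>c \<in> charts A. submanifold codim (cover c) (chart_preimage c N) \<and>
       (\<forall>h \<in> carrier (chart_group c).
          chart_act c h ` chart_preimage c N \<subseteq> chart_preimage c N))"

text \<open>The charts of a suborbifold \<open>N\<close> are \<open>(N \<inter> U, p\<inverse>(N \<inter> U), H, p)\<close>, with the same groups, and
  such a chart is reduced around \<open>x \<in> N\<close> iff \<open>(U, V, H, p)\<close> is. Hence the multiplicity of \<open>x\<close>
  in the orbifold \<open>N\<close> is its multiplicity in the ambient orbifold.\<close>

definition principal_stratum ::
  "('x::topological_space, 'v::euclidean_space, 'h) ochart set \<Rightarrow> 'x set \<Rightarrow> 'x set"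
  where "principal_stratum A N =
    {x \<in> N. multiplicity A x = (INF y \<in> connected_component_set N x. multiplicity A y)}"


section \<open>Orientations\<close>

text \<open>An orientation assigns to each point of each chart a sign, relative to the standard
  orientation of the coordinate space. Applied to the self-embeddings given by the elements
  of a chart group, the last condition says that these groups preserve the orientation.\<close>

definition orbifold_orientation ::
  "('x::topological_space, real ^ 'm, 'h) ochart set \<Rightarrow>
   (('x, real ^ 'm, 'h) ochart \<Rightarrow> real ^ 'm \<Rightarrow> real) \<Rightarrow> bool"
  where "orbifold_orientation A ori \<longleftrightarrow>
    (\<forall>c \<in> charts A. continuous_on (cover c) (ori c) \<and> ori c ` cover c \<subseteq> {-1, 1}) \<and>
    (\<forall>c \<in> charts A. \<forall>c' \<in> charts A. \<forall>\<eta> \<phi>. chart_embedding id c c' \<eta> \<phi> \<longrightarrow>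
       (\<forall>v \<in> cover c. ori c' (\<phi> v) = sgn (det (matrix (deriv_at \<phi> v))) * ori c v))"

text \<open>An orientation of the two-dimensional quotient of the whole space by a subspace \<open>W\<close>,
  encoded as the sign of an area form on that quotient.\<close>

definition quotient_plane_orientation ::
  "'v::euclidean_space set \<Rightarrow> ('v \<Rightarrow> 'v \<Rightarrow> real) \<Rightarrow> bool"
  where "quotient_plane_orientation W s \<longleftrightarrow>
    (\<exists>\<omega> :: 'v \<Rightarrow> 'v \<Rightarrow> real. bilinear \<omega> \<and> (\<forall>a. \<omega> a a = 0) \<and>
       (\<forall>a b. \<omega> a b = 0 \<longleftrightarrow> (\<exists>p q. (p, q) \<noteq> (0, 0) \<and> p *\<^sub>R a + q *\<^sub>R b \<in> W)) \<and>
       (\<forall>a b. s a b = sgn (\<omega> a b)))"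

text \<open>An orientation of the normal bundle of a codimension-two suborbifold \<open>N\<close>: the fibre at \<open>v\<close>
  is the quotient of the tangent space at \<open>v\<close> by the tangent space of the preimage of \<open>N\<close>,
  which is identified with any invariant complement. The three conditions are: fibrewise
  orientation, continuity, compatibility with chart embeddings.\<close>

definition normal_bundle_orientation ::
  "('x::topological_space, 'v::euclidean_space, 'h) ochart set \<Rightarrow> 'x set \<Rightarrow>
   (('x, 'v, 'h) ochart \<Rightarrow> 'v \<Rightarrow> 'v \<Rightarrow> 'v \<Rightarrow> real) \<Rightarrow> bool"
  where "normal_bundle_orientation A N \<nu> \<longleftrightarrow>
    (\<forall>c \<in> charts A. \<forall>v \<in> chart_preimage c N.
       quotient_plane_orientation (tangent_space (chart_preimage c N) v) (\<nu> c v)) \<and>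
    (\<forall>c \<in> charts A. \<forall>v \<in> chart_preimage c N. \<forall>a b. \<nu> c v a b = 1 \<longrightarrow>
       (\<forall>\<^sub>F w in at v within chart_preimage c N. \<nu> c w a b = 1)) \<and>
    (\<forall>c \<in> charts A. \<forall>c' \<in> charts A. \<forall>\<eta> \<phi>. chart_embedding id c c' \<eta> \<phi> \<longrightarrow>
       (\<forall>v \<in> chart_preimage c N. \<forall>a b.
          \<nu> c' (\<phi> v) (deriv_at \<phi> v a) (deriv_at \<phi> v b) = \<nu> c v a b))"

definition isotropy_preserves_normal_orientation ::
  "('x::topological_space, 'v::euclidean_space, 'h) ochart set \<Rightarrow> 'x set \<Rightarrow>
   (('x, 'v, 'h) ochart \<Rightarrow> 'v \<Rightarrow> 'v \<Rightarrow> 'v \<Rightarrow> real) \<Rightarrow> bool"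
  where "isotropy_preserves_normal_orientation A N \<nu> \<longleftrightarrow>
    (\<forall>x \<in> N. \<forall>c. reduced_chart A x c \<longrightarrow>
       (\<forall>v \<in> cover c. proj c v = x \<longrightarrow> (\<forall>h \<in> carrier (chart_group c). \<forall>a b.
          \<nu> c v (deriv_at (chart_act c h) v a) (deriv_at (chart_act c h) v b) = \<nu> c v a b)))"


section \<open>Torus actions and torus orbifolds\<close>

text \<open>The action map \<open>T \<times> M \<rightarrow> M\<close> is required to be a smooth map of orbifolds: it has smooth local
  lifts \<open>F\<close> to charts, where the coordinate on \<open>T\<close> is supplied by \<^const>\<open>torus_exp\<close>.\<close>

definition smooth_torus_action ::
  "('x::topological_space, 'v::euclidean_space, 'h) ochart set \<Rightarrow> (complex ^ 'n \<Rightarrow> 'x \<Rightarrow> 'x) \<Rightarrow> bool"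
  where "smooth_torus_action A act \<longleftrightarrow>
    group_action torus_group UNIV act \<and>
    (\<forall>(\<theta>\<^sub>0 :: real ^ 'n) x. \<exists>c \<in> charts A. \<exists>c' \<in> charts A. \<exists>e > 0. \<exists>F \<eta>. x \<in> base c \<and>
       smooth_map_on (ball \<theta>\<^sub>0 e \<times> cover c) (\<lambda>(\<theta>, v). F \<theta> v) \<and>
       (\<forall>\<theta> \<in> ball \<theta>\<^sub>0 e. chart_embedding (act (torus_exp \<theta>)) c c' \<eta> (F \<theta>)))"

definition fixed_set :: "(complex ^ 'n \<Rightarrow> 'x \<Rightarrow> 'x) \<Rightarrow> (complex ^ 'n) set \<Rightarrow> 'x set"
  where "fixed_set act S = {x. \<forall>t\<in>S. act t x = x}"

abbreviation torus_fixed :: "(complex ^ 'n \<Rightarrow> 'x \<Rightarrow> 'x) \<Rightarrow> 'x set"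
  where "torus_fixed act \<equiv> fixed_set act (carrier torus_group)"

definition characteristic_suborbifold ::
  "('x::topological_space, 'v::euclidean_space, 'h) ochart set \<Rightarrow> (complex ^ 'n \<Rightarrow> 'x \<Rightarrow> 'x) \<Rightarrow>
   'x set \<Rightarrow> bool"
  where "characteristic_suborbifold A act N \<longleftrightarrow>
    suborbifold A 2 N \<and> N \<inter> torus_fixed act \<noteq> {} \<and>
    (\<exists>S. circle_subgroup S \<and> N \<in> components (fixed_set act S))"

text \<open>The underlying space is the whole type \<open>'x\<close>. The characteristic suborbifolds are \<open>Mc 1, \<dots>, Mc d\<close>,
  with circle subgroups \<open>Sc i\<close> and preferred normal orientations \<open>\<nu> i\<close>.\<close>

locale torus_orbifold =
  fixes A :: "('x::t2_space, real ^ 'm, 'h) ochart set"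
    and ori :: "('x, real ^ 'm, 'h) ochart \<Rightarrow> real ^ 'm \<Rightarrow> real"
    and act :: "complex ^ 'n \<Rightarrow> 'x \<Rightarrow> 'x"
    and d :: nat
    and Mc :: "nat \<Rightarrow> 'x set"
    and Sc :: "nat \<Rightarrow> (complex ^ 'n) set"
    and \<nu> :: "nat \<Rightarrow> ('x, real ^ 'm, 'h) ochart \<Rightarrow> real ^ 'm \<Rightarrow> real ^ 'm \<Rightarrow> real ^ 'm \<Rightarrow> real"
  assumes orbifold: "orbifold A"
    and dimension: "CARD('m) = 2 * CARD('n)"
    and connected_space: "connected (UNIV :: 'x set)"
    and compact_space: "compact (UNIV :: 'x set)"
    and orientation: "orbifold_orientation A ori"
    and smooth_action: "smooth_torus_action A act"
    and effective: "faithful_action torus_group UNIV act"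
    and fixed_point: "torus_fixed act \<noteq> {}"
    and characteristic: "bij_betw Mc {1..d} {N. characteristic_suborbifold A act N}"
    and circles: "\<And>i. i \<in> {1..d} \<Longrightarrow> circle_subgroup (Sc i) \<and> Mc i \<subseteq> fixed_set act (Sc i)"
    and normal_orientation: "\<And>i. i \<in> {1..d} \<Longrightarrow> normal_bundle_orientation A (Mc i) (\<nu> i)"
    and isotropy_preserves:
      "\<And>i. i \<in> {1..d} \<Longrightarrow> isotropy_preserves_normal_orientation A (Mc i) (\<nu> i)"


section \<open>Minimal coverings of the circle subgroups\<close>

definition disk_chart ::
  "('x::topological_space, 'v::euclidean_space, 'h) ochart set \<Rightarrow> 'x \<Rightarrow> ('x, 'v, 'h) ochart \<Rightarrow> bool"
  where "disk_chart A x c \<longleftrightarrow>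
    reduced_chart A x c \<and> (\<exists>r > 0. cover c = ball 0 r) \<and> proj c 0 = x \<and>
    (\<forall>h \<in> carrier (chart_group c). \<exists>L. linear L \<and> (\<forall>v \<in> cover c. chart_act c h v = L v))"

text \<open>The action of the image of \<open>\<rho>\<close> on \<open>U\<close> lifts along \<open>\<rho>\<close> to a smooth action \<open>\<psi>\<close> of the circle
  on \<open>V\<close>; in particular \<open>U\<close> is invariant under that image.\<close>

definition action_lifts ::
  "(complex ^ 'n \<Rightarrow> 'x \<Rightarrow> 'x) \<Rightarrow> (complex \<Rightarrow> complex ^ 'n) \<Rightarrow>
   ('x, 'v::euclidean_space, 'h) ochart \<Rightarrow> bool"
  where "action_lifts act \<rho> c \<longleftrightarrow>
    (\<exists>\<psi>. group_action circle_group (cover c) \<psi> \<and>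
       smooth_map_on (UNIV \<times> cover c) (\<lambda>(\<theta> :: real, v). \<psi> (cis \<theta>) v) \<and>
       (\<forall>z \<in> carrier circle_group. \<forall>v \<in> cover c. proj c (\<psi> z v) = act (\<rho> z) (proj c v)))"

definition lifting_covering ::
  "('x::topological_space, 'v::euclidean_space, 'h) ochart set \<Rightarrow> (complex ^ 'n \<Rightarrow> 'x \<Rightarrow> 'x) \<Rightarrow>
   'x set \<Rightarrow> (complex ^ 'n) set \<Rightarrow> (complex \<Rightarrow> complex ^ 'n) \<Rightarrow> bool"
  where "lifting_covering A act N S \<rho> \<longleftrightarrow>
    finite_covering_group S \<rho> \<and> (\<forall>x\<in>N. \<exists>c. disk_chart A x c \<and> action_lifts act \<rho> c)"

text \<open>Minimality refers to the degree of the covering, which is the order of its kernel.\<close>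

definition minimal_lifting_covering ::
  "('x::topological_space, 'v::euclidean_space, 'h) ochart set \<Rightarrow> (complex ^ 'n \<Rightarrow> 'x \<Rightarrow> 'x) \<Rightarrow>
   'x set \<Rightarrow> (complex ^ 'n) set \<Rightarrow> (complex \<Rightarrow> complex ^ 'n) \<Rightarrow> bool"
  where "minimal_lifting_covering A act N S \<rho> \<longleftrightarrow>
    lifting_covering A act N S \<rho> \<and>
    (\<forall>\<sigma>. lifting_covering A act N S \<sigma> \<longrightarrow>
       card (kernel circle_group torus_group \<rho>) \<le> card (kernel circle_group torus_group \<sigma>))"


section \<open>Sigma, and the groups associated with its members\<close>

text \<open>The empty set belongs to \<open>Sigma_set\<close> whenever \<open>T\<close> has a fixed point, since \<open>M_inter Mc {}\<close>
  is the whole space.\<close>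

definition M_inter :: "(nat \<Rightarrow> 'x set) \<Rightarrow> nat set \<Rightarrow> 'x set"
  where "M_inter Mc I = (\<Inter>i\<in>I. Mc i)"

definition Sigma_set :: "(complex ^ 'n \<Rightarrow> 'x \<Rightarrow> 'x) \<Rightarrow> nat \<Rightarrow> (nat \<Rightarrow> 'x set) \<Rightarrow> nat set set"
  where "Sigma_set act d Mc = {I. I \<subseteq> {1..d} \<and> M_inter Mc I \<inter> torus_fixed act \<noteq> {}} \<union> {{}}"

definition Sigma_k :: "(complex ^ 'n \<Rightarrow> 'x \<Rightarrow> 'x) \<Rightarrow> nat \<Rightarrow> (nat \<Rightarrow> 'x set) \<Rightarrow> nat \<Rightarrow> nat set set"
  where "Sigma_k act d Mc k = {I \<in> Sigma_set act d Mc. card I = k}"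

definition cover_torus :: "nat set \<Rightarrow> (nat \<Rightarrow> complex) monoid"
  where "cover_torus I = product_group I (\<lambda>i. circle_group)"

definition cover_torus_hom ::
  "(nat \<Rightarrow> complex \<Rightarrow> complex ^ 'n) \<Rightarrow> nat set \<Rightarrow> (nat \<Rightarrow> complex) \<Rightarrow> complex ^ 'n"
  where "cover_torus_hom \<rho> I z = finprod torus_group (\<lambda>i. \<rho> i (z i)) I"

definition kernel_group :: "(nat \<Rightarrow> complex \<Rightarrow> complex ^ 'n) \<Rightarrow> nat set \<Rightarrow> (nat \<Rightarrow> complex) monoid"
  where "kernel_group \<rho> I =
    cover_torus I \<lparr>carrier := kernel (cover_torus I) torus_group (cover_torus_hom \<rho> I)\<rparr>"

end

theory Submission
  imports Defs "HOL-Algebra.Multiplicative_Group"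
begin

text \<open>Fix a reduced chart around \<open>x\<close> and let \<open>v\<close> be the point over \<open>x\<close>. Elements of the torus
  fixing \<open>x\<close> lift to germs of diffeomorphisms at \<open>v\<close>, uniquely up to the chart group, and a germ
  lifting the identity has the same derivative at \<open>v\<close> as an element of that finite group. A finite-order
  germ with trivial derivative is trivial, and triviality propagates over the connected space; so the
  effectivity of the torus action and \<open>d(M) = 1\<close> make everything detectable on derivatives at \<open>v\<close>.

  For \<open>i \<in> I\<close> the lifted action of the covering circle \<open>S\<^sub>i\<close> fixes the tangent space \<open>W\<^sub>i\<close> of \<open>M\<^sub>i\<close>
  and, by minimality of the covering, acts effectively, hence as the full rotation group on a normal
  plane \<open>V\<^sub>i\<close>. Lifts along a connected group commute with all other lifts, since commutators have
  derivatives in a finite set; therefore \<open>V\<^sub>i\<close> is contained in \<open>W\<^sub>j\<close> for \<open>i \<noteq> j\<close>, and every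
  element of the chart group acts on each \<open>V\<^sub>i\<close> as a rotation.
  If \<open>x\<close> is principal in \<open>M\<^sub>I\<close>, the chart group fixes the intersection of the \<open>W\<^sub>i\<close>,
  so an element \<open>h\<close> is determined by the rotations \<open>z\<^sub>i\<close> it induces on the planes \<open>V\<^sub>i\<close>, and
  the tuples \<open>(z\<^sub>i)\<close> that occur are those for which the product of the lifts of the
  \<open>\<rho>\<^sub>i(z\<^sub>i)\<close> covers the identity, that is, the kernel of \<open>\<rho>\<^sub>I\<close>.\<close>

section \<open>Continuously differentiable maps\<close>

text \<open>Two difficulties shape the argument. A lift of a torus element is only a germ, and
  comparing two lifts produces at each nearby point a chart group element that may change from point
  to point. Finite closed covers, together with the fact that differing from a given 1-jet (value
  and derivative) is an open condition, turn such a varying choice into one group element that is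
  correct to first order at the point considered. Moreover, a trivial derivative forces a germ to be
  trivial only if the germ is known to have finite order. The torus action is not linearized, so
  facts about torus elements are proved for torsion elements and then extended: by density of the
  roots of unity, or because a closed subgroup of the circle without torsion is trivial. In the
  final comparison the torus element is torsion anyway, since chart groups are finite. The normal
  plane is the eigenspace of -1 for the lift of -1, a complement of the tangent space that requires
  no invariant metric.\<close>

lemma Ck_on_cong:
  assumes "open S" "\<And>x. x \<in> S \<Longrightarrow> f x = g x" "Ck_on k S f"
  shows "Ck_on k S g"
  using assms(2,3)
proof (induction k arbitrary: f g)
  case 0
  then show ?case using continuous_on_eq[of S f g] by simp
next
  case (Suc k)
  have D: "(g has_derivative deriv_at f x) (at x)" if "x \<in> S" for x
    by (rule has_derivative_transform_within_open[OF _ assms(1) that, of f])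
       (use Suc.prems that in \<open>auto simp: frechet_derivative_works[symmetric]\<close>)
  then have eq: "deriv_at g x = deriv_at f x" if "x \<in> S" for x
    using that frechet_derivative_at by metis
  have "g differentiable at x" if "x \<in> S" for x
    using differentiableI[OF D[OF that]] .
  moreover have "Ck_on k S (\<lambda>x. deriv_at g x v)" for v
    by (rule Suc.IH[of "\<lambda>x. deriv_at f x v"]) (use Suc.prems eq in auto)
  ultimately show ?case by auto
qed

lemma Ck_on_subset: "Ck_on k S f \<Longrightarrow> T \<subseteq> S \<Longrightarrow> Ck_on k T f"
  by (induction k arbitrary: f) (auto intro: continuous_on_subset)

lemma Ck_on_imp_continuous_on: "Ck_on k S f \<Longrightarrow> continuous_on S f"
  by (cases k) (auto intro!: continuous_at_imp_continuous_on differentiable_imp_continuous_within)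

lemma Ck_on_SucD: "Ck_on (Suc k) S f \<Longrightarrow> Ck_on k S f"
proof (induction k arbitrary: f)
  case 0
  then show ?case using Ck_on_imp_continuous_on Ck_on.simps(1) by blast
qed auto

lemma Ck_on_const: "Ck_on k S (\<lambda>x. c)"
  by (induction k arbitrary: c) auto

lemma Ck_on_add:
  assumes "open S" "Ck_on k S f" "Ck_on k S g"
  shows "Ck_on k S (\<lambda>x. f x + g x)"
  using assms(2,3)
proof (induction k arbitrary: f g)
  case (Suc k)
  have D: "((\<lambda>x. f x + g x) has_derivative (\<lambda>v. deriv_at f x v + deriv_at g x v)) (at x)"
    if "x \<in> S" for x
    using Suc.prems that by (intro has_derivative_add) (auto simp: frechet_derivative_works[symmetric])
  have eq: "deriv_at (\<lambda>x. f x + g x) x v = deriv_at f x v + deriv_at g x v" if "x \<in> S" for x v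
    using fun_cong[OF frechet_derivative_at[OF D[OF that]], of v] by simp
  have "Ck_on k S (\<lambda>x. deriv_at (\<lambda>x. f x + g x) x v)" for v
    by (rule Ck_on_cong[OF assms(1), of "\<lambda>x. deriv_at f x v + deriv_at g x v"])
       (use Suc eq in auto)
  moreover have "\<forall>x\<in>S. (\<lambda>x. f x + g x) differentiable at x"
    using differentiableI[OF D] by blast
  ultimately show ?case unfolding Ck_on.simps by (intro conjI allI)
qed (auto intro: continuous_intros)

lemma Ck_on_sum:
  assumes "open S" "finite B" "\<And>b. b \<in> B \<Longrightarrow> Ck_on k S (f b)"
  shows "Ck_on k S (\<lambda>x. \<Sum>b\<in>B. f b x)"
  using assms(2,3) by (induction B) (auto intro: Ck_on_const Ck_on_add assms(1))

lemma Ck_on_bounded_linear: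
  assumes "open S" "bounded_linear L" "Ck_on k S f"
  shows "Ck_on k S (\<lambda>x. L (f x))"
  using assms(3)
proof (induction k arbitrary: f)
  case 0
  then show ?case using assms(2) by (auto intro: bounded_linear.continuous_on)
next
  case (Suc k)
  have D: "((\<lambda>x. L (f x)) has_derivative (\<lambda>v. L (deriv_at f x v))) (at x)"
    if "x \<in> S" for x
    using Suc.prems that
    by (intro bounded_linear.has_derivative[OF assms(2)]) (auto simp: frechet_derivative_works[symmetric])
  have eq: "deriv_at (\<lambda>x. L (f x)) x v = L (deriv_at f x v)" if "x \<in> S" for x v
    using fun_cong[OF frechet_derivative_at[OF D[OF that]], of v] by simp
  have "Ck_on k S (\<lambda>x. deriv_at (\<lambda>x. L (f x)) x v)" for v
    by (rule Ck_on_cong[OF assms(1), of "\<lambda>x. L (deriv_at f x v)"])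
       (use Suc eq in auto)
  moreover have "\<forall>x\<in>S. (\<lambda>x. L (f x)) differentiable at x"
    using differentiableI[OF D] by blast
  ultimately show ?case unfolding Ck_on.simps by (intro conjI allI)
qed

lemma Ck_on_scaleR:
  fixes f :: "'a::real_normed_vector \<Rightarrow> real"
  assumes "open S" "Ck_on k S f" "Ck_on k S g"
  shows "Ck_on k S (\<lambda>x. f x *\<^sub>R g x)"
  using assms(2,3)
proof (induction k arbitrary: f g)
  case (Suc k)
  have D: "((\<lambda>x. f x *\<^sub>R g x) has_derivative (\<lambda>v. f x *\<^sub>R deriv_at g x v + deriv_at f x v *\<^sub>R g x)) (at x)"
    if "x \<in> S" for x
    using Suc.prems that by (intro has_derivative_scaleR) (auto simp: frechet_derivative_works[symmetric])
  have eq: "deriv_at (\<lambda>x. f x *\<^sub>R g x) x v = f x *\<^sub>R deriv_at g x v + deriv_at f x v *\<^sub>R g x" if "x \<in> S" for x v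
    using fun_cong[OF frechet_derivative_at[OF D[OF that]], of v] by simp
  have "Ck_on k S (\<lambda>x. deriv_at (\<lambda>x. f x *\<^sub>R g x) x v)" for v
  proof (rule Ck_on_cong[OF assms(1), of "\<lambda>x. f x *\<^sub>R deriv_at g x v + deriv_at f x v *\<^sub>R g x"])
    show "Ck_on k S (\<lambda>x. f x *\<^sub>R deriv_at g x v + deriv_at f x v *\<^sub>R g x)"
      by (intro Ck_on_add assms Suc.IH) (use Suc.prems in \<open>auto intro: Ck_on_SucD simp del: Ck_on.simps\<close>, (use Suc.prems in auto))
  qed (use eq in auto)
  moreover have "\<forall>x\<in>S. (\<lambda>x. f x *\<^sub>R g x) differentiable at x"
    using differentiableI[OF D] by blast
  ultimately show ?case unfolding Ck_on.simps by (intro conjI allI)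
qed (auto intro: continuous_intros)

text \<open>The chain rule differentiates \<open>f\<close> in a direction that moves with the point,
  whereas \<open>Ck_on\<close> knows only fixed directions. Expanding the direction in
  \<open>Basis\<close> leaves finitely many fixed directions with varying coefficients, to which
  sums and products apply.\<close>

lemma Ck_on_compose:
  fixes f :: "'b::euclidean_space \<Rightarrow> 'c::real_normed_vector"
    and g :: "'a::real_normed_vector \<Rightarrow> 'b"
  assumes "open S" "open T" "g ` S \<subseteq> T" "Ck_on k S g" "Ck_on k T f"
  shows "Ck_on k S (\<lambda>x. f (g x))"
  using assms(4,5)
proof (induction k arbitrary: f)
  case 0
  then show ?case using assms(3) by (auto intro: continuous_on_compose2)
next
  case (Suc k)
  have D: "((\<lambda>x. f (g x)) has_derivative (\<lambda>v. deriv_at f (g x) (deriv_at g x v))) (at x)"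
    if "x \<in> S" for x
    using Suc.prems that assms(3)
    by (intro has_derivative_compose[of g _ x UNIV f, simplified]) (auto simp: frechet_derivative_works[symmetric])
  have lin: "linear (deriv_at f (g x))" if "x \<in> S" for x
    using Suc.prems that assms(3) linear_frechet_derivative by fastforce
  have *: "deriv_at (\<lambda>x. f (g x)) x v = (\<Sum>b\<in>Basis. (deriv_at g x v \<bullet> b) *\<^sub>R deriv_at f (g x) b)"
    if "x \<in> S" for x v
  proof -
    have "deriv_at (\<lambda>x. f (g x)) x v = deriv_at f (g x) (deriv_at g x v)"
      using frechet_derivative_at[OF D[OF that]] by (metis)
    also have "\<dots> = deriv_at f (g x) (\<Sum>b\<in>Basis. (deriv_at g x v \<bullet> b) *\<^sub>R b)"
      by (simp add: euclidean_representation)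
    also have "\<dots> = (\<Sum>b\<in>Basis. (deriv_at g x v \<bullet> b) *\<^sub>R deriv_at f (g x) b)"
      using lin[OF that] by (simp add: linear_sum linear_cmul)
    finally show ?thesis .
  qed
  have g: "Ck_on k S g" using Suc.prems Ck_on_SucD by blast
  have "Ck_on k S (\<lambda>x. deriv_at (\<lambda>x. f (g x)) x v)" for v
  proof (rule Ck_on_cong[OF assms(1), of "\<lambda>x. \<Sum>b\<in>Basis. (deriv_at g x v \<bullet> b) *\<^sub>R deriv_at f (g x) b"])
    have "Ck_on k S (\<lambda>x. deriv_at f (g x) b)" for b
      by (rule Suc.IH[of "\<lambda>y. deriv_at f y b"]) (use g Suc.prems in auto)
    moreover have "Ck_on k S (\<lambda>x. deriv_at g x v \<bullet> b)" for b
      by (rule Ck_on_bounded_linear[OF assms(1) bounded_linear_inner_left]) (use Suc.prems in auto)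
    ultimately show "Ck_on k S (\<lambda>x. \<Sum>b\<in>Basis. (deriv_at g x v \<bullet> b) *\<^sub>R deriv_at f (g x) b)"
      by (intro Ck_on_sum Ck_on_scaleR assms(1)) auto
  qed (simp add: *)
  moreover have "\<forall>x\<in>S. (\<lambda>x. f (g x)) differentiable at x"
    using differentiableI[OF D] by blast
  ultimately show ?case unfolding Ck_on.simps by (intro conjI allI)
qed

lemma smooth_map_on_compose:
  fixes f :: "'b::euclidean_space \<Rightarrow> 'c::real_normed_vector"
    and g :: "'a::real_normed_vector \<Rightarrow> 'b"
  assumes "open S" "open T" "g ` S \<subseteq> T" "smooth_map_on S g" "smooth_map_on T f"
  shows "smooth_map_on S (\<lambda>x. f (g x))"
  using assms Ck_on_compose unfolding smooth_map_on_def by blast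

lemma smooth_map_on_subset: "smooth_map_on S f \<Longrightarrow> T \<subseteq> S \<Longrightarrow> smooth_map_on T f"
  using Ck_on_subset unfolding smooth_map_on_def by blast

lemma smooth_map_on_cong:
  "open S \<Longrightarrow> (\<And>x. x \<in> S \<Longrightarrow> f x = g x) \<Longrightarrow> smooth_map_on S f \<Longrightarrow> smooth_map_on S g"
  using Ck_on_cong unfolding smooth_map_on_def by blast

lemma smooth_map_on_bounded_linear:
  assumes "bounded_linear L" shows "smooth_map_on S L"
proof -
  have D: "deriv_at L x = L" for x
    using frechet_derivative_at[OF bounded_linear_imp_has_derivative[OF assms]] by metis
  have "Ck_on k S L" for k
    using assms
    by (cases k) (auto simp: D Ck_on_const linear_continuous_on bounded_linear_imp_differentiable)
  then show ?thesis by (simp add: smooth_map_on_def)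
qed

lemma smooth_map_on_imp_continuous_on: "smooth_map_on S f \<Longrightarrow> continuous_on S f"
  using Ck_on_imp_continuous_on smooth_map_on_def by blast

section \<open>Germs of C1 maps, with derivative continuous in operator norm, and their local
  inverses\<close>

definition C1_at :: "('a::real_normed_vector \<Rightarrow> 'b::real_normed_vector) \<Rightarrow> 'a \<Rightarrow> bool"
  where "C1_at f v \<longleftrightarrow> (\<exists>S (f' :: 'a \<Rightarrow> 'a \<Rightarrow>\<^sub>L 'b). open S \<and> v \<in> S \<and>
    (\<forall>x\<in>S. (f has_derivative blinfun_apply (f' x)) (at x)) \<and> continuous_on S f')"

text \<open>In finite dimension, continuity of each directional derivative already gives continuity
  of the derivative in operator norm, the form that the inverse function theorem uses.\<close>

lemma smooth_map_on_imp_C1_at: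
  fixes f :: "'a::euclidean_space \<Rightarrow> 'b::real_normed_vector"
  assumes "open S" "smooth_map_on S f" "v \<in> S"
  shows "C1_at f v"
proof -
  have 1: "Ck_on (Suc 0) S f" using assms smooth_map_on_def by blast
  define f' where "f' x = Blinfun (deriv_at f x)" for x
  have D: "(f has_derivative deriv_at f x) (at x)" if "x \<in> S" for x
    using 1 that frechet_derivative_works by auto
  then have f': "blinfun_apply (f' x) = deriv_at f x" if "x \<in> S" for x
    using that has_derivative_bounded_linear bounded_linear_Blinfun_apply unfolding f'_def by blast
  have "continuous_on S f'"
  proof (rule continuous_on_blinfun_componentwise)
    fix i :: 'a
    have "continuous_on S (\<lambda>x. deriv_at f x i)" using 1 by auto
    then show "continuous_on S (\<lambda>x. blinfun_apply (f' x) i)"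
      by (rule continuous_on_eq) (simp add: f')
  qed
  with D f' assms show ?thesis unfolding C1_at_def by metis
qed

lemma C1_at_has_derivative: "C1_at f v \<Longrightarrow> (f has_derivative deriv_at f v) (at v)"
  unfolding C1_at_def using frechet_derivative_at by metis

lemma C1_at_linear_deriv: "C1_at f v \<Longrightarrow> linear (deriv_at f v)"
  using C1_at_has_derivative has_derivative_linear by blast

lemma C1_at_isCont: "C1_at f v \<Longrightarrow> isCont f v"
  using C1_at_has_derivative has_derivative_continuous by blast

lemma C1_at_eventually: "C1_at f v \<Longrightarrow> eventually (C1_at f) (nhds v)"
  unfolding C1_at_def eventually_nhds by blast

lemma C1_at_deriv_tendsto:
  assumes "C1_at f v" shows "((\<lambda>x. deriv_at f x u) \<longlongrightarrow> deriv_at f v u) (nhds v)"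
proof -
  obtain S f' where S: "open S" "v \<in> S" "\<And>x. x \<in> S \<Longrightarrow> (f has_derivative blinfun_apply (f' x)) (at x)"
    "continuous_on S f'"
    using assms unfolding C1_at_def by blast
  have eq: "deriv_at f x = blinfun_apply (f' x)" if "x \<in> S" for x
    using S(3)[OF that] frechet_derivative_at by metis
  have "isCont f' v" using S continuous_on_eq_continuous_at by blast
  then have "(f' \<longlongrightarrow> f' v) (nhds v)" by (simp add: continuous_at tendsto_at_iff_tendsto_nhds)
  then have "((\<lambda>x. blinfun_apply (f' x) u) \<longlongrightarrow> blinfun_apply (f' v) u) (nhds v)"
    by (intro tendsto_intros)
  then show ?thesis
    unfolding eq[OF S(2)]
    by (rule tendsto_cong[THEN iffD1, rotated]) (use S eq in \<open>auto simp: eventually_nhds\<close>)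
qed

lemma C1_at_cong:
  assumes "C1_at f v" "eventually (\<lambda>x. f x = g x) (nhds v)"
  shows "C1_at g v" "deriv_at g v = deriv_at f v"
proof -
  obtain S f' where S: "open S" "v \<in> S" "\<And>x. x \<in> S \<Longrightarrow> (f has_derivative blinfun_apply (f' x)) (at x)"
    "continuous_on S f'"
    using assms unfolding C1_at_def by blast
  obtain T where T: "open T" "v \<in> T" "\<And>x. x \<in> T \<Longrightarrow> f x = g x"
    using assms(2) unfolding eventually_nhds by blast
  have "(g has_derivative blinfun_apply (f' x)) (at x)" if "x \<in> S \<inter> T" for x
    by (rule has_derivative_transform_within_open[of f _ x UNIV "S \<inter> T"]) (use S T that in auto)
  moreover have "continuous_on (S \<inter> T) f'" using S(4) continuous_on_subset by blast
  ultimately show "C1_at g v" unfolding C1_at_def using S T by blast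
  have "(g has_derivative deriv_at f v) (at v)"
    by (rule has_derivative_transform_within_open[of f _ v UNIV T]) (use T C1_at_has_derivative assms in auto)
  then show "deriv_at g v = deriv_at f v" using frechet_derivative_at by metis
qed

lemma C1_at_compose:
  assumes "C1_at g v" "C1_at f (g v)"
  shows "C1_at (\<lambda>x. f (g x)) v" "deriv_at (\<lambda>x. f (g x)) v = (\<lambda>u. deriv_at f (g v) (deriv_at g v u))"
proof -
  obtain S g' where S: "open S" "v \<in> S" "\<And>x. x \<in> S \<Longrightarrow> (g has_derivative blinfun_apply (g' x)) (at x)"
    "continuous_on S g'"
    using assms unfolding C1_at_def by blast
  obtain T f' where T: "open T" "g v \<in> T" "\<And>x. x \<in> T \<Longrightarrow> (f has_derivative blinfun_apply (f' x)) (at x)"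
    "continuous_on T f'"
    using assms unfolding C1_at_def by blast
  have cg: "continuous_on S g"
    using S(1,3) has_derivative_continuous continuous_at_imp_continuous_on by blast
  define R where "R = S \<inter> g -` T"
  have R: "open R" "v \<in> R"
    using continuous_open_preimage[OF cg S(1) T(1)] S T unfolding R_def by auto
  have "((\<lambda>x. f (g x)) has_derivative blinfun_apply (f' (g x) o\<^sub>L g' x)) (at x)" if "x \<in> R" for x
    using has_derivative_compose[of g "blinfun_apply (g' x)" x UNIV f "blinfun_apply (f' (g x))"] S T that
    unfolding R_def by (simp add: blinfun_compose.rep_eq o_def)
  moreover have "continuous_on R (\<lambda>x. f' (g x) o\<^sub>L g' x)"
  proof (intro continuous_intros)
    show "continuous_on R (\<lambda>x. f' (g x))"
      using continuous_on_compose2[OF T(4)] continuous_on_subset[OF cg] unfolding R_def by (metis IntE image_subsetI inf_le1 vimageD)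
    show "continuous_on R g'" using S(4) continuous_on_subset unfolding R_def by blast
  qed
  ultimately show "C1_at (\<lambda>x. f (g x)) v" unfolding C1_at_def using R by (metis (no_types, lifting))
  show "deriv_at (\<lambda>x. f (g x)) v = (\<lambda>u. deriv_at f (g v) (deriv_at g v u))"
    using has_derivative_compose[OF C1_at_has_derivative[OF assms(1)] C1_at_has_derivative[OF assms(2)]]
      frechet_derivative_at by metis
qed

lemma C1_at_ident: "C1_at (\<lambda>x. x) v"
  unfolding C1_at_def
  by (intro exI[of _ UNIV] exI[of _ "\<lambda>_. id_blinfun"]) (auto simp: id_def[symmetric] eq_id_iff)

lemma C1_at_bounded_linear: "bounded_linear L \<Longrightarrow> C1_at L v \<and> deriv_at L v = L"
proof -
  assume L: "bounded_linear L"
  have D: "(L has_derivative L) (at x)" for x using L by (rule bounded_linear_imp_has_derivative)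
  have "C1_at L v" unfolding C1_at_def
    by (intro exI[of _ UNIV] exI[of _ "\<lambda>_. Blinfun L"]) (auto simp: D bounded_linear_Blinfun_apply L)
  then show ?thesis using D frechet_derivative_at by metis
qed

lemma C1_at_linear:
  fixes L :: "'a::euclidean_space \<Rightarrow> 'b::real_normed_vector"
  shows "linear L \<Longrightarrow> C1_at L v \<and> deriv_at L v = L"
  by (rule C1_at_bounded_linear) (rule linear_conv_bounded_linear[THEN iffD1])

lemma C1_at_add:
  assumes "C1_at f v" "C1_at g v"
  shows "C1_at (\<lambda>x. f x + g x) v" "deriv_at (\<lambda>x. f x + g x) v = (\<lambda>u. deriv_at f v u + deriv_at g v u)"
proof -
  obtain S f' where S: "open S" "v \<in> S" "\<And>x. x \<in> S \<Longrightarrow> (f has_derivative blinfun_apply (f' x)) (at x)"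
    "continuous_on S f'"
    using assms unfolding C1_at_def by blast
  obtain T g' where T: "open T" "v \<in> T" "\<And>x. x \<in> T \<Longrightarrow> (g has_derivative blinfun_apply (g' x)) (at x)"
    "continuous_on T g'"
    using assms unfolding C1_at_def by blast
  show "C1_at (\<lambda>x. f x + g x) v" unfolding C1_at_def
    by (intro exI[of _ "S \<inter> T"] exI[of _ "\<lambda>x. f' x + g' x"])
       (use S T in \<open>auto intro!: continuous_intros derivative_eq_intros intro: continuous_on_subset simp: blinfun.add_left\<close>)
  show "deriv_at (\<lambda>x. f x + g x) v = (\<lambda>u. deriv_at f v u + deriv_at g v u)"
    using has_derivative_add[OF C1_at_has_derivative[OF assms(1)] C1_at_has_derivative[OF assms(2)]]
      frechet_derivative_at by metis
qed

lemma C1_at_const: "C1_at (\<lambda>x. c) v"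
  unfolding C1_at_def
  by (intro exI[of _ UNIV] exI[of _ "\<lambda>_. 0"]) (auto simp: zero_blinfun.rep_eq)

lemma C1_at_sum:
  assumes "finite B" "\<And>b. b \<in> B \<Longrightarrow> C1_at (f b) v"
  shows "C1_at (\<lambda>x. \<Sum>b\<in>B. f b x) v \<and> deriv_at (\<lambda>x. \<Sum>b\<in>B. f b x) v = (\<lambda>u. \<Sum>b\<in>B. deriv_at (f b) v u)"
  using assms
proof (induction B)
  case empty
  then show ?case by (simp add: C1_at_const)
next
  case (insert b B)
  then show ?case using C1_at_add[of "f b" v "\<lambda>x. \<Sum>b\<in>B. f b x"] by simp
qed

text \<open>The inverse function theorem yields a differentiable local inverse; that its derivative
  varies continuously is continuity of operator inversion. With \<open>F\<close> the derivative
  along \<open>g\<close> and \<open>G\<close> its inverse, this follows from the resolvent identity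
  \<open>G y - G z = G y (F z - F y) G z\<close>.\<close>

lemma C1_at_inverse:
  fixes f :: "'a::euclidean_space \<Rightarrow> 'a"
  assumes "C1_at f v" "inj (deriv_at f v)"
  obtains g U V where "open U" "v \<in> U" "open V" "f v \<in> V" "homeomorphism U V f g" "C1_at g (f v)"
    "\<And>u. deriv_at g (f v) (deriv_at f v u) = u"
proof -
  obtain S f' where S: "open S" "v \<in> S" "\<And>x. x \<in> S \<Longrightarrow> (f has_derivative blinfun_apply (f' x)) (at x)"
    "continuous_on S f'"
    using assms unfolding C1_at_def by blast
  have eq: "deriv_at f x = blinfun_apply (f' x)" if "x \<in> S" for x
    using S(3)[OF that] frechet_derivative_at by metis
  obtain invf where invf: "linear invf" "\<And>u. invf (f' v u) = u"
    using linear_injective_left_inverse[of "deriv_at f v"] assms C1_at_linear_deriv eq[OF S(2)]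
    by (metis comp_apply id_apply)
  have "Blinfun invf o\<^sub>L f' v = id_blinfun"
    by (rule blinfun_eqI) (use invf in \<open>simp add: bounded_linear_Blinfun_apply linear_conv_bounded_linear\<close>)
  then obtain U V g g' where U: "open U" "U \<subseteq> S" "v \<in> U" "open V" "f v \<in> V" and hom: "homeomorphism U V f g"
    and g: "\<And>y. y \<in> V \<Longrightarrow> (g has_derivative (g' y)) (at y)"
    and g': "\<And>y. y \<in> V \<Longrightarrow> g' y = inv_into UNIV (blinfun_apply (f'(g y)))"
    and bij: "\<And>y. y \<in> V \<Longrightarrow> bij (blinfun_apply (f'(g y)))"
    using inverse_function_theorem[OF S(1,3,4,2)] by metis
  have gv: "g (f v) = v" using homeomorphism_apply1[OF hom U(3)] .
  have bl: "blinfun_apply (Blinfun (g' y)) = g' y" if "y \<in> V" for y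
    using g[OF that] has_derivative_bounded_linear bounded_linear_Blinfun_apply by blast
  have left: "blinfun_apply (Blinfun (g' y)) (f' (g y) u) = u" if "y \<in> V" for y u
    using g[OF that] g'[OF that] bij[OF that]
    by (simp add: bounded_linear_Blinfun_apply has_derivative_bounded_linear bij_is_inj)
  have right: "f' (g y) (blinfun_apply (Blinfun (g' y)) u) = u" if "y \<in> V" for y u
    using g[OF that] g'[OF that] bij[OF that]
    by (simp add: bounded_linear_Blinfun_apply has_derivative_bounded_linear bij_is_surj surj_f_inv_f)
  have "continuous_on V (\<lambda>y. Blinfun (g' y))"
  proof -
    have cg: "continuous_on V g" using homeomorphism_cont2[OF hom] .
    have gS: "g ` V \<subseteq> S" using homeomorphism_image2[OF hom] U(2) by simp
    define G where "G y = Blinfun (g' y)" for y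
    define F where "F y = f' (g y)" for y
    have cF: "continuous_on V F" unfolding F_def
      using continuous_on_compose2[OF S(4) cg gS] .
    have diff: "G y - G z = G y o\<^sub>L (F z - F y) o\<^sub>L G z" if "y \<in> V" "z \<in> V" for y z
    proof (rule blinfun_eqI)
      fix u
      have a: "blinfun_apply (F z) (blinfun_apply (G z) u) = u" "\<And>w. blinfun_apply (G y) (blinfun_apply (F y) w) = w"
        using left[OF that(1)] right[OF that(2)] unfolding F_def G_def by auto
      show "blinfun_apply (G y - G z) u = blinfun_apply (G y o\<^sub>L (F z - F y) o\<^sub>L G z) u"
        by (simp add: blinfun.diff_left blinfun.diff_right a)
    qed
    have "isCont G z" if z: "z \<in> V" for z
    proof -
      have Fz: "(F \<longlongrightarrow> F z) (at z)" using cF U(4) z continuous_on_eq_continuous_at continuous_at by blast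
      define M where "M = norm (G z)"
      have M: "M \<ge> 0" by (simp add: M_def)
      have Vev: "eventually (\<lambda>y. y \<in> V) (at z)" using U(4) z eventually_at_in_open' by blast
      have t0: "((\<lambda>y. norm (F z - F y) * M) \<longlongrightarrow> 0) (at z)"
        using tendsto_mult[OF tendsto_norm[OF tendsto_diff[OF tendsto_const Fz]] tendsto_const[of M], of "F z"] by simp
      then have sm: "eventually (\<lambda>y. norm (F z - F y) * M < 1/2) (at z)"
        by (rule order_tendstoD(2)) simp
      have "eventually (\<lambda>y. norm (G y - G z) \<le> 2 * M * (norm (F z - F y) * M)) (at z)"
        using Vev sm
      proof eventually_elim
        case (elim y)
        let ?e = "norm (F z - F y) * M"
        have n: "norm (G y - G z) \<le> norm (G y) * ?e"
          unfolding diff[OF elim(1) z] M_def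
          by (metis (no_types, opaque_lifting) mult.assoc mult_right_mono norm_blinfun_compose norm_ge_zero order_trans)
        \<comment> \<open>A bound for \<open>G y\<close> that does not presuppose continuity: since
          the factor \<open>?e\<close> is below 1/2, the identity gives
          \<open>norm (G y) \<le> M + norm (G y) / 2\<close>, and half of it can be absorbed on the
          left.\<close>
        have "norm (G y) \<le> norm (G z) + norm (G y - G z)" by (metis add.commute diff_add_cancel norm_triangle_ineq)
        also have "\<dots> \<le> M + norm (G y) * (1/2)"
          using n mult_left_mono[OF less_imp_le[OF elim(2)] norm_ge_zero[of "G y"]] unfolding M_def by linarith
        finally have "norm (G y) \<le> 2 * M" by simp
        then have "norm (G y) * ?e \<le> 2 * M * ?e" using M by (intro mult_right_mono) auto
        with n show ?case by linarith
      qed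
      moreover have "((\<lambda>y. 2 * M * (norm (F z - F y) * M)) \<longlongrightarrow> 0) (at z)"
        using tendsto_mult[OF tendsto_const[of "2*M"] t0] by simp
      ultimately have "((\<lambda>y. G y - G z) \<longlongrightarrow> 0) (at z)"
        by (rule Lim_null_comparison)
      then show ?thesis unfolding continuous_at using Lim_null by blast
    qed
    then show ?thesis unfolding G_def using continuous_at_imp_continuous_on by blast
  qed
  then have C1: "C1_at g (f v)" unfolding C1_at_def
    using U g by (intro exI[of _ V] exI[of _ "\<lambda>y. Blinfun (g' y)"]) (auto simp: bl)
  have "deriv_at g (f v) = g' (f v)" using frechet_derivative_at[OF g[OF U(5)]] by simp
  then have "deriv_at g (f v) (deriv_at f v u) = u" for u
    using left[OF U(5), of u] unfolding eq[OF S(2)] bl[OF U(5)] gv by simp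
  from that[OF U(1,3,4,5) hom C1 this] show ?thesis .
qed

section \<open>Charts\<close>

context
  fixes c :: "('x::topological_space, 'v::euclidean_space, 'h) ochart"
  assumes c: "orbifold_chart c"
begin

lemma chart_action: "group_action (chart_group c) (cover c) (chart_act c)"
  using c by (simp add: orbifold_chart_def)

lemma chart_group_group: "group (chart_group c)"
  using chart_action group_action.group_hom group_hom.axioms(1) by blast

lemma open_cover: "open (cover c)" and open_base: "open (base c)"
  and finite_chart_group: "finite (carrier (chart_group c))"
  using c by (simp_all add: orbifold_chart_def)

lemma chart_act_closed: "h \<in> carrier (chart_group c) \<Longrightarrow> v \<in> cover c \<Longrightarrow> chart_act c h v \<in> cover c"
  using group_action.element_image[OF chart_action] by blast

lemma chart_act_mult:
  "g \<in> carrier (chart_group c) \<Longrightarrow> h \<in> carrier (chart_group c) \<Longrightarrow> v \<in> cover c \<Longrightarrow>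
    chart_act c (g \<otimes>\<^bsub>chart_group c\<^esub> h) v = chart_act c g (chart_act c h v)"
  using group_action.composition_rule[OF chart_action] by blast

lemma chart_act_one: "v \<in> cover c \<Longrightarrow> chart_act c \<one>\<^bsub>chart_group c\<^esub> v = v"
  using group_action.id_eq_one[OF chart_action] by (metis restrict_apply')

lemma chart_inv_closed:
  "h \<in> carrier (chart_group c) \<Longrightarrow> inv\<^bsub>chart_group c\<^esub> h \<in> carrier (chart_group c)"
  using chart_group_group by (rule group.inv_closed)

lemma chart_mult_closed:
  "g \<in> carrier (chart_group c) \<Longrightarrow> h \<in> carrier (chart_group c) \<Longrightarrow>
    g \<otimes>\<^bsub>chart_group c\<^esub> h \<in> carrier (chart_group c)"
  using chart_group_group by (metis group.is_monoid monoid.m_closed)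

lemma chart_one_closed: "\<one>\<^bsub>chart_group c\<^esub> \<in> carrier (chart_group c)"
  using chart_group_group by (metis group.is_monoid monoid.one_closed)

lemma chart_act_inv:
  assumes "h \<in> carrier (chart_group c)" "v \<in> cover c"
  shows "chart_act c (inv\<^bsub>chart_group c\<^esub> h) (chart_act c h v) = v"
    and "chart_act c h (chart_act c (inv\<^bsub>chart_group c\<^esub> h) v) = v"
  using chart_act_mult[OF chart_inv_closed[OF assms(1)] assms(1,2)]
    chart_act_mult[OF assms(1) chart_inv_closed[OF assms(1)] assms(2)]
    chart_act_one[OF assms(2)] group.l_inv[OF chart_group_group assms(1)]
    group.r_inv[OF chart_group_group assms(1)]
  by simp_all

lemma smooth_chart_act: "h \<in> carrier (chart_group c) \<Longrightarrow> smooth_map_on (cover c) (chart_act c h)"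
  using c by (simp add: orbifold_chart_def)

lemma C1_chart_act: "h \<in> carrier (chart_group c) \<Longrightarrow> v \<in> cover c \<Longrightarrow> C1_at (chart_act c h) v"
  using smooth_map_on_imp_C1_at open_cover smooth_chart_act by blast

lemma proj_image: "proj c ` cover c = base c"
  using c unfolding orbifold_chart_def quotient_map_def by simp

lemma proj_eq_iff:
  assumes "v \<in> cover c" "w \<in> cover c"
  shows "proj c v = proj c w \<longleftrightarrow> (\<exists>h\<in>carrier (chart_group c). w = chart_act c h v)"
  using c assms unfolding orbifold_chart_def orbit_def by blast

lemma proj_chart_act:
  assumes "h \<in> carrier (chart_group c)" "v \<in> cover c"
  shows "proj c (chart_act c h v) = proj c v"
  using proj_eq_iff[OF assms(2) chart_act_closed[OF assms]] assms(1) by auto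

lemma open_chart_act_vimage:
  assumes "h \<in> carrier (chart_group c)" "open U"
  shows "open {v \<in> cover c. chart_act c h v \<in> U}"
proof -
  have "open (cover c \<inter> chart_act c h -` U)"
    by (rule continuous_open_preimage[OF smooth_map_on_imp_continuous_on[OF smooth_chart_act[OF assms(1)]] open_cover assms(2)])
  then show ?thesis by (simp add: Int_def vimage_def)
qed

text \<open>The saturation of \<open>U\<close> is the union of its preimages under the group
  elements, hence open, and a quotient map detects openness on saturations.\<close>

lemma open_proj_image:
  assumes "open U" "U \<subseteq> cover c" shows "open (proj c ` U)"
proof -
  have q: "quotient_map (top_of_set (cover c)) (top_of_set (base c)) (proj c)"
    using c by (simp add: orbifold_chart_def)
  have sub: "proj c ` U \<subseteq> base c" using assms(2) proj_image by blast
  have "{x \<in> cover c. proj c x \<in> proj c ` U} = (\<Union>h\<in>carrier (chart_group c). {v \<in> cover c. chart_act c h v \<in> U})"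
    (is "?L = ?R")
  proof
    show "?L \<subseteq> ?R" using proj_eq_iff assms(2) by fastforce
    show "?R \<subseteq> ?L" using proj_chart_act by (auto simp: image_iff) metis
  qed
  then have "open {x \<in> cover c. proj c x \<in> proj c ` U}"
    using open_chart_act_vimage[OF _ assms(1)] by auto
  then have "openin (top_of_set (cover c)) {x \<in> cover c. proj c x \<in> proj c ` U}"
    using open_openin_trans open_cover by (metis (no_types, lifting) mem_Collect_eq open_subset subsetI)
  then have "openin (top_of_set (base c)) (proj c ` U)"
    using q sub by (simp add: quotient_map_def)
  then show ?thesis using open_base openin_open_trans by (metis openin_open_eq)
qed

lemma continuous_on_proj: "continuous_on (cover c) (proj c)"
proof -
  have q: "quotient_map (top_of_set (cover c)) (top_of_set (base c)) (proj c)"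
    using c by (simp add: orbifold_chart_def)
  show ?thesis
    using quotient_imp_continuous_map[OF q] by (simp add: continuous_map_in_subtopology)
qed

lemma open_proj_vimage:
  assumes "open N" shows "open {v \<in> cover c. proj c v \<in> N}"
proof -
  have "open (cover c \<inter> proj c -` N)"
    by (rule continuous_open_preimage[OF continuous_on_proj open_cover assms])
  then show ?thesis by (simp add: Int_def vimage_def)
qed

text \<open>Since \<open>proj c\<close> is continuous and open, local statements at a point of the
  orbifold and at any point above it are interchangeable. Every passage between the underlying space
  and a chart uses this.\<close>

lemma eventually_proj:
  assumes "v \<in> cover c"
  shows "eventually P (nhds (proj c v)) \<longleftrightarrow> eventually (\<lambda>w. P (proj c w)) (nhds v)"
proof
  assume "eventually P (nhds (proj c v))"
  then obtain N where N: "open N" "proj c v \<in> N" "\<And>y. y \<in> N \<Longrightarrow> P y"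
    unfolding eventually_nhds by blast
  show "eventually (\<lambda>w. P (proj c w)) (nhds v)" unfolding eventually_nhds
    by (rule exI[of _ "{v \<in> cover c. proj c v \<in> N}"]) (use N assms open_proj_vimage in auto)
next
  assume "eventually (\<lambda>w. P (proj c w)) (nhds v)"
  then obtain N where N: "open N" "v \<in> N" "\<And>y. y \<in> N \<Longrightarrow> P (proj c y)"
    unfolding eventually_nhds by blast
  show "eventually P (nhds (proj c v))" unfolding eventually_nhds
    by (rule exI[of _ "proj c ` (N \<inter> cover c)"])
       (use N assms open_proj_image[of "N \<inter> cover c"] open_cover in auto)
qed

lemma eventually_cover: "v \<in> cover c \<Longrightarrow> eventually (\<lambda>w. w \<in> cover c) (nhds v)"
  unfolding eventually_nhds using open_cover by blast

lemma stabilizer_iff: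
  "h \<in> stabilizer (chart_group c) (chart_act c) v \<longleftrightarrow> h \<in> carrier (chart_group c) \<and> chart_act c h v = v"
  by (auto simp: stabilizer_def)

text \<open>By the Hausdorff property each of the finitely many \<open>h\<close> moving
  \<open>v\<close> has a neighbourhood \<open>N h\<close> of \<open>v\<close> that it moves off
  itself. Cutting \<open>U\<close> down by these gives \<open>P\<close>, and intersecting the
  preimages of \<open>P\<close> under the stabilizer makes the result invariant without losing
  openness.\<close>

lemma invariant_neighbourhood:
  assumes "v \<in> cover c" "open U" "v \<in> U"
  obtains B where "open B" "v \<in> B" "B \<subseteq> U" "B \<subseteq> cover c"
    "\<And>h w. h \<in> stabilizer (chart_group c) (chart_act c) v \<Longrightarrow> w \<in> B \<Longrightarrow> chart_act c h w \<in> B"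
    "\<And>h w. h \<in> carrier (chart_group c) \<Longrightarrow> w \<in> B \<Longrightarrow> chart_act c h w \<in> B \<Longrightarrow>
       h \<in> stabilizer (chart_group c) (chart_act c) v"
proof -
  let ?H = "carrier (chart_group c)" and ?S = "stabilizer (chart_group c) (chart_act c) v"
  have S: "subgroup ?S (chart_group c)"
    using group_action.stabilizer_subgroup[OF chart_action assms(1)] .
  have SH: "?S \<subseteq> ?H" using S subgroup.subset by blast
  have "\<exists>N. open N \<and> v \<in> N \<and> (\<forall>w\<in>N. w \<in> cover c \<longrightarrow> chart_act c h w \<notin> N)" if "h \<in> ?H - ?S" for h
  proof -
    have "chart_act c h v \<noteq> v" using that by (auto simp: stabilizer_iff)
    then obtain N1 N2 where N: "open N1" "open N2" "chart_act c h v \<in> N1" "v \<in> N2" "N1 \<inter> N2 = {}"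
      using hausdorff by metis
    show ?thesis
      by (rule exI[of _ "{w \<in> cover c. chart_act c h w \<in> N1} \<inter> N2"])
         (use N that assms open_chart_act_vimage[of h N1] in auto)
  qed
  then obtain N where N: "\<And>h. h \<in> ?H - ?S \<Longrightarrow> open (N h) \<and> v \<in> N h \<and> (\<forall>w\<in>N h. w \<in> cover c \<longrightarrow> chart_act c h w \<notin> N h)"
    by metis
  define P where "P = U \<inter> cover c \<inter> (\<Inter>h\<in>?H - ?S. N h)"
  have P: "open P" "v \<in> P"
    unfolding P_def using N assms open_cover finite_chart_group by (auto intro!: open_INT)
  define B where "B = (\<Inter>h\<in>?S. {w \<in> cover c. chart_act c h w \<in> P})"
  have one: "\<one>\<^bsub>chart_group c\<^esub> \<in> ?S" using S subgroup.one_closed by blast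
  show thesis
  proof
    show "open B" unfolding B_def
      using SH open_chart_act_vimage P finite_subset[OF SH finite_chart_group] by (intro open_INT) auto
    show "v \<in> B" unfolding B_def using assms P by (auto simp: stabilizer_iff)
    show BU: "B \<subseteq> U" and BC: "B \<subseteq> cover c"
      unfolding B_def using one chart_act_one unfolding P_def by force+
    show "chart_act c h w \<in> B" if "h \<in> ?S" "w \<in> B" for h w
      unfolding B_def
    proof
      fix g assume g: "g \<in> ?S"
      have w: "w \<in> cover c" using that BC by blast
      have gh: "g \<in> carrier (chart_group c)" "h \<in> carrier (chart_group c)" using g that SH by auto
      have "g \<otimes>\<^bsub>chart_group c\<^esub> h \<in> ?S" using S g that subgroup.m_closed by metis
      then have "chart_act c (g \<otimes>\<^bsub>chart_group c\<^esub> h) w \<in> P" using that unfolding B_def by auto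
      then show "chart_act c h w \<in> {w \<in> cover c. chart_act c g w \<in> P}"
        using chart_act_mult[of g h w] chart_act_closed[of h w] w gh by simp
    qed
    show "h \<in> ?S" if "h \<in> ?H" "w \<in> B" "chart_act c h w \<in> B" for h w
    proof (rule ccontr)
      assume "h \<notin> ?S"
      moreover have "B \<subseteq> P" unfolding B_def using one chart_act_one by force
      ultimately show False using N[of h] that BC unfolding P_def by blast
    qed
  qed
qed

end

section \<open>Restriction of a chart to an open set and a subgroup\<close>

definition sub_chart :: "('x, 'v, 'h) ochart \<Rightarrow> 'v set \<Rightarrow> 'h set \<Rightarrow> ('x, 'v, 'h) ochart"
  where "sub_chart c B K = \<lparr>base = proj c ` B, cover = B, chart_group = (chart_group c)\<lparr>carrier := K\<rparr>,
    chart_act = (\<lambda>h. restrict (chart_act c h) B), proj = proj c\<rparr>"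

lemma sub_chart_simps [simp]:
  "base (sub_chart c B K) = proj c ` B" "cover (sub_chart c B K) = B"
  "chart_group (sub_chart c B K) = (chart_group c)\<lparr>carrier := K\<rparr>"
  "chart_act (sub_chart c B K) = (\<lambda>h. restrict (chart_act c h) B)" "proj (sub_chart c B K) = proj c"
  by (simp_all add: sub_chart_def)

text \<open>The condition \<open>sep\<close> is what makes orbits of \<open>K\<close> in
  \<open>B\<close> the traces of orbits of the full group, so that the fibres of
  \<open>proj c\<close> on \<open>B\<close> are the \<open>K\<close>-orbits. It is met by the
  stabilizer of a point and an \<open>invariant_neighbourhood\<close> of it.\<close>

lemma orbifold_chart_sub_chart:
  fixes c :: "('x::topological_space, 'v::euclidean_space, 'h) ochart"
  assumes c: "orbifold_chart c" and B: "open B" "B \<subseteq> cover c" and K: "subgroup K (chart_group c)"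
    and inv: "\<And>h w. h \<in> K \<Longrightarrow> w \<in> B \<Longrightarrow> chart_act c h w \<in> B"
    and sep: "\<And>h w. h \<in> carrier (chart_group c) \<Longrightarrow> w \<in> B \<Longrightarrow> chart_act c h w \<in> B \<Longrightarrow> h \<in> K"
  shows "orbifold_chart (sub_chart c B K)"
proof -
  have KH: "K \<subseteq> carrier (chart_group c)" using K subgroup.subset by blast
  have Kinv: "inv\<^bsub>chart_group c\<^esub> h \<in> K" if "h \<in> K" for h using K that subgroup.m_inv_closed by metis
  have bij: "restrict (chart_act c h) B \<in> Bij B" if h: "h \<in> K" for h
  proof -
    have "bij_betw (chart_act c h) B B"
      by (rule bij_betw_byWitness[where f' = "chart_act c (inv\<^bsub>chart_group c\<^esub> h)"])
         (use h inv Kinv KH B chart_act_inv[OF c] in \<open>auto simp: subset_iff\<close>)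
    then show ?thesis unfolding Bij_def by (simp add: bij_betw_restrict_eq)
  qed
  have act: "group_action ((chart_group c)\<lparr>carrier := K\<rparr>) B (\<lambda>h. restrict (chart_act c h) B)"
  proof (intro group_action.intro group_hom.intro group_hom_axioms.intro group_BijGroup homI)
    show "Group.group ((chart_group c)\<lparr>carrier := K\<rparr>)"
      using subgroup.subgroup_is_group[OF K chart_group_group[OF c]] .
    show "restrict (chart_act c h) B \<in> carrier (BijGroup B)" if "h \<in> carrier ((chart_group c)\<lparr>carrier := K\<rparr>)" for h
      using that bij by (simp add: BijGroup_def)
    show "restrict (chart_act c (g \<otimes>\<^bsub>(chart_group c)\<lparr>carrier := K\<rparr>\<^esub> h)) B =
        restrict (chart_act c g) B \<otimes>\<^bsub>BijGroup B\<^esub> restrict (chart_act c h) B"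
      if "g \<in> carrier ((chart_group c)\<lparr>carrier := K\<rparr>)" "h \<in> carrier ((chart_group c)\<lparr>carrier := K\<rparr>)" for g h
    proof -
      have gh: "g \<in> K" "h \<in> K" using that by auto
      have "chart_act c (g \<otimes>\<^bsub>chart_group c\<^esub> h) w = chart_act c g (chart_act c h w)" if "w \<in> B" for w
        using chart_act_mult[OF c] gh KH B that by blast
      then show ?thesis using bij[OF gh(1)] bij[OF gh(2)] inv[OF gh(2)]
        by (auto simp: BijGroup_def compose_def fun_eq_iff)
    qed
  qed
  have eqv: "proj c v = proj c w \<longleftrightarrow> w \<in> orbit ((chart_group c)\<lparr>carrier := K\<rparr>) (\<lambda>h. restrict (chart_act c h) B) v"
    if "v \<in> B" "w \<in> B" for v w
    using proj_eq_iff[OF c, of v w] that B sep[OF _ that(1)] KH by (auto simp: orbit_def)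
  have "quotient_map (top_of_set B) (top_of_set (proj c ` B)) (proj c)"
  proof (rule continuous_open_imp_quotient_map)
    have "continuous_on B (proj c)" using continuous_on_subset[OF continuous_on_proj[OF c] B(2)] .
    then show "continuous_map (top_of_set B) (top_of_set (proj c ` B)) (proj c)"
      by (simp add: continuous_map_in_subtopology)
    show "open_map (top_of_set B) (top_of_set (proj c ` B)) (proj c)"
      unfolding open_map_def
    proof (intro allI impI)
      fix U assume "openin (top_of_set B) U"
      then have U: "open U" "U \<subseteq> B" using B(1) openin_open_eq by blast+
      then have "open (proj c ` U)" using open_proj_image[OF c] B by blast
      then show "openin (top_of_set (proj c ` B)) (proj c ` U)"
        using U by (meson image_mono open_subset)
    qed
  qed simp
  moreover have "smooth_map_on B (restrict (chart_act c h) B)" if "h \<in> K" for h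
    by (rule smooth_map_on_cong[OF B(1), of "chart_act c h"])
       (use smooth_map_on_subset[OF smooth_chart_act[OF c]] that KH B in auto)
  ultimately show ?thesis
    unfolding orbifold_chart_def
    using act eqv B open_proj_image[OF c] finite_subset[OF KH finite_chart_group[OF c]] by simp
qed

section \<open>Embeddings of charts and the maximal atlas\<close>

lemma chart_embeddingD:
  assumes "chart_embedding f b c \<eta> \<phi>"
  shows "\<eta> \<in> hom (chart_group b) (chart_group c)" "inj_on \<eta> (carrier (chart_group b))"
    "smooth_map_on (cover b) \<phi>" "inj_on \<phi> (cover b)" "\<phi> ` cover b \<subseteq> cover c"
    "\<And>v. v \<in> cover b \<Longrightarrow> \<phi> v \<in> cover c"
    "\<And>h. h \<in> carrier (chart_group b) \<Longrightarrow> \<eta> h \<in> carrier (chart_group c)"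
    "\<And>v. v \<in> cover b \<Longrightarrow> inj (deriv_at \<phi> v)"
    "\<And>v. v \<in> cover b \<Longrightarrow> proj c (\<phi> v) = f (proj b v)"
    "\<And>h v. h \<in> carrier (chart_group b) \<Longrightarrow> v \<in> cover b \<Longrightarrow>
      \<phi> (chart_act b h v) = chart_act c (\<eta> h) (\<phi> v)"
    "\<And>v. v \<in> cover b \<Longrightarrow> \<eta> ` stabilizer (chart_group b) (chart_act b) v =
       stabilizer (chart_group c) (chart_act c) (\<phi> v)"
  using assms unfolding chart_embedding_def hom_def by (simp_all add: image_subset_iff Pi_iff)

lemma chart_embedding_into_sub_chart:
  assumes e: "chart_embedding f b c \<eta> \<phi>" and "\<phi> ` cover b \<subseteq> B" "\<eta> ` carrier (chart_group b) \<subseteq> K"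
    "K \<subseteq> carrier (chart_group c)"
    and sep: "\<And>h w. h \<in> carrier (chart_group c) \<Longrightarrow> w \<in> B \<Longrightarrow> chart_act c h w \<in> B \<Longrightarrow> h \<in> K"
  shows "chart_embedding f b (sub_chart c B K) \<eta> \<phi>"
proof -
  have "stabilizer (chart_group (sub_chart c B K)) (chart_act (sub_chart c B K)) (\<phi> v) =
        stabilizer (chart_group c) (chart_act c) (\<phi> v)" if "v \<in> cover b" for v
    using that assms(2-4) sep by (auto simp: stabilizer_def)
  then show ?thesis
    using assms unfolding chart_embedding_def by (auto simp: hom_def)
qed

lemma chart_embedding_sub_chart:
  assumes B: "B \<subseteq> cover c" and K: "K \<subseteq> carrier (chart_group c)"
    and sep: "\<And>h w. h \<in> carrier (chart_group c) \<Longrightarrow> w \<in> B \<Longrightarrow> chart_act c h w \<in> B \<Longrightarrow> h \<in> K"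
  shows "chart_embedding id (sub_chart c B K) c id id"
proof -
  have "smooth_map_on B id" unfolding id_def by (rule smooth_map_on_bounded_linear) simp
  moreover have "stabilizer ((chart_group c)\<lparr>carrier := K\<rparr>) (\<lambda>h. restrict (chart_act c h) B) v =
      stabilizer (chart_group c) (chart_act c) v" if "v \<in> B" for v
    using that B K sep by (auto simp: stabilizer_def)
  ultimately show ?thesis
    unfolding chart_embedding_def using B K by (auto simp: hom_def)
qed

lemma chart_embedding_compose:
  fixes b c e :: "('x::topological_space, 'v::euclidean_space, 'h) ochart"
  assumes b: "orbifold_chart b" and c: "orbifold_chart c"
    and 1: "chart_embedding f b c \<eta> \<phi>" and 2: "chart_embedding g c e \<eta>' \<phi>'"
  shows "chart_embedding (g \<circ> f) b e (\<eta>' \<circ> \<eta>) (\<phi>' \<circ> \<phi>)"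
proof -
  note d1 = chart_embeddingD[OF 1] and d2 = chart_embeddingD[OF 2]
  have "\<eta>' \<circ> \<eta> \<in> hom (chart_group b) (chart_group e)" using hom_compose[OF d1(1) d2(1)] .
  moreover have "inj_on (\<eta>' \<circ> \<eta>) (carrier (chart_group b))"
    by (intro comp_inj_on d1(2) inj_on_subset[OF d2(2)]) (use d1(7) in auto)
  moreover have "smooth_map_on (cover b) (\<phi>' \<circ> \<phi>)"
    unfolding o_def by (rule smooth_map_on_compose[OF open_cover[OF b] open_cover[OF c] d1(5) d1(3) d2(3)])
  moreover have "inj_on (\<phi>' \<circ> \<phi>) (cover b)"
    by (intro comp_inj_on d1(4) inj_on_subset[OF d2(4)] d1(5))
  moreover have "(\<phi>' \<circ> \<phi>) ` cover b \<subseteq> cover e" using d1(6) d2(6) by auto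
  moreover have "inj (deriv_at (\<phi>' \<circ> \<phi>) v)" if v: "v \<in> cover b" for v
  proof -
    have "C1_at \<phi> v" using smooth_map_on_imp_C1_at[OF open_cover[OF b] d1(3) v] .
    moreover have "C1_at \<phi>' (\<phi> v)" using smooth_map_on_imp_C1_at[OF open_cover[OF c] d2(3) d1(6)[OF v]] .
    ultimately have "deriv_at (\<phi>' \<circ> \<phi>) v = deriv_at \<phi>' (\<phi> v) \<circ> deriv_at \<phi> v"
      using C1_at_compose(2)[of \<phi> v \<phi>'] by (simp add: o_def)
    then show ?thesis using inj_compose[OF d2(8)[OF d1(6)[OF v]] d1(8)[OF v]] by simp
  qed
  moreover have "proj e ((\<phi>' \<circ> \<phi>) v) = (g \<circ> f) (proj b v)" if "v \<in> cover b" for v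
    using d1(6,9) d2(9) that by simp
  moreover have "(\<phi>' \<circ> \<phi>) (chart_act b h v) = chart_act e ((\<eta>' \<circ> \<eta>) h) ((\<phi>' \<circ> \<phi>) v)"
    if "h \<in> carrier (chart_group b)" "v \<in> cover b" for h v
    using d1(6,7,10) d2(10) that by simp
  moreover have "(\<eta>' \<circ> \<eta>) ` stabilizer (chart_group b) (chart_act b) v =
      stabilizer (chart_group e) (chart_act e) ((\<phi>' \<circ> \<phi>) v)" if "v \<in> cover b" for v
    using d1(11)[OF that] d2(11)[OF d1(6)[OF that]] by (simp only: image_comp[symmetric] o_apply)
  ultimately show ?thesis unfolding chart_embedding_def by simp
qed

lemma inj_deriv_at_inverse:
  assumes "C1_at f v" "C1_at g (f v)" "\<forall>\<^sub>F w in nhds v. g (f w) = w"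
  shows "deriv_at g (f v) (deriv_at f v u) = u" "inj (deriv_at f v)"
proof -
  have *: "deriv_at g (f v) (deriv_at f v u) = u" for u
    using C1_at_cong(2)[OF C1_at_compose(1)[OF assms(1,2)] assms(3)]
    unfolding C1_at_compose(2)[OF assms(1,2)] frechet_derivative_ident by (metis)
  then show "deriv_at g (f v) (deriv_at f v u) = u" .
  show "inj (deriv_at f v)" using * by (metis injI)
qed

lemma inj_deriv_chart_act:
  assumes c: "orbifold_chart c" and k: "k \<in> carrier (chart_group c)" and v: "v \<in> cover c"
  shows "inj (deriv_at (chart_act c k) v)"
proof (rule inj_deriv_at_inverse(2))
  show "C1_at (chart_act c k) v" using C1_chart_act[OF c k v] .
  show "C1_at (chart_act c (inv\<^bsub>chart_group c\<^esub> k)) (chart_act c k v)"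
    using C1_chart_act[OF c chart_inv_closed[OF c k] chart_act_closed[OF c k v]] .
  show "\<forall>\<^sub>F w in nhds v. chart_act c (inv\<^bsub>chart_group c\<^esub> k) (chart_act c k w) = w"
    using eventually_cover[OF c v] by eventually_elim (use chart_act_inv(1)[OF c k] in auto)
qed

text \<open>A group element commutes with the action only up to conjugation, so its homomorphism is
  \<open>h\<close> to \<open>k h\<close> times the inverse of \<open>k\<close>. This makes the
  choice of a point in a fibre immaterial.\<close>

lemma chart_embedding_chart_act:
  fixes c :: "('x::topological_space, 'v::euclidean_space, 'h) ochart"
  assumes c: "orbifold_chart c" and k: "k \<in> carrier (chart_group c)"
  shows "chart_embedding id c c (\<lambda>h. k \<otimes>\<^bsub>chart_group c\<^esub> h \<otimes>\<^bsub>chart_group c\<^esub> inv\<^bsub>chart_group c\<^esub> k) (chart_act c k)"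
proof -
  interpret G: group "chart_group c" using chart_group_group[OF c] .
  let ?G = "chart_group c"
  let ?\<eta> = "\<lambda>h. k \<otimes>\<^bsub>?G\<^esub> h \<otimes>\<^bsub>?G\<^esub> inv\<^bsub>?G\<^esub> k"
  have cancel: "inv\<^bsub>?G\<^esub> k \<otimes>\<^bsub>?G\<^esub> (k \<otimes>\<^bsub>?G\<^esub> y) = y" if "y \<in> carrier ?G" for y
    using that k by (simp add: G.m_assoc[symmetric])
  have hom: "?\<eta> \<in> hom ?G ?G"
    using k by (intro homI) (auto simp: G.m_assoc cancel)
  have inj: "inj_on ?\<eta> (carrier ?G)" using k by (intro inj_onI) (simp add: G.m_assoc)
  have eqv: "chart_act c k (chart_act c h v) = chart_act c (?\<eta> h) (chart_act c k v)"
    if "h \<in> carrier ?G" "v \<in> cover c" for h v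
  proof -
    have "chart_act c (?\<eta> h) (chart_act c k v) = chart_act c (?\<eta> h \<otimes>\<^bsub>?G\<^esub> k) v"
      using that k by (simp add: chart_act_mult[OF c])
    also have "?\<eta> h \<otimes>\<^bsub>?G\<^esub> k = k \<otimes>\<^bsub>?G\<^esub> h" using that k by (simp add: G.m_assoc)
    finally show ?thesis using that k by (simp add: chart_act_mult[OF c])
  qed
  have injk: "inj_on (chart_act c k) (cover c)"
    by (rule inj_on_inverseI[where g = "chart_act c (inv\<^bsub>?G\<^esub> k)"]) (use chart_act_inv[OF c k] in auto)
  have stab: "?\<eta> ` stabilizer ?G (chart_act c) v = stabilizer ?G (chart_act c) (chart_act c k v)"
    if v: "v \<in> cover c" for v
  proof (intro equalityI subsetI)
    fix g assume "g \<in> ?\<eta> ` stabilizer ?G (chart_act c) v"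
    then obtain h where h: "h \<in> carrier ?G" "chart_act c h v = v" "g = ?\<eta> h"
      by (auto simp: stabilizer_def)
    have "chart_act c g (chart_act c k v) = chart_act c k v" using eqv[OF h(1) v] h by simp
    moreover have "g \<in> carrier ?G" using h k by simp
    ultimately show "g \<in> stabilizer ?G (chart_act c) (chart_act c k v)" by (simp add: stabilizer_def)
  next
    fix g assume "g \<in> stabilizer ?G (chart_act c) (chart_act c k v)"
    then have g: "g \<in> carrier ?G" "chart_act c g (chart_act c k v) = chart_act c k v" by (auto simp: stabilizer_def)
    define h where "h = inv\<^bsub>?G\<^esub> k \<otimes>\<^bsub>?G\<^esub> g \<otimes>\<^bsub>?G\<^esub> k"
    have h: "h \<in> carrier ?G" "g = ?\<eta> h"
      using g k by (auto simp: h_def G.m_assoc) (simp add: G.m_assoc[symmetric])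
    have "chart_act c k (chart_act c h v) = chart_act c k v" using eqv[OF h(1) v] g h by simp
    then have "chart_act c h v = v" using injk v chart_act_closed[OF c h(1) v] inj_onD by metis
    with h show "g \<in> ?\<eta> ` stabilizer ?G (chart_act c) v" by (auto simp: stabilizer_def)
  qed
  show ?thesis
    unfolding chart_embedding_def
    using hom inj smooth_chart_act[OF c k] injk chart_act_closed[OF c k] inj_deriv_chart_act[OF c k]
      proj_chart_act[OF c k] eqv stab by auto
qed

lemma compatible_sym: "compatible c c' \<Longrightarrow> compatible c' c"
  unfolding compatible_def by blast

lemma compatibleE:
  assumes "compatible c c'" "x \<in> base c" "x \<in> base c'"
  obtains b \<eta> \<phi> \<eta>' \<phi>' where "orbifold_chart b" "x \<in> base b"
    "chart_embedding id b c \<eta> \<phi>" "chart_embedding id b c' \<eta>' \<phi>'"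
  using bspec[OF assms(1)[unfolded compatible_def] IntI[OF assms(2,3)]] by (elim exE conjE) blast

text \<open>Compatibility of \<open>c\<close> with \<open>a\<close> provides a common chart
  \<open>e\<close>. It must be moved and shrunk until its image in \<open>c\<close> lies in
  \<open>B\<close> and its group lands in \<open>K\<close>; the embedding into \<open>a\<close>
  survives both changes.\<close>

lemma sub_chart_in_charts:
  fixes c :: "('x::topological_space, 'v::euclidean_space, 'h) ochart"
  assumes cA: "c \<in> charts A" and A: "\<forall>a\<in>A. orbifold_chart a"
    and B: "open B" "B \<subseteq> cover c" and K: "subgroup K (chart_group c)"
    and inv: "\<And>h w. h \<in> K \<Longrightarrow> w \<in> B \<Longrightarrow> chart_act c h w \<in> B"
    and sep: "\<And>h w. h \<in> carrier (chart_group c) \<Longrightarrow> w \<in> B \<Longrightarrow> chart_act c h w \<in> B \<Longrightarrow> h \<in> K"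
  shows "sub_chart c B K \<in> charts A"
proof -
  have c: "orbifold_chart c" using cA by (simp add: charts_def)
  have KH: "K \<subseteq> carrier (chart_group c)" using K subgroup.subset by blast
  have "compatible (sub_chart c B K) a" if a: "a \<in> A" for a
    unfolding compatible_def
  proof
    fix y assume y: "y \<in> base (sub_chart c B K) \<inter> base a"
    then obtain w where w: "w \<in> B" "y = proj c w" by auto
    have "y \<in> base c" using w B proj_image[OF c] by blast
    moreover have "compatible c a" using cA a by (simp add: charts_def)
    ultimately obtain e \<eta> \<phi> \<eta>' \<phi>' where e: "orbifold_chart e" "y \<in> base e"
      and \<phi>: "chart_embedding id e c \<eta> \<phi>" and \<phi>': "chart_embedding id e a \<eta>' \<phi>'"
      using compatibleE y by blast
    obtain u where u: "u \<in> cover e" "proj e u = y" using e(2) proj_image[OF e(1)] by (metis imageE)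
    have \<phi>c: "\<phi> z \<in> cover c" if "z \<in> cover e" for z using chart_embeddingD(6)[OF \<phi> that] .
    have "proj c (\<phi> u) = proj c w" using chart_embeddingD(9)[OF \<phi> u(1)] u w by simp
    \<comment> \<open>The given embedding meets the fibre of \<open>y\<close>, but possibly outside
      \<open>B\<close>; the element \<open>k\<close> moves its image of \<open>u\<close> to the
      point \<open>w\<close> of \<open>B\<close>.\<close>
    then obtain k where k: "k \<in> carrier (chart_group c)" "w = chart_act c k (\<phi> u)"
      using proj_eq_iff[OF c \<phi>c[OF u(1)], of w] w B by blast
    define \<eta>k \<phi>k where "\<eta>k = (\<lambda>h. k \<otimes>\<^bsub>chart_group c\<^esub> h \<otimes>\<^bsub>chart_group c\<^esub> inv\<^bsub>chart_group c\<^esub> k) \<circ> \<eta>"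
      and "\<phi>k = chart_act c k \<circ> \<phi>"
    have emk: "chart_embedding id e c \<eta>k \<phi>k"
      using chart_embedding_compose[OF e(1) c \<phi> chart_embedding_chart_act[OF c k(1)]]
      unfolding \<eta>k_def \<phi>k_def by simp
    have ck: "continuous_on (cover e) \<phi>k"
      using smooth_map_on_imp_continuous_on[OF chart_embeddingD(3)[OF emk]] .
    define O' where "O' = cover e \<inter> \<phi>k -` B"
    have O': "open O'" "u \<in> O'"
      unfolding O'_def using continuous_open_preimage[OF ck open_cover[OF e(1)] B(1)] u k w
      by (auto simp: \<phi>k_def)
    obtain E where E: "open E" "u \<in> E" "E \<subseteq> O'" "E \<subseteq> cover e"
      "\<And>h w. h \<in> stabilizer (chart_group e) (chart_act e) u \<Longrightarrow> w \<in> E \<Longrightarrow> chart_act e h w \<in> E"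
      "\<And>h w. h \<in> carrier (chart_group e) \<Longrightarrow> w \<in> E \<Longrightarrow> chart_act e h w \<in> E \<Longrightarrow>
         h \<in> stabilizer (chart_group e) (chart_act e) u"
      by (rule invariant_neighbourhood[OF e(1) u(1) O']) (rule that)
    let ?S = "stabilizer (chart_group e) (chart_act e) u"
    have S: "subgroup ?S (chart_group e)"
      using group_action.stabilizer_subgroup[OF chart_action[OF e(1)] u(1)] .
    have SH: "?S \<subseteq> carrier (chart_group e)" using S subgroup.subset by blast
    define b where "b = sub_chart e E ?S"
    have b: "orbifold_chart b" unfolding b_def
      by (rule orbifold_chart_sub_chart[OF e(1) E(1,4) S E(5,6)])
    have be: "chart_embedding id b e id id" unfolding b_def
      by (rule chart_embedding_sub_chart[OF E(4) SH E(6)])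
    have "chart_embedding id b c \<eta>k \<phi>k"
      using chart_embedding_compose[OF b e(1) be emk] by simp
    then have "chart_embedding id b (sub_chart c B K) \<eta>k \<phi>k"
    proof (rule chart_embedding_into_sub_chart)
      show "\<phi>k ` cover b \<subseteq> B" using E(3) unfolding b_def O'_def by auto
      \<comment> \<open>The group of \<open>b\<close> is the stabilizer of \<open>u\<close>, which
        goes onto the stabilizer of \<open>\<phi>k u\<close>. Such elements keep this point of
        \<open>B\<close> in \<open>B\<close>, so \<open>sep\<close> applies.\<close>
      show "\<eta>k ` carrier (chart_group b) \<subseteq> K"
      proof
        fix g assume "g \<in> \<eta>k ` carrier (chart_group b)"
        then have "g \<in> \<eta>k ` ?S" by (simp add: b_def)
        then have "g \<in> stabilizer (chart_group c) (chart_act c) (\<phi>k u)"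
          using chart_embeddingD(11)[OF emk u(1)] by simp
        moreover have "\<phi>k u \<in> B" using O' O'_def by blast
        ultimately show "g \<in> K" using sep by (auto simp: stabilizer_def)
      qed
    qed (fact KH sep)+
    moreover have "chart_embedding id b a \<eta>' \<phi>'"
      using chart_embedding_compose[OF b e(1) be \<phi>'] by simp
    moreover have "y \<in> base b" using u(2) E(2) by (auto simp: b_def)
    ultimately show "\<exists>b. orbifold_chart b \<and> y \<in> base b \<and>
       (\<exists>\<eta> \<phi>. chart_embedding id b (sub_chart c B K) \<eta> \<phi>) \<and> (\<exists>\<eta> \<phi>. chart_embedding id b a \<eta> \<phi>)"
      using b by blast
  qed
  moreover have "orbifold_chart (sub_chart c B K)"
    by (rule orbifold_chart_sub_chart[OF c B K]) (fact inv sep)+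
  ultimately show ?thesis unfolding charts_def by (intro CollectI conjI ballI)
qed

text \<open>Restrict any chart to an invariant neighbourhood of a point \<open>v\<close> above
  \<open>x\<close>, with the stabilizer of \<open>v\<close> as group: another point of the fibre in
  \<open>B\<close> would be a translate of \<open>v\<close> by a stabilizing element.\<close>

lemma reduced_chart_exists:
  fixes A :: "('x::t2_space, 'v::euclidean_space, 'h) ochart set"
  assumes "orbifold A" shows "\<exists>c. reduced_chart A x c"
proof -
  obtain c where cA: "c \<in> A" "x \<in> base c" using assms unfolding orbifold_def by blast
  then have c: "orbifold_chart c" "c \<in> charts A" using assms unfolding orbifold_def charts_def by auto
  obtain v where v: "v \<in> cover c" "proj c v = x" using cA(2) proj_image[OF c(1)] by (metis imageE)
  obtain B where B: "open B" "v \<in> B" "B \<subseteq> cover c"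
    "\<And>h w. h \<in> stabilizer (chart_group c) (chart_act c) v \<Longrightarrow> w \<in> B \<Longrightarrow> chart_act c h w \<in> B"
    "\<And>h w. h \<in> carrier (chart_group c) \<Longrightarrow> w \<in> B \<Longrightarrow> chart_act c h w \<in> B \<Longrightarrow>
       h \<in> stabilizer (chart_group c) (chart_act c) v"
    by (rule invariant_neighbourhood[OF c(1) v(1) open_UNIV UNIV_I]) (rule that)
  let ?S = "stabilizer (chart_group c) (chart_act c) v"
  have "sub_chart c B ?S \<in> charts A"
    by (rule sub_chart_in_charts[OF c(2) _ B(1,3) group_action.stabilizer_subgroup[OF chart_action[OF c(1)] v(1)] B(4,5)])
       (use assms in \<open>simp add: orbifold_def\<close>)
  moreover have "{w \<in> B. proj c w = x} = {v}"
  proof -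
    have "w = v" if w: "w \<in> B" "proj c w = x" for w
    proof -
      obtain h where h: "h \<in> carrier (chart_group c)" "w = chart_act c h v"
        using proj_eq_iff[OF c(1) v(1), of w] v w B(3) by auto
      have "h \<in> stabilizer (chart_group c) (chart_act c) v" using B(5)[OF h(1) B(2)] h(2) w(1) by simp
      then have "chart_act c h v = v" unfolding stabilizer_def by simp
      then show ?thesis using h(2) by simp
    qed
    with v(2) B(2) show ?thesis by blast
  qed
  ultimately show ?thesis unfolding reduced_chart_def using v(2) B(2) by (intro exI[of _ "sub_chart c B ?S"]) auto
qed

section \<open>Independence of the isotropy group from the chart\<close>

abbreviation stab_group :: "('x, 'v, 'h) ochart \<Rightarrow> 'v \<Rightarrow> 'h monoid"
  where "stab_group c v \<equiv> (chart_group c)\<lparr>carrier := stabilizer (chart_group c) (chart_act c) v\<rparr>"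

lemma chart_embedding_stab_iso:
  assumes "chart_embedding f b c \<eta> \<phi>" "v \<in> cover b"
  shows "stab_group b v \<cong> stab_group c (\<phi> v)"
proof -
  have "\<eta> \<in> iso (stab_group b v) (stab_group c (\<phi> v))"
    using chart_embeddingD(11)[OF assms] chart_embeddingD(1,2,7)[OF assms(1)]
    unfolding iso_def bij_betw_def hom_def
    by (auto intro: inj_on_subset[of \<eta>] simp: stabilizer_def)
  then show ?thesis by (auto simp: is_iso_def)
qed

text \<open>The two points need not be images of one point of the common chart \<open>b\<close>.
  Within each chart, points of one fibre have conjugate stabilizers, and the embeddings of
  \<open>b\<close> identify stabilizers across the charts.\<close>

lemma compatible_stab_iso:
  fixes c c' :: "('x::topological_space, 'v::euclidean_space, 'h) ochart"
  assumes c: "orbifold_chart c" "orbifold_chart c'" "compatible c c'"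
    and v: "v \<in> cover c" "v' \<in> cover c'" "proj c v = proj c' v'"
  shows "stab_group c v \<cong> stab_group c' v'"
proof -
  have grp: "Group.group (stab_group b v)" if "orbifold_chart b" "v \<in> cover b"
    for b :: "('x::topological_space, 'v::euclidean_space, 'h) ochart" and v
    using subgroup.subgroup_is_group[OF group_action.stabilizer_subgroup[OF chart_action[OF that(1)] that(2)] chart_group_group[OF that(1)]] .
  have same: "stab_group b v \<cong> stab_group b w" if b: "orbifold_chart b" and v: "v \<in> cover b" "w \<in> cover b" "proj b v = proj b w"
    for b :: "('x::topological_space, 'v::euclidean_space, 'h) ochart" and v w
  proof -
    obtain k where k: "k \<in> carrier (chart_group b)" "w = chart_act b k v" using proj_eq_iff[OF b] v by blast
    show ?thesis using chart_embedding_stab_iso[OF chart_embedding_chart_act[OF b k(1)] v(1)] k(2) by simp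
  qed
  have "proj c v \<in> base c \<inter> base c'"
    using v proj_image[OF c(1)] proj_image[OF c(2)] by (metis IntI imageI)
  then obtain b \<eta> \<phi> \<eta>' \<phi>' where b: "orbifold_chart b" "proj c v \<in> base b"
    and \<phi>: "chart_embedding id b c \<eta> \<phi>" and \<phi>': "chart_embedding id b c' \<eta>' \<phi>'"
    using compatibleE[OF c(3)] by blast
  obtain u where u: "u \<in> cover b" "proj b u = proj c v" using b proj_image[OF b(1)] by (metis imageE)
  have p: "\<phi> u \<in> cover c" "proj c (\<phi> u) = proj c v" "\<phi>' u \<in> cover c'" "proj c' (\<phi>' u) = proj c v"
    using chart_embeddingD(6,9)[OF \<phi> u(1)] chart_embeddingD(6,9)[OF \<phi>' u(1)] u by simp_all
  have "stab_group c v \<cong> stab_group c (\<phi> u)" using same[OF c(1) v(1) p(1)] p by simp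
  also have "stab_group c (\<phi> u) \<cong> stab_group b u"
    using group.iso_sym[OF grp[OF b(1) u(1)] chart_embedding_stab_iso[OF \<phi> u(1)]] .
  also have "stab_group b u \<cong> stab_group c' (\<phi>' u)" using chart_embedding_stab_iso[OF \<phi>' u(1)] .
  also have "stab_group c' (\<phi>' u) \<cong> stab_group c' v'" using same[OF c(2) p(3) v(2)] p v by simp
  finally show ?thesis .
qed

text \<open>Members of \<open>charts A\<close> are compatible with the atlas by definition, but not
  by definition with each other; hence the detour through a chart \<open>a\<close> of
  \<open>A\<close>.\<close>

lemma charts_stab_iso:
  fixes A :: "('x::t2_space, 'v::euclidean_space, 'h) ochart set"
  assumes A: "orbifold A" and c: "c \<in> charts A" "c' \<in> charts A"
    and v: "v \<in> cover c" "v' \<in> cover c'" "proj c v = proj c' v'"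
  shows "stab_group c v \<cong> stab_group c' v'"
proof -
  obtain a where a: "a \<in> A" "proj c v \<in> base a" using A unfolding orbifold_def by blast
  then have oa: "orbifold_chart a" using A unfolding orbifold_def by blast
  obtain u where u: "u \<in> cover a" "proj a u = proj c v" using a proj_image[OF oa] by (metis imageE)
  have oc: "orbifold_chart c" "orbifold_chart c'" "compatible c a" "compatible a c'"
    using c a compatible_sym unfolding charts_def by blast+
  have "stab_group c v \<cong> stab_group a u" using compatible_stab_iso[OF oc(1) oa oc(3) v(1) u(1)] u by simp
  also have "stab_group a u \<cong> stab_group c' v'" using compatible_stab_iso[OF oa oc(2,4) u(1) v(2)] u v by simp
  finally show ?thesis .
qed

lemma reduced_chart_stab_group:
  assumes "reduced_chart A x c" "v \<in> cover c" "proj c v = x"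
  shows "stab_group c v = chart_group c"
proof -
  have c: "orbifold_chart c" using assms unfolding reduced_chart_def charts_def by blast
  have "w = v" if "w \<in> cover c" "proj c w = x" for w
  proof -
    obtain u where "{w \<in> cover c. proj c w = x} = {u}" using assms(1) unfolding reduced_chart_def by blast
    moreover have "w \<in> {w \<in> cover c. proj c w = x}" "v \<in> {w \<in> cover c. proj c w = x}" using that assms by auto
    ultimately show ?thesis by auto
  qed
  then have "stabilizer (chart_group c) (chart_act c) v = carrier (chart_group c)"
    using chart_act_closed[OF c _ assms(2)] proj_chart_act[OF c _ assms(2)] assms(3)
    by (auto simp: stabilizer_def)
  then show ?thesis by simp
qed

text \<open>Replaces the arbitrarily chosen reduced chart hidden in \<open>isotropy_group\<close> by
  any chart and any point above.\<close>

lemma isotropy_group_iso: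
  fixes A :: "('x::t2_space, 'v::euclidean_space, 'h) ochart set"
  assumes A: "orbifold A" and c: "c \<in> charts A" "v \<in> cover c"
  shows "isotropy_group A (proj c v) \<cong> stab_group c v"
proof -
  define b where "b = (SOME b. reduced_chart A (proj c v) b)"
  have b: "reduced_chart A (proj c v) b"
    unfolding b_def using reduced_chart_exists[OF A] by (rule someI_ex)
  then obtain w where w: "w \<in> cover b" "proj b w = proj c v" unfolding reduced_chart_def by blast
  have "stab_group b w \<cong> stab_group c v"
    by (rule charts_stab_iso[OF A _ c(1) w(1) c(2) w(2)]) (use b in \<open>simp add: reduced_chart_def\<close>)
  moreover have "isotropy_group A (proj c v) = chart_group b" by (simp add: isotropy_group_def b_def)
  ultimately show ?thesis using reduced_chart_stab_group[OF b w] by simp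
qed

lemma multiplicity_eq:
  fixes A :: "('x::t2_space, 'v::euclidean_space, 'h) ochart set"
  assumes A: "orbifold A" and c: "c \<in> charts A" "v \<in> cover c"
  shows "multiplicity A (proj c v) = card (stabilizer (chart_group c) (chart_act c) v)"
  using isotropy_group_iso[OF assms] unfolding is_iso_def iso_def multiplicity_def order_def
  by (auto dest: bij_betw_same_card)

section \<open>Finite-order maps and finite unions\<close>

lemma C1_at_filterlim: "C1_at f v \<Longrightarrow> filterlim f (nhds (f v)) (nhds v)"
  using C1_at_isCont[of f v] by (simp add: isCont_def tendsto_at_iff_tendsto_nhds)

lemma C1_at_eventually_compose:
  "C1_at f v \<Longrightarrow> eventually P (nhds (f v)) \<Longrightarrow> eventually (\<lambda>w. P (f w)) (nhds v)"
  using C1_at_filterlim filterlim_iff by blast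

lemma C1_at_jet_neq:
  assumes f: "C1_at f v" and g: "C1_at g v" and ne: "\<not> (f v = g v \<and> deriv_at f v = deriv_at g v)"
  shows "\<forall>\<^sub>F w in nhds v. \<not> (f w = g w \<and> deriv_at f w = deriv_at g w)"
proof (cases "f v = g v")
  case False
  have "((\<lambda>w. f w - g w) \<longlongrightarrow> f v - g v) (nhds v)"
    using C1_at_filterlim[OF f] C1_at_filterlim[OF g] by (rule tendsto_diff)
  then have "\<forall>\<^sub>F w in nhds v. f w - g w \<noteq> 0"
    using False by (intro tendsto_imp_eventually_ne) auto
  then show ?thesis by eventually_elim auto
next
  case True
  then obtain u where u: "deriv_at f v u \<noteq> deriv_at g v u" using ne by auto
  have "((\<lambda>w. deriv_at f w u - deriv_at g w u) \<longlongrightarrow> deriv_at f v u - deriv_at g v u) (nhds v)"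
    using C1_at_deriv_tendsto[OF f] C1_at_deriv_tendsto[OF g] by (rule tendsto_diff)
  then have "\<forall>\<^sub>F w in nhds v. deriv_at f w u - deriv_at g w u \<noteq> 0"
    using u by (intro tendsto_imp_eventually_ne) auto
  then show ?thesis by eventually_elim auto
qed

text \<open>Differing from each of finitely many 1-jets is an open condition, so agreement with some
  of them passes to limits. This is the closedness half of all the continuation arguments
  below.\<close>

lemma C1_at_jet_limit:
  assumes "finite H" "C1_at g v" "\<And>h. h \<in> H \<Longrightarrow> C1_at (f h) v"
    and "\<exists>\<^sub>F w in nhds v. \<exists>h\<in>H. g w = f h w \<and> deriv_at g w = deriv_at (f h) w"
  shows "\<exists>h\<in>H. g v = f h v \<and> deriv_at g v = deriv_at (f h) v"
proof (rule ccontr)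
  assume "\<not> ?thesis"
  then have "\<forall>h\<in>H. \<forall>\<^sub>F w in nhds v. \<not> (g w = f h w \<and> deriv_at g w = deriv_at (f h) w)"
    using C1_at_jet_neq[OF assms(2)] assms(3) by blast
  then have "\<forall>\<^sub>F w in nhds v. \<forall>h\<in>H. \<not> (g w = f h w \<and> deriv_at g w = deriv_at (f h) w)"
    by (rule eventually_ball_finite[OF assms(1)])
  then have "\<forall>\<^sub>F w in nhds v. \<not> (\<exists>h\<in>H. g w = f h w \<and> deriv_at g w = deriv_at (f h) w)"
    by (rule eventually_mono) blast
  then show False using assms(4) unfolding frequently_def by simp
qed

text \<open>The finite case of the Baire theorem: a closed set may be dropped from the union if the
  rest has empty interior.\<close>

lemma interior_finite_Union_closed:
  assumes "finite H" "\<And>h. h \<in> H \<Longrightarrow> closed (C h)" "interior (\<Union>h\<in>H. C h) \<noteq> {}"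
  shows "\<exists>h\<in>H. interior (C h) \<noteq> {}"
  using assms
proof (induction H)
  case (insert h H)
  show ?case
  proof (cases "interior (\<Union>h\<in>H. C h) = {}")
    case True
    then have "interior (C h \<union> (\<Union>h\<in>H. C h)) = interior (C h)"
      using insert.prems by (intro interior_closed_Un_empty_interior) auto
    then show ?thesis using insert.prems by auto
  next
    case False
    then show ?thesis using insert by auto
  qed
qed auto

text \<open>By the Baire property of finite closed covers, the two maps agree on open sets accumulating at \<open>v\<close>.\<close>

lemma C1_at_finite_choice:
  fixes g :: "'a::euclidean_space \<Rightarrow> 'b::real_normed_vector"
  assumes H: "finite H" and g: "C1_at g v" and f: "\<And>h. h \<in> H \<Longrightarrow> C1_at (f h) v"
    and ev: "\<forall>\<^sub>F w in nhds v. \<exists>h\<in>H. g w = f h w"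
  shows "\<exists>h\<in>H. g v = f h v \<and> deriv_at g v = deriv_at (f h) v"
proof (rule C1_at_jet_limit[OF H g f])
  show "\<exists>\<^sub>F w in nhds v. \<exists>h\<in>H. g w = f h w \<and> deriv_at g w = deriv_at (f h) w"
    unfolding frequently_def
  proof
    assume "\<forall>\<^sub>F w in nhds v. \<not> (\<exists>h\<in>H. g w = f h w \<and> deriv_at g w = deriv_at (f h) w)"
    moreover have "\<forall>\<^sub>F w in nhds v. \<forall>h\<in>H. C1_at (f h) w"
      by (rule eventually_ball_finite[OF H]) (intro ballI C1_at_eventually f)
    ultimately have "\<forall>\<^sub>F w in nhds v. \<not> (\<exists>h\<in>H. g w = f h w \<and> deriv_at g w = deriv_at (f h) w) \<and>
        (\<exists>h\<in>H. g w = f h w) \<and> C1_at g w \<and> (\<forall>h\<in>H. C1_at (f h) w)"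
      using ev C1_at_eventually[OF g] by eventually_elim blast
    then obtain S where S: "open S" "v \<in> S"
      and SP: "\<And>w. w \<in> S \<Longrightarrow> \<not> (\<exists>h\<in>H. g w = f h w \<and> deriv_at g w = deriv_at (f h) w) \<and>
        (\<exists>h\<in>H. g w = f h w) \<and> C1_at g w \<and> (\<forall>h\<in>H. C1_at (f h) w)"
      unfolding eventually_nhds by blast
    obtain e where e: "e > 0" "cball v e \<subseteq> S" using S open_contains_cball by blast
    define C where "C h = {w \<in> cball v e. g w - f h w \<in> {0}}" for h
    have "closed (C h)" if h: "h \<in> H" for h
    proof -
      have "continuous_on (cball v e) (\<lambda>w. g w - f h w)"
        using SP e h by (intro continuous_at_imp_continuous_on ballI continuous_diff C1_at_isCont) auto
      then show ?thesis unfolding C_def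
        using continuous_closed_preimage[of "cball v e" "\<lambda>w. g w - f h w" "{0}"] by (simp add: Int_def vimage_def)
    qed
    moreover have "(\<Union>h\<in>H. C h) = cball v e"
    proof
      show "cball v e \<subseteq> (\<Union>h\<in>H. C h)"
      proof
        fix w assume w: "w \<in> cball v e"
        then obtain h where "h \<in> H" "g w = f h w" using SP e by blast
        then show "w \<in> (\<Union>h\<in>H. C h)" using w by (auto simp: C_def)
      qed
    qed (auto simp: C_def)
    moreover have "interior (cball v e) \<noteq> {}" using e by simp
    ultimately obtain h where h: "h \<in> H" "interior (C h) \<noteq> {}"
      using interior_finite_Union_closed[OF H, of C] by auto
    then obtain w where w: "w \<in> interior (C h)" by blast
    then have "\<forall>\<^sub>F z in nhds w. g z = f h z"
      unfolding eventually_nhds using interior_subset[of "C h"] by (intro exI[of _ "interior (C h)"]) (auto simp: C_def)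
    moreover have wS: "w \<in> S" using w interior_subset[of "C h"] e unfolding C_def by blast
    ultimately have "deriv_at (f h) w = deriv_at g w" "g w = f h w"
      using C1_at_cong(2)[of g w "f h"] SP[OF wS] eventually_nhds_x_imp_x by blast+
    then show False using SP[OF wS] h(1) by metis
  qed
qed

lemma C1_at_funpow:
  assumes "C1_at f v" "f v = v"
  shows "C1_at (f ^^ k) v \<and> (f ^^ k) v = v \<and> deriv_at (f ^^ k) v = deriv_at f v ^^ k"
proof (induction k)
  case 0
  then show ?case using C1_at_ident by (simp add: id_def)
next
  case (Suc k)
  then show ?case using C1_at_compose[of "f ^^ k" v f] assms by (simp add: o_def)
qed

text \<open>The averaging trick behind Bochner's linearization theorem.\<close>

lemma finite_order_trivial_jet:
  fixes f :: "'a::euclidean_space \<Rightarrow> 'a"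
  assumes f: "C1_at f v" "f v = v" "deriv_at f v = (\<lambda>u. u)"
    and N: "N > 0" "\<forall>\<^sub>F w in nhds v. (f ^^ N) w = w"
  shows "\<forall>\<^sub>F w in nhds v. f w = w"
proof -
  \<comment> \<open>Applying \<open>f\<close> first shifts the summation index, which replaces the
    summand \<open>w\<close> by \<open>(f ^^ N) w = w\<close>; hence
    \<open>\<phi> (f w) = \<phi> w\<close> near \<open>v\<close>. The derivative of
    \<open>\<phi>\<close> at \<open>v\<close> is multiplication by \<open>N\<close>, so
    \<open>\<phi>\<close> is injective there and \<open>f w = w\<close>.\<close>
  define \<phi> where "\<phi> w = (\<Sum>k<N. (f ^^ k) w)" for w
  have id: "(\<lambda>u. u) ^^ k = (\<lambda>u::'a. u)" for k by (induction k) (auto simp: fun_eq_iff)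
  have C: "C1_at (f ^^ k) v" "deriv_at (f ^^ k) v = (\<lambda>u. u)" for k
    using C1_at_funpow[OF f(1,2)] f(3) id by auto
  have "C1_at \<phi> v" "deriv_at \<phi> v = (\<lambda>u. \<Sum>k<N. u)"
    using C1_at_sum[of "{..<N}" "\<lambda>k. f ^^ k" v] C unfolding \<phi>_def by auto
  moreover have "inj (\<lambda>u::'a. \<Sum>k<N. u)"
    using N(1) by (auto intro!: injI simp: sum_constant_scaleR)
  ultimately obtain U V g where U: "open U" "v \<in> U" "homeomorphism U V \<phi> g"
    using C1_at_inverse[of \<phi> v] by metis
  have inj: "inj_on \<phi> U" using U(3) homeomorphism_apply1 inj_on_inverseI by metis
  have "\<forall>\<^sub>F w in nhds v. w \<in> U" using U eventually_nhds by blast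
  moreover have "\<forall>\<^sub>F w in nhds v. f w \<in> U"
    using C1_at_eventually_compose[OF f(1), of "\<lambda>w. w \<in> U"] U f(2) eventually_nhds by metis
  ultimately show ?thesis using N(2)
  proof eventually_elim
    case (elim w)
    have "\<phi> (f w) = (\<Sum>k<N. (f ^^ Suc k) w)" by (simp add: \<phi>_def funpow_swap1)
    also have "\<dots> = (\<Sum>k<Suc N. (f ^^ k) w) - w"
      using sum.lessThan_Suc_shift[of "\<lambda>k. (f ^^ k) w" N] by simp
    also have "\<dots> = \<phi> w" using elim(3) by (simp add: \<phi>_def)
    finally show ?case using inj elim inj_onD by metis
  qed
qed

section \<open>The torus\<close>

lemma torus_group_simps [simp]:
  "mult torus_group = (*)" "one torus_group = 1"
  by (auto simp: torus_group_def fun_eq_iff vec_eq_iff)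

lemma circle_group_simps [simp]:
  "carrier circle_group = sphere 0 1" "mult circle_group = (*)" "one circle_group = 1"
  by (auto simp: circle_group_def)

lemma in_torus_iff: "t \<in> carrier torus_group \<longleftrightarrow> (\<forall>j. norm (t $ j) = 1)"
  by (simp add: torus_group_def)

lemma torus_mult_closed [simp]:
  "s \<in> carrier torus_group \<Longrightarrow> t \<in> carrier torus_group \<Longrightarrow> s * t \<in> carrier torus_group"
  by (simp add: in_torus_iff norm_mult)

lemma torus_one_closed [simp]: "1 \<in> carrier torus_group"
  by (simp add: in_torus_iff)

lemma torus_power_closed [simp]: "t \<in> carrier torus_group \<Longrightarrow> t ^ k \<in> carrier torus_group"
  by (induction k) auto

definition torus_inv :: "complex ^ 'n \<Rightarrow> complex ^ 'n" where "torus_inv t = (\<chi> j. cnj (t $ j))"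

lemma torus_inv: "t \<in> carrier torus_group \<Longrightarrow> torus_inv t \<in> carrier torus_group"
  "t \<in> carrier torus_group \<Longrightarrow> torus_inv t * t = 1" "t \<in> carrier torus_group \<Longrightarrow> t * torus_inv t = 1"
proof -
  assume t: "t \<in> carrier torus_group"
  then show "torus_inv t \<in> carrier torus_group" by (simp add: in_torus_iff torus_inv_def)
  have "cnj (t $ j) * t $ j = 1" for j
    using t by (simp add: in_torus_iff mult.commute[of "cnj _"] complex_norm_square[symmetric])
  then show "torus_inv t * t = 1" "t * torus_inv t = 1"
    by (auto simp: vec_eq_iff torus_inv_def mult.commute)
qed

lemma comm_group_torus: "comm_group torus_group"
proof (rule comm_groupI)
  fix x assume "x \<in> carrier (torus_group :: (complex ^ 'n) monoid)"
  then show "\<exists>y\<in>carrier torus_group. y \<otimes>\<^bsub>torus_group\<^esub> x = \<one>\<^bsub>torus_group\<^esub>"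
    using torus_inv by (intro bexI[of _ "torus_inv x"]) auto
qed (auto simp: mult_ac)

lemma comm_group_circle: "comm_group circle_group"
proof (rule comm_groupI)
  fix x assume "x \<in> carrier circle_group"
  then show "\<exists>y\<in>carrier circle_group. y \<otimes>\<^bsub>circle_group\<^esub> x = \<one>\<^bsub>circle_group\<^esub>"
    by (intro bexI[of _ "cnj x"]) (auto simp: mult.commute[of "cnj _"] complex_norm_square[symmetric])
qed (auto simp: mult_ac norm_mult)

lemma torus_exp_onto: "t \<in> carrier torus_group \<Longrightarrow> \<exists>\<theta>. torus_exp \<theta> = t"
proof -
  assume "t \<in> carrier torus_group"
  then have "cis (Arg (t $ j)) = t $ j" for j
    using rcis_cmod_Arg[of "t $ j"] by (simp add: in_torus_iff rcis_def)
  then show ?thesis by (intro exI[of _ "\<chi> j. Arg (t $ j)"]) (simp add: torus_exp_def vec_eq_iff)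
qed

section \<open>Local lifts of the torus action\<close>

locale smooth_torus_orbifold =
  fixes A :: "('x::t2_space, 'v::euclidean_space, 'h) ochart set"
    and act :: "complex ^ 'n \<Rightarrow> 'x \<Rightarrow> 'x"
  assumes orb: "orbifold A" and smooth: "smooth_torus_action A act"
begin

lemma chartsD: "c \<in> charts A \<Longrightarrow> orbifold_chart c"
  by (simp add: charts_def)

lemma chart_at:
  obtains c v where "c \<in> charts A" "v \<in> cover c" "proj c v = x"
proof -
  obtain c where "reduced_chart A x c" using reduced_chart_exists[OF orb] by blast
  then have "c \<in> charts A" "x \<in> base c" by (auto simp: reduced_chart_def)
  then show thesis using proj_image[OF chartsD] that by (metis imageE)
qed

lemma act_group_action: "group_action torus_group UNIV act"
  using smooth by (simp add: smooth_torus_action_def)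

lemma act_mult:
  "s \<in> carrier torus_group \<Longrightarrow> t \<in> carrier torus_group \<Longrightarrow> act (s * t) x = act s (act t x)"
  using group_action.composition_rule[OF act_group_action, of x s t] by simp

lemma act_one: "act 1 x = x"
  using group_action.id_eq_one[OF act_group_action] by (metis UNIV_I restrict_apply' torus_group_simps(2))

text \<open>Conditions are imposed only near \<open>v\<close>, so \<open>g\<close> stands for a germ
  and composition needs no bookkeeping of domains. No equivariance is demanded, since everything is
  compared through \<open>lift_one_jet\<close>.\<close>

definition is_lift :: "('x, 'v, 'h) ochart \<Rightarrow> 'v \<Rightarrow> ('x, 'v, 'h) ochart \<Rightarrow> complex ^ 'n \<Rightarrow> ('v \<Rightarrow> 'v) \<Rightarrow> bool"
  where "is_lift c v c' t g \<longleftrightarrow> v \<in> cover c \<and> C1_at g v \<and>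
    (\<forall>\<^sub>F w in nhds v. g w \<in> cover c' \<and> proj c' (g w) = act t (proj c w))"

lemma is_liftD:
  assumes "is_lift c v c' t g"
  shows "v \<in> cover c" "C1_at g v" "g v \<in> cover c'" "proj c' (g v) = act t (proj c v)"
    "\<forall>\<^sub>F w in nhds v. g w \<in> cover c' \<and> proj c' (g w) = act t (proj c w)"
  using assms eventually_nhds_x_imp_x[of _ v] unfolding is_lift_def by blast+

lemma is_lift_compose:
  assumes "is_lift c v c' t g" "is_lift c' (g v) c'' s f" "s \<in> carrier torus_group" "t \<in> carrier torus_group"
  shows "is_lift c v c'' (s * t) (\<lambda>w. f (g w))"
proof -
  note g = is_liftD[OF assms(1)] and f = is_liftD[OF assms(2)]
  have "\<forall>\<^sub>F w in nhds v. f (g w) \<in> cover c'' \<and> proj c'' (f (g w)) = act s (proj c' (g w))"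
    by (rule C1_at_eventually_compose[OF g(2) f(5)])
  then have "\<forall>\<^sub>F w in nhds v. f (g w) \<in> cover c'' \<and> proj c'' (f (g w)) = act (s * t) (proj c w)"
    using g(5) by eventually_elim (simp add: act_mult assms)
  then show ?thesis using g(1) C1_at_compose(1)[OF g(2) f(2)] by (simp add: is_lift_def)
qed

lemma is_lift_eventually: 
  assumes "orbifold_chart c" "is_lift c v c' t g" shows "\<forall>\<^sub>F w in nhds v. is_lift c w c' t g"
proof -
  note g = is_liftD[OF assms(2)]
  show ?thesis unfolding is_lift_def
    using eventually_cover[OF assms(1) g(1)] C1_at_eventually[OF g(2)] iffD2[OF eventually_eventually g(5)]
    by eventually_elim simp
qed

lemma is_lift_id: "orbifold_chart c \<Longrightarrow> v \<in> cover c \<Longrightarrow> is_lift c v c 1 (\<lambda>w. w)"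
  unfolding is_lift_def using C1_at_ident eventually_cover by (auto simp: act_one)

lemma is_lift_chart_act:
  assumes "orbifold_chart c" "v \<in> cover c" "h \<in> carrier (chart_group c)"
  shows "is_lift c v c 1 (chart_act c h)"
  unfolding is_lift_def
  using assms(2) C1_chart_act[OF assms(1,3,2)] eventually_cover[OF assms(1,2)]
  by (auto elim!: eventually_mono simp: act_one chart_act_closed[OF assms(1,3)] proj_chart_act[OF assms(1,3)])

lemma is_lift_embedding:
  assumes "orbifold_chart b" "chart_embedding (act t) b c \<eta> \<phi>" "v \<in> cover b"
  shows "is_lift b v c t \<phi>"
proof -
  have "C1_at \<phi> v" using smooth_map_on_imp_C1_at[OF open_cover[OF assms(1)] chart_embeddingD(3)[OF assms(2)] assms(3)] .
  moreover have "\<forall>\<^sub>F w in nhds v. \<phi> w \<in> cover c \<and> proj c (\<phi> w) = act t (proj b w)"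
    using eventually_cover[OF assms(1,3)]
    by eventually_elim (use chart_embeddingD(6,9)[OF assms(2)] in simp)
  ultimately show ?thesis using assms(3) by (simp add: is_lift_def)
qed

lemma act_one_eq: "act 1 = id"
  by (simp add: fun_eq_iff act_one)

lemma is_lift_embedding_inverse:
  assumes b: "orbifold_chart b" and e: "chart_embedding id b c \<eta> \<phi>" and v: "v \<in> cover b"
  shows "\<exists>g. is_lift c (\<phi> v) b 1 g \<and> g (\<phi> v) = v"
proof -
  have "C1_at \<phi> v" using smooth_map_on_imp_C1_at[OF open_cover[OF b] chart_embeddingD(3)[OF e] v] .
  then obtain g U V where U: "open U" "v \<in> U" "open V" "\<phi> v \<in> V" "homeomorphism U V \<phi> g" "C1_at g (\<phi> v)"
    using C1_at_inverse[OF _ chart_embeddingD(8)[OF e v]] by metis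
  have gv: "g (\<phi> v) = v" using homeomorphism_apply1[OF U(5,2)] .
  have "\<forall>\<^sub>F y in nhds (\<phi> v). y \<in> V" using U(3,4) eventually_nhds by blast
  moreover have "\<forall>\<^sub>F y in nhds (\<phi> v). g y \<in> cover b"
    using C1_at_eventually_compose[OF U(6)] eventually_cover[OF b v] gv by simp
  ultimately have "\<forall>\<^sub>F y in nhds (\<phi> v). g y \<in> cover b \<and> proj b (g y) = act 1 (proj c y)"
  proof eventually_elim
    case (elim y)
    have "proj b (g y) = proj c (\<phi> (g y))" using chart_embeddingD(9)[OF e elim(2)] by simp
    then show ?case using elim homeomorphism_apply2[OF U(5) elim(1)] by (simp add: act_one)
  qed
  then show ?thesis using U(6) gv chart_embeddingD(6)[OF e v] by (auto simp: is_lift_def)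
qed

text \<open>The germ is a composite along \<open>v\<close>, \<open>\<phi> u\<close>,
  \<open>u\<close>, \<open>\<phi>' u\<close>, \<open>v'\<close>: a chart group element, the local
  inverse of one embedding, the other embedding, and a chart group element that reaches the
  prescribed target.\<close>

lemma is_lift_compatible:
  assumes c: "orbifold_chart c" "orbifold_chart c'" "compatible c c'"
    and v: "v \<in> cover c" "v' \<in> cover c'" "proj c v = proj c' v'"
  shows "\<exists>g. is_lift c v c' 1 g \<and> g v = v'"
proof -
  have "proj c v \<in> base c" "proj c v \<in> base c'"
    using v proj_image[OF c(1)] proj_image[OF c(2)] by (metis imageI)+
  then obtain b \<eta> \<phi> \<eta>' \<phi>' where b: "orbifold_chart b" "proj c v \<in> base b"
    and \<phi>: "chart_embedding id b c \<eta> \<phi>" and \<phi>': "chart_embedding id b c' \<eta>' \<phi>'"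
    using compatibleE[OF c(3)] by metis
  obtain u where u: "u \<in> cover b" "proj b u = proj c v" using b proj_image[OF b(1)] by (metis imageE)
  have p: "\<phi> u \<in> cover c" "proj c (\<phi> u) = proj c v" "\<phi>' u \<in> cover c'" "proj c' (\<phi>' u) = proj c v"
    using chart_embeddingD(6,9)[OF \<phi> u(1)] chart_embeddingD(6,9)[OF \<phi>' u(1)] u by simp_all
  obtain k where k: "k \<in> carrier (chart_group c)" "\<phi> u = chart_act c k v"
    using proj_eq_iff[OF c(1) v(1) p(1)] p by auto
  obtain k' where k': "k' \<in> carrier (chart_group c')" "v' = chart_act c' k' (\<phi>' u)"
    using proj_eq_iff[OF c(2) p(3) v(2)] p v by auto
  obtain g where g: "is_lift c (\<phi> u) b 1 g" "g (\<phi> u) = u"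
    using is_lift_embedding_inverse[OF b(1) \<phi> u(1)] by blast
  have 1: "is_lift c v c 1 (chart_act c k)" using is_lift_chart_act[OF c(1) v(1) k(1)] .
  have 2: "is_lift c v b (1 * 1) (\<lambda>w. g (chart_act c k w))"
    by (rule is_lift_compose[OF 1]) (use g k in auto)
  have 3: "is_lift b u c' 1 \<phi>'" using is_lift_embedding[OF b(1) _ u(1)] \<phi>' by (simp add: act_one_eq)
  have 4: "is_lift c v c' (1 * (1 * 1)) (\<lambda>w. \<phi>' (g (chart_act c k w)))"
    by (rule is_lift_compose[OF 2]) (use g k 3 in auto)
  have 5: "is_lift c' (\<phi>' u) c' 1 (chart_act c' k')" using is_lift_chart_act[OF c(2) p(3) k'(1)] .
  have "is_lift c v c' (1 * (1 * (1 * 1))) (\<lambda>w. chart_act c' k' (\<phi>' (g (chart_act c k w))))"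
    by (rule is_lift_compose[OF 4]) (use g k 5 in auto)
  then show ?thesis using g k k' by (intro exI[of _ "\<lambda>w. chart_act c' k' (\<phi>' (g (chart_act c k w)))"]) auto
qed

lemma is_lift_transition:
  assumes c: "c \<in> charts A" "c' \<in> charts A"
    and v: "v \<in> cover c" "v' \<in> cover c'" "proj c v = proj c' v'"
  shows "\<exists>g. is_lift c v c' 1 g \<and> g v = v'"
proof -
  obtain a where a: "a \<in> A" "proj c v \<in> base a" using orb unfolding orbifold_def by blast
  then have oa: "orbifold_chart a" using orb unfolding orbifold_def by blast
  obtain u where u: "u \<in> cover a" "proj a u = proj c v" using a proj_image[OF oa] by (metis imageE)
  have oc: "orbifold_chart c" "orbifold_chart c'" "compatible c a" "compatible a c'"
    using c a compatible_sym unfolding charts_def by blast+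
  obtain f where f: "is_lift c v a 1 f" "f v = u"
    using is_lift_compatible[OF oc(1) oa oc(3) v(1) u(1)] u by auto
  obtain g where g: "is_lift a u c' 1 g" "g u = v'"
    using is_lift_compatible[OF oa oc(2,4) u(1) v(2)] u v by auto
  have "is_lift c v c' (1 * 1) (\<lambda>w. g (f w))" using is_lift_compose[OF f(1)] g(1) f(2) by simp
  then show ?thesis using f g by auto
qed

text \<open>Smoothness of the action supplies lifts only between charts of its own choosing.
  Transition germs on both sides carry them to the prescribed charts and the prescribed points of
  the two fibres.\<close>

lemma is_lift_exists:
  assumes c: "c \<in> charts A" "c' \<in> charts A" and t: "t \<in> carrier torus_group"
    and v: "v \<in> cover c" "v' \<in> cover c'" "act t (proj c v) = proj c' v'"
  shows "\<exists>g. is_lift c v c' t g \<and> g v = v'"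
proof -
  obtain \<theta> where \<theta>: "torus_exp \<theta> = t" using torus_exp_onto[OF t] by blast
  obtain b b' e F \<eta> where b: "b \<in> charts A" "b' \<in> charts A" "e > 0" "proj c v \<in> base b"
    and F: "\<And>\<theta>'. \<theta>' \<in> ball \<theta> e \<Longrightarrow> chart_embedding (act (torus_exp \<theta>')) b b' \<eta> (F \<theta>')"
    using smooth[unfolded smooth_torus_action_def, THEN conjunct2, rule_format, of "proj c v" \<theta>] by metis
  have em: "chart_embedding (act t) b b' \<eta> (F \<theta>)" using F[of \<theta>] b \<theta> by simp
  note ob = chartsD[OF b(1)]
  obtain u where u: "u \<in> cover b" "proj b u = proj c v" using b proj_image[OF ob] by (metis imageE)
  have l: "is_lift b u b' t (F \<theta>)" using is_lift_embedding[OF ob em u(1)] .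
  obtain f where f: "is_lift c v b 1 f" "f v = u" using is_lift_transition[OF c(1) b(1) v(1) u(1)] u by auto
  have "F \<theta> u \<in> cover b'" "proj b' (F \<theta> u) = proj c' v'" using is_liftD[OF l] u v by auto
  then obtain g where g: "is_lift b' (F \<theta> u) c' 1 g" "g (F \<theta> u) = v'"
    using is_lift_transition[OF b(2) c(2) _ v(2)] by metis
  have 1: "is_lift c v b' (t * 1) (\<lambda>w. F \<theta> (f w))" using is_lift_compose[OF f(1)] l f(2) t by simp
  have "is_lift c v c' (1 * (t * 1)) (\<lambda>w. g (F \<theta> (f w)))"
    by (rule is_lift_compose[OF 1]) (use g f t in auto)
  then show ?thesis using f g by auto
qed

section \<open>Lifts of the identity and of torsion elements\<close>

lemma lift_one_choice:
  assumes c: "orbifold_chart c" and g: "is_lift c v c 1 g"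
  shows "\<forall>\<^sub>F w in nhds v. \<exists>h\<in>carrier (chart_group c). g w = chart_act c h w"
  using is_liftD(5)[OF g] eventually_cover[OF c is_liftD(1)[OF g]]
proof eventually_elim
  case (elim w)
  then show ?case using proj_eq_iff[OF c elim(2), of "g w"] by (simp add: act_one)
qed

text \<open>In \<open>lift_one_choice\<close> the group element depends on \<open>w\<close>;
  \<open>C1_at_finite_choice\<close> turns this into a single element that matches both the value
  and the derivative at \<open>v\<close>.\<close>

lemma lift_one_jet:
  assumes c: "orbifold_chart c" and g: "is_lift c v c 1 g"
  shows "\<exists>h\<in>carrier (chart_group c). g v = chart_act c h v \<and> deriv_at g v = deriv_at (chart_act c h) v"
  by (rule C1_at_finite_choice[OF finite_chart_group[OF c] is_liftD(2)[OF g]])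
     (use C1_chart_act[OF c _ is_liftD(1)[OF g]] lift_one_choice[OF assms] in auto)

lemma chart_act_finite_order:
  assumes c: "orbifold_chart c" and h: "h \<in> carrier (chart_group c)" and v: "v \<in> cover c"
  shows "\<forall>\<^sub>F w in nhds v. (chart_act c h ^^ order (chart_group c)) w = w" "order (chart_group c) > 0"
proof -
  interpret G: group "chart_group c" using chart_group_group[OF c] .
  have pow: "(chart_act c h ^^ k) w = chart_act c (h [^]\<^bsub>chart_group c\<^esub> k) w" if "w \<in> cover c" for k w
  proof (induction k)
    case 0
    then show ?case using chart_act_one[OF c that] by simp
  next
    case (Suc k)
    have "chart_act c (h [^]\<^bsub>chart_group c\<^esub> Suc k) w = chart_act c (h \<otimes>\<^bsub>chart_group c\<^esub> h [^]\<^bsub>chart_group c\<^esub> k) w"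
      using h G.nat_pow_Suc2[OF h] by simp
    then show ?case using Suc chart_act_mult[OF c h G.nat_pow_closed[OF h] that] by simp
  qed
  show "order (chart_group c) > 0" using finite_chart_group[OF c] G.order_gt_0_iff_finite by blast
  show "\<forall>\<^sub>F w in nhds v. (chart_act c h ^^ order (chart_group c)) w = w"
    using eventually_cover[OF c v]
  proof eventually_elim
    case (elim w)
    show ?case unfolding pow[OF elim] G.pow_order_eq_1[OF h] using chart_act_one[OF c elim] .
  qed
qed

lemma chart_act_trivial_jet:
  assumes c: "orbifold_chart c" and h: "h \<in> carrier (chart_group c)" and v: "v \<in> cover c"
    and jet: "chart_act c h v = v" "deriv_at (chart_act c h) v = (\<lambda>u. u)"
  shows "\<forall>\<^sub>F w in nhds v. chart_act c h w = w"
  using finite_order_trivial_jet[OF C1_chart_act[OF c h v] jet] chart_act_finite_order[OF c h v] by blast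

text \<open>At a nearby \<open>w\<close> the germ has the 1-jet of some \<open>h\<close>. If the jet
  of \<open>h\<close> at \<open>v\<close> were not that of the identity, it would differ from the
  jet of \<open>g\<close> near \<open>v\<close> as well; the remaining \<open>h\<close> have trivial
  jet at \<open>v\<close> and act trivially near \<open>v\<close>.\<close>

lemma lift_one_trivial_jet:
  assumes c: "orbifold_chart c" and g: "is_lift c v c 1 g" "g v = v" "deriv_at g v = (\<lambda>u. u)"
  shows "\<forall>\<^sub>F w in nhds v. g w = w"
proof -
  let ?H = "carrier (chart_group c)"
  note v = is_liftD(1)[OF g(1)]
  have "\<forall>\<^sub>F w in nhds v. g w = chart_act c h w \<and> deriv_at g w = deriv_at (chart_act c h) w \<longrightarrow> g w = w"
    if h: "h \<in> ?H" for h
  proof (cases "chart_act c h v = v \<and> deriv_at (chart_act c h) v = (\<lambda>u. u)")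
    case True
    then show ?thesis using chart_act_trivial_jet[OF c h v] by (auto elim: eventually_mono)
  next
    case False
    then have "\<not> (g v = chart_act c h v \<and> deriv_at g v = deriv_at (chart_act c h) v)" using g by metis
    from C1_at_jet_neq[OF is_liftD(2)[OF g(1)] C1_chart_act[OF c h v] this]
    show ?thesis by (rule eventually_mono) blast
  qed
  then have "\<forall>\<^sub>F w in nhds v. \<forall>h\<in>?H. g w = chart_act c h w \<and> deriv_at g w = deriv_at (chart_act c h) w \<longrightarrow> g w = w"
    by (intro eventually_ball_finite[OF finite_chart_group[OF c]] ballI)
  with is_lift_eventually[OF c g(1)] show ?thesis
  proof eventually_elim
    case (elim w)
    then show ?case using lift_one_jet[OF c elim(1)] by blast
  qed
qed

lemma is_lift_funpow:
  assumes "orbifold_chart c" "is_lift c v c t g" "g v = v" "t \<in> carrier torus_group"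
  shows "is_lift c v c (t ^ k) (g ^^ k)"
proof (induction k)
  case 0
  then show ?case using is_lift_id[OF assms(1) is_liftD(1)[OF assms(2)]] by (simp add: id_def)
next
  case (Suc k)
  have "(g ^^ k) v = v" using C1_at_funpow[OF is_liftD(2)[OF assms(2)] assms(3)] by blast
  then show ?case using is_lift_compose[OF Suc, of c t g] assms by (simp add: o_def)
qed

text \<open>The germ \<open>g\<close> need not have finite order a priori. But \<open>g ^^ N\<close>
  lifts the identity and has trivial jet, so it is trivial near \<open>v\<close>, and averaging then
  applies to \<open>g\<close> itself.\<close>

lemma torsion_lift_trivial_jet:
  assumes c: "orbifold_chart c" and t: "t \<in> carrier torus_group" "t ^ N = 1" "N > 0"
    and g: "is_lift c v c t g" "g v = v" "deriv_at g v = (\<lambda>u. u)"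
  shows "\<forall>\<^sub>F w in nhds v. g w = w"
proof (rule finite_order_trivial_jet[OF is_liftD(2)[OF g(1)] g(2,3) t(3)])
  have id: "(\<lambda>u. u) ^^ k = (\<lambda>u::'v. u)" for k by (induction k) (auto simp: fun_eq_iff)
  show "\<forall>\<^sub>F w in nhds v. (g ^^ N) w = w"
    by (rule lift_one_trivial_jet[OF c])
       (use is_lift_funpow[OF c g(1,2) t(1), of N] C1_at_funpow[OF is_liftD(2)[OF g(1)] g(2), of N] t g id in auto)
qed

lemma torsion_trivial_jet_local:
  assumes c: "orbifold_chart c" and t: "t \<in> carrier torus_group" "t ^ N = 1" "N > 0"
    and g: "is_lift c v c t g" "g v = v" "deriv_at g v = (\<lambda>u. u)"
  shows "\<forall>\<^sub>F y in nhds (proj c v). act t y = y"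
  unfolding eventually_proj[OF c is_liftD(1)[OF g(1)]]
  using torsion_lift_trivial_jet[OF assms] is_liftD(5)[OF g(1)] by eventually_elim metis

text \<open>This is continuity of \<open>act t\<close>, which smoothness of the action gives only
  through lifts to charts.\<close>

lemma act_eventually:
  assumes t: "t \<in> carrier torus_group" and ev: "\<forall>\<^sub>F y in nhds (act t x). P y"
  shows "\<forall>\<^sub>F y in nhds x. P (act t y)"
proof -
  obtain c v where c: "c \<in> charts A" "v \<in> cover c" "proj c v = x" by (rule chart_at)
  obtain c' v' where c': "c' \<in> charts A" "v' \<in> cover c'" "proj c' v' = act t x" by (rule chart_at)
  obtain g where g: "is_lift c v c' t g" "g v = v'" using is_lift_exists[OF c(1) c'(1) t c(2) c'(2)] c c' by auto
  have "\<forall>\<^sub>F w in nhds v. P (proj c' (g w))"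
    using C1_at_eventually_compose[OF is_liftD(2)[OF g(1)], of "\<lambda>w. P (proj c' w)"]
      eventually_proj[OF chartsD[OF c'(1)] c'(2), of P] ev g c' by simp
  then have "\<forall>\<^sub>F w in nhds v. P (act t (proj c w))" using is_liftD(5)[OF g(1)] by eventually_elim simp
  then show ?thesis using eventually_proj[OF chartsD[OF c(1)] c(2), of "\<lambda>y. P (act t y)"] c by simp
qed

end

section \<open>Propagation of triviality over a connected space\<close>

lemma open_eventually_nhds: "open {x. eventually P (nhds x)}"
proof (rule topological_space_class.openI)
  fix x assume "x \<in> {x. eventually P (nhds x)}"
  then obtain S where "open S" "x \<in> S" "\<And>y. y \<in> S \<Longrightarrow> P y" unfolding eventually_nhds by blast
  then show "\<exists>T. open T \<and> x \<in> T \<and> T \<subseteq> {x. eventually P (nhds x)}"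
    unfolding eventually_nhds by (intro exI[of _ S]) blast
qed

text \<open>Closedness is phrased with \<open>frequently\<close>, the form in which
  \<open>C1_at_jet_limit\<close> takes its hypothesis.\<close>

lemma connected_clopen_eq:
  assumes "connected S" "Y \<subseteq> S" "open Y" "x \<in> Y"
    and "\<And>y. y \<in> S \<Longrightarrow> (\<exists>\<^sub>F z in nhds y. z \<in> Y) \<Longrightarrow> y \<in> Y"
  shows "Y = S"
proof (rule ccontr)
  assume "Y \<noteq> S"
  define V where "V = {y. \<forall>\<^sub>F z in nhds y. z \<notin> Y}"
  have V: "open V" unfolding V_def by (rule open_eventually_nhds)
  have "S \<subseteq> Y \<union> V"
    using assms(5) unfolding V_def frequently_def by auto
  moreover have "Y \<inter> V \<inter> S = {}"
    unfolding V_def using eventually_nhds_x_imp_x[of "\<lambda>z. z \<notin> Y"] by auto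
  ultimately have "Y \<inter> S = {} \<or> V \<inter> S = {}" using connectedD[OF assms(1) assms(3) V] by blast
  then show False using assms(2,4) \<open>S \<subseteq> Y \<union> V\<close> \<open>Y \<noteq> S\<close> by blast
qed

locale effective_torus_orbifold = smooth_torus_orbifold A act
  for A :: "('x::t2_space, 'v::euclidean_space, 'h) ochart set" and act :: "complex ^ 'n \<Rightarrow> 'x \<Rightarrow> 'x" +
  assumes connected_space: "connected (UNIV :: 'x set)"
    and faithful: "inj_on act (carrier torus_group)"
    and min1: "min_multiplicity A = 1"
begin

text \<open>Continuation of the set \<open>Y\<close> near whose points \<open>t\<close> acts
  trivially. At a limit point, a lift of \<open>t\<close> also lifts the identity near points over
  \<open>Y\<close>, so it has there the jet of a chart group element; in the limit one such element
  \<open>h\<close> has the jet of the lift at \<open>v\<close>. Dividing by \<open>h\<close> gives a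
  lift of \<open>t\<close> with trivial jet, and torsion makes it trivial near \<open>v\<close>.
  Faithfulness then gives \<open>t = 1\<close>.\<close>

lemma torsion_eq_one:
  assumes t: "t \<in> carrier torus_group" "t ^ N = 1" "N > 0"
    and ev: "\<forall>\<^sub>F y in nhds x. act t y = y"
  shows "t = 1"
proof -
  define Y where "Y = {x. \<forall>\<^sub>F y in nhds x. act t y = y}"
  have "Y = UNIV"
  proof (rule connected_clopen_eq[OF connected_space subset_UNIV])
    show "x \<in> Y" using ev by (simp add: Y_def)
    show "open Y" unfolding Y_def by (rule open_eventually_nhds)
    fix y assume fr: "\<exists>\<^sub>F z in nhds y. z \<in> Y"
    have fixed: "act t y = y"
    proof (rule ccontr)
      assume "act t y \<noteq> y"
      then obtain N1 N2 where N: "open N1" "open N2" "act t y \<in> N1" "y \<in> N2" "N1 \<inter> N2 = {}"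
        using hausdorff by metis
      have "\<forall>\<^sub>F z in nhds y. act t z \<in> N1" using act_eventually[OF t(1), of "\<lambda>z. z \<in> N1" y] N eventually_nhds by blast
      moreover have "\<forall>\<^sub>F z in nhds y. z \<in> N2" using N eventually_nhds by blast
      ultimately have "\<forall>\<^sub>F z in nhds y. \<not> z \<in> Y"
      proof eventually_elim
        case (elim z)
        have "act t z = z" if "z \<in> Y" using that eventually_nhds_x_imp_x unfolding Y_def by blast
        then show ?case using elim N by auto
      qed
      then show False using fr unfolding frequently_def by simp
    qed
    obtain c v where c: "c \<in> charts A" "v \<in> cover c" "proj c v = y" by (rule chart_at)
    note oc = chartsD[OF c(1)]
    obtain g where g: "is_lift c v c t g" "g v = v" using is_lift_exists[OF c(1,1) t(1) c(2,2)] c fixed by auto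
    have "\<exists>\<^sub>F w in nhds v. \<exists>h\<in>carrier (chart_group c). g w = chart_act c h w \<and> deriv_at g w = deriv_at (chart_act c h) w"
      unfolding frequently_def
    proof
      assume no: "\<forall>\<^sub>F w in nhds v. \<not> (\<exists>h\<in>carrier (chart_group c). g w = chart_act c h w \<and> deriv_at g w = deriv_at (chart_act c h) w)"
      have "\<forall>\<^sub>F w in nhds v. \<not> proj c w \<in> Y"
        using no is_lift_eventually[OF oc g(1)]
      proof eventually_elim
        case (elim w)
        show ?case
        proof
          assume "proj c w \<in> Y"
          then have "\<forall>\<^sub>F z in nhds w. act t (proj c z) = proj c z"
            using eventually_proj[OF oc is_liftD(1)[OF elim(2)], of "\<lambda>z. act t z = z"] unfolding Y_def by simp
          then have "\<forall>\<^sub>F z in nhds w. g z \<in> cover c \<and> proj c (g z) = act 1 (proj c z)"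
            using is_liftD(5)[OF elim(2)] by eventually_elim (simp add: act_one)
          then have "is_lift c w c 1 g" using is_liftD(1,2)[OF elim(2)] by (simp add: is_lift_def)
          then show False using lift_one_jet[OF oc] elim(1) by blast
        qed
      qed
      then have "\<forall>\<^sub>F z in nhds y. \<not> z \<in> Y" using eventually_proj[OF oc c(2), of "\<lambda>z. \<not> z \<in> Y"] c(3) by simp
      then show False using fr unfolding frequently_def by simp
    qed
    from C1_at_jet_limit[OF finite_chart_group[OF oc] is_liftD(2)[OF g(1)] C1_chart_act[OF oc _ c(2)] this]
    obtain h where h: "h \<in> carrier (chart_group c)" "g v = chart_act c h v" "deriv_at g v = deriv_at (chart_act c h) v"
      by blast
    let ?k = "inv\<^bsub>chart_group c\<^esub> h"
    have k: "?k \<in> carrier (chart_group c)" using chart_inv_closed[OF oc h(1)] .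
    have hv: "chart_act c h v = v" using h g by simp
    have kv: "chart_act c ?k v = v" using chart_act_inv(1)[OF oc h(1) c(2)] hv by simp
    \<comment> \<open>Composition with the inverse of \<open>h\<close> changes the lift of
      \<open>t\<close> without changing \<open>t\<close>, and makes its derivative at
      \<open>v\<close> the identity.\<close>
    define f where "f w = chart_act c ?k (g w)" for w
    have f: "is_lift c v c (1 * t) f" "f v = v"
      unfolding f_def using is_lift_compose[OF g(1), of c 1] is_lift_chart_act[OF oc c(2) k] g(2) t kv by auto
    have "deriv_at f v u = u" for u
    proof -
      have "deriv_at f v u = deriv_at (chart_act c ?k) v (deriv_at (chart_act c h) v u)"
        unfolding f_def using C1_at_compose(2)[OF is_liftD(2)[OF g(1)], of "chart_act c ?k"] C1_chart_act[OF oc k c(2)] g(2) h(3) by simp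
      also have "\<dots> = u"
      proof -
        have "\<forall>\<^sub>F w in nhds v. chart_act c ?k (chart_act c h w) = w"
          using eventually_cover[OF oc c(2)] by eventually_elim (use chart_act_inv(1)[OF oc h(1)] in auto)
        then show ?thesis
          using inj_deriv_at_inverse(1)[OF C1_chart_act[OF oc h(1) c(2)], of "chart_act c ?k"] C1_chart_act[OF oc k c(2)] hv by simp
      qed
      finally show ?thesis .
    qed
    then have df: "deriv_at f v = (\<lambda>u. u)" by blast
    have fl: "is_lift c v c t f" using f(1) by simp
    show "y \<in> Y"
      using torsion_trivial_jet_local[OF oc t fl f(2) df] c(3) by (simp add: Y_def)
  qed
  then have "act t x = act 1 x" for x
    using eventually_nhds_x_imp_x[of "\<lambda>y. act t y = y" x] act_one unfolding Y_def by auto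
  then show ?thesis using faithful t(1) by (auto dest!: inj_onD[of act _ t 1])
qed

text \<open>A nontrivial \<open>h\<close> with trivial jet fixes a neighbourhood, so multiplicities
  near its point exceed one. The set \<open>E\<close> of points with such a neighbourhood is closed
  by the same jet argument, hence everything, which contradicts the existence of a point of
  multiplicity one.\<close>

lemma chart_act_effective:
  assumes c: "c \<in> charts A" and v: "v \<in> cover c" and h: "h \<in> carrier (chart_group c)"
    and jet: "chart_act c h v = v" "deriv_at (chart_act c h) v = (\<lambda>u. u)"
  shows "h = \<one>\<^bsub>chart_group c\<^esub>"
proof (rule ccontr)
  assume h1: "h \<noteq> \<one>\<^bsub>chart_group c\<^esub>"
  define E where "E = {x. \<forall>\<^sub>F y in nhds x. multiplicity A y \<noteq> 1}"
  have *: "proj c v \<in> E" if c: "c \<in> charts A" and v: "v \<in> cover c" and h: "h \<in> carrier (chart_group c)"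
    and jet: "chart_act c h v = v" "deriv_at (chart_act c h) v = (\<lambda>u. u)" and h1: "h \<noteq> \<one>\<^bsub>chart_group c\<^esub>"
    for c h and v :: 'v
  proof -
    note oc = chartsD[OF c]
    have "\<forall>\<^sub>F w in nhds v. multiplicity A (proj c w) \<noteq> 1"
      using chart_act_trivial_jet[OF oc h v jet] eventually_cover[OF oc v]
    proof eventually_elim
      case (elim w)
      have fin: "finite (stabilizer (chart_group c) (chart_act c) w)"
        using finite_chart_group[OF oc] by (auto simp: stabilizer_def intro: finite_subset)
      have "{h, \<one>\<^bsub>chart_group c\<^esub>} \<subseteq> stabilizer (chart_group c) (chart_act c) w"
        using h elim chart_one_closed[OF oc] chart_act_one[OF oc] by (auto simp: stabilizer_def)
      from card_mono[OF fin this] show ?case using multiplicity_eq[OF orb c elim(2)] h1 by simp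
    qed
    then show ?thesis using eventually_proj[OF oc v, of "\<lambda>y. multiplicity A y \<noteq> 1"] by (simp add: E_def)
  qed
  have "E = UNIV"
  proof (rule connected_clopen_eq[OF connected_space subset_UNIV])
    show "proj c v \<in> E" using *[OF c v h jet h1] .
    show "open E" unfolding E_def by (rule open_eventually_nhds)
    fix y assume fr: "\<exists>\<^sub>F z in nhds y. z \<in> E"
    obtain c v where c: "c \<in> charts A" "v \<in> cover c" "proj c v = y" by (rule chart_at)
    note oc = chartsD[OF c(1)]
    let ?H = "carrier (chart_group c) - {\<one>\<^bsub>chart_group c\<^esub>}"
    have fin: "finite ?H" using finite_chart_group[OF oc] by simp
    have "\<exists>\<^sub>F w in nhds v. \<exists>h\<in>?H. w = chart_act c h w \<and> deriv_at (\<lambda>w. w) w = deriv_at (chart_act c h) w"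
      unfolding frequently_def
    proof
      assume no: "\<forall>\<^sub>F w in nhds v. \<not> (\<exists>h\<in>?H. w = chart_act c h w \<and> deriv_at (\<lambda>w. w) w = deriv_at (chart_act c h) w)"
      have "\<forall>\<^sub>F w in nhds v. \<not> proj c w \<in> E"
        using no eventually_cover[OF oc c(2)]
      proof eventually_elim
        case (elim w)
        show ?case
        proof
          assume "proj c w \<in> E"
          then have "\<forall>\<^sub>F z in nhds w. multiplicity A (proj c z) \<noteq> 1"
            using eventually_proj[OF oc elim(2), of "\<lambda>y. multiplicity A y \<noteq> 1"] unfolding E_def by simp
          \<comment> \<open>Every \<open>z\<close> near \<open>w\<close> is fixed by some nontrivial
            element, which may vary with \<open>z\<close>; finite choice then selects one whose jet
            at \<open>w\<close> is that of the identity.\<close>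
          then have "\<forall>\<^sub>F z in nhds w. \<exists>h\<in>?H. z = chart_act c h z"
            using eventually_cover[OF oc elim(2)]
          proof eventually_elim
            case (elim z)
            have "\<one>\<^bsub>chart_group c\<^esub> \<in> stabilizer (chart_group c) (chart_act c) z"
              using chart_one_closed[OF oc] chart_act_one[OF oc elim(2)] by (simp add: stabilizer_def)
            moreover have "stabilizer (chart_group c) (chart_act c) z \<noteq> {\<one>\<^bsub>chart_group c\<^esub>}"
              using elim multiplicity_eq[OF orb c(1) elim(2)] by auto
            ultimately obtain h where "h \<in> stabilizer (chart_group c) (chart_act c) z" "h \<noteq> \<one>\<^bsub>chart_group c\<^esub>" by blast
            then show ?case by (intro bexI[of _ h]) (auto simp: stabilizer_def)
          qed
          from C1_at_finite_choice[OF fin C1_at_ident C1_chart_act[OF oc _ elim(2)] this]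
          show False using elim(1) by blast
        qed
      qed
      then have "\<forall>\<^sub>F z in nhds y. \<not> z \<in> E" using eventually_proj[OF oc c(2), of "\<lambda>z. \<not> z \<in> E"] c(3) by simp
      then show False using fr unfolding frequently_def by simp
    qed
    from C1_at_jet_limit[OF fin C1_at_ident C1_chart_act[OF oc _ c(2)] this]
    obtain h where "h \<in> ?H" "v = chart_act c h v" "deriv_at (\<lambda>w. w) v = deriv_at (chart_act c h) v"
      by blast
    then show "y \<in> E" using *[OF c(1,2), of h] c(3) by simp
  qed
  moreover obtain x where "multiplicity A x = 1"
    using min1 Inf_nat_def1[of "range (multiplicity A)"] unfolding min_multiplicity_def by force
  ultimately show False
    using eventually_nhds_x_imp_x[of "\<lambda>y. multiplicity A y \<noteq> 1" x] unfolding E_def by auto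
qed

end

section \<open>The circle\<close>

lemma connected_circle: "connected (sphere (0::complex) 1)"
  by (rule connected_sphere) simp

lemma unit_eq_cis_Arg: "norm z = 1 \<Longrightarrow> cis (Arg z) = z"
  using rcis_cmod_Arg[of z] by (simp add: rcis_def)

text \<open>A local section of \<open>cis\<close> near \<open>z\<close> is
  \<open>Arg z + Arg (w / z)\<close>: the quotient \<open>w / z\<close> stays near 1, away from the
  branch cut, wherever \<open>z\<close> lies.\<close>

lemma continuous_on_circleI:
  fixes h :: "complex \<Rightarrow> 'a::topological_space"
  assumes "continuous_on UNIV (\<lambda>\<theta>::real. h (cis \<theta>))"
  shows "continuous_on (sphere 0 1) h"
  unfolding continuous_on_eq_continuous_within
proof
  fix z :: complex assume z: "z \<in> sphere 0 1"
  then have z0: "z \<noteq> 0" and cz: "cis (Arg z) = z" using unit_eq_cis_Arg by auto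
  define k where "k w = Arg z + Arg (w / z)" for w
  have zz: "z / z = 1" using z0 by (rule divide_self)
  have "isCont Arg (z / z)" unfolding zz by (rule continuous_at_Arg) (simp add: complex_nonpos_Reals_iff)
  then have "isCont (\<lambda>w. Arg (w / z)) z"
    by (rule isCont_o2[where g = Arg and f = "\<lambda>w. w / z", rotated]) (intro continuous_intros z0)
  then have k: "isCont k z" unfolding k_def by (intro continuous_intros)
  have "isCont (\<lambda>\<theta>::real. h (cis \<theta>)) (k z)" using assms by (simp add: continuous_on_eq_continuous_at)
  then have "isCont (\<lambda>w. h (cis (k w))) z"
    using continuous_at_compose[OF k, of "\<lambda>\<theta>. h (cis \<theta>)"] by (simp add: o_def)
  then have c: "continuous (at z within sphere 0 1) (\<lambda>w. h (cis (k w)))"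
    using continuous_at_imp_continuous_at_within by blast
  have eq: "cis (k w) = w" if "w \<in> sphere 0 1" for w
  proof -
    have "norm (w / z) = 1" using that z by (simp add: norm_divide)
    then show ?thesis using unit_eq_cis_Arg[of "w / z"] cz z0 by (simp add: k_def cis_mult[symmetric])
  qed
  show "continuous (at z within sphere 0 1) h"
    by (rule continuous_transform_within[OF c zero_less_one z]) (simp add: eq)
qed

lemma continuous_circle_finite:
  fixes f :: "complex \<Rightarrow> 'a::metric_space"
  assumes "continuous_on (sphere 0 1) f" "finite F" "\<And>z. z \<in> sphere 0 1 \<Longrightarrow> f z \<in> F" "z \<in> sphere 0 1"
  shows "f z = f 1"
proof -
  have "finite (f ` sphere 0 1)"
    by (rule finite_subset[OF _ assms(2)]) (use assms(3) in blast)
  then have "f ` sphere 0 1 = {} \<or> (\<exists>a. f ` sphere 0 1 = {a})"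
    using connected_finite_iff_sing[OF connected_continuous_image[OF assms(1) connected_circle]] by simp
  moreover have "f z \<in> f ` sphere 0 1" "f 1 \<in> f ` sphere 0 1" using assms(4) by (auto intro!: imageI)
  ultimately show ?thesis by (elim disjE exE) simp_all
qed

text \<open>The roots of unity are the points with rational angle up to full turns and are dense.
  This extends statements accessible only for torsion elements to the whole circle.\<close>

lemma circle_closed_torsion:
  fixes f :: "complex \<Rightarrow> 'a::t2_space"
  assumes f: "continuous_on (sphere 0 1) f" and C: "closed C"
    and tor: "\<And>z N. z \<in> sphere 0 1 \<Longrightarrow> N > (0::nat) \<Longrightarrow> z ^ N = 1 \<Longrightarrow> f z \<in> C"
    and z: "z \<in> sphere 0 1"
  shows "f z \<in> C"
proof -
  define r where "r = Arg z / (2 * pi)"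
  have zr: "z = cis (2 * pi * r)" using unit_eq_cis_Arg[of z] z by (simp add: r_def)
  have "r \<in> closure \<rat>"
    unfolding closure_approachable
  proof (intro allI impI)
    fix e :: real assume "e > 0"
    then obtain q where "q \<in> \<rat>" "r - e < q" "q < r" using Rats_dense_in_real[of "r - e" r] by auto
    then show "\<exists>y\<in>\<rat>. dist y r < e" by (intro bexI[of _ q]) (auto simp: dist_real_def)
  qed
  then obtain q where q: "\<And>n. q n \<in> \<rat>" "q \<longlonglongrightarrow> r" unfolding closure_sequential by blast
  have inC: "f (cis (2 * pi * q n)) \<in> C" for n
  proof -
    obtain a b where ab: "q n = of_int a / of_int b" "b > 0" using q(1)[of n] by (elim Rats_cases') auto
    have "cis (2 * pi * q n) ^ nat b = cis (real (nat b) * (2 * pi * q n))" by (rule Complex.DeMoivre)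
    also have "real (nat b) * (2 * pi * q n) = 2 * pi * of_int a" using ab by simp
    also have "cis (2 * pi * of_int a) = 1" by (rule cis_multiple_2pi) simp
    finally show ?thesis using tor[of "cis (2 * pi * q n)" "nat b"] ab(2) by simp
  qed
  have cf: "continuous_on UNIV (\<lambda>\<theta>. f (cis \<theta>))"
    by (rule continuous_on_compose2[OF f]) (auto intro!: continuous_intros)
  have "(\<lambda>n. 2 * pi * q n) \<longlonglongrightarrow> 2 * pi * r" using q(2) by (intro tendsto_intros)
  then have "(\<lambda>n. f (cis (2 * pi * q n))) \<longlonglongrightarrow> f (cis (2 * pi * r))"
    using cf by (intro isCont_tendsto_compose[of _ "\<lambda>\<theta>. f (cis \<theta>)"]) (auto simp: continuous_on_eq_continuous_at)
  from closed_sequentially[OF C inC this] show ?thesis unfolding zr .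
qed

lemma norm_cis_diff_le: "norm (cis a - cis b) \<le> \<bar>a - b\<bar>"
proof -
  have "cis a - cis b = cis b * (cis (a - b) - 1)"
    by (simp add: cis_mult right_diff_distrib)
  then have "cis a - cis b = cis b * (exp (\<i> * of_real (a - b)) - 1)"
    by (simp only: cis_conv_exp[of "a - b"])
  then have "norm (cis a - cis b) = 2 * \<bar>sin ((a - b) / 2)\<bar>"
    using dist_exp_i_1[of "a - b"] by (simp add: norm_mult)
  also have "\<dots> \<le> \<bar>a - b\<bar>" using abs_sin_x_le_abs_x[of "(a - b) / 2"] by simp
  finally show ?thesis .
qed

text \<open>An element of infinite order would have powers arbitrarily close to \<open>-1\<close>.\<close>

lemma torsion_free_closed_subgroup_circle:
  assumes K: "closed K" "K \<subseteq> sphere (0::complex) 1" "1 \<in> K" "\<And>z w. z \<in> K \<Longrightarrow> w \<in> K \<Longrightarrow> z * w \<in> K"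
    and tf: "\<And>z N. z \<in> K \<Longrightarrow> N > (0::nat) \<Longrightarrow> z ^ N = 1 \<Longrightarrow> z = 1"
    and z: "z \<in> K"
  shows "z = 1"
proof (rule ccontr)
  assume z1: "z \<noteq> 1"
  have pow: "w ^ k \<in> K" if "w \<in> K" for w k using that K by (induction k) auto
  have "norm z = 1" using subsetD[OF K(2) z] by simp
  then have zc: "cis (Arg z) = z" by (rule unit_eq_cis_Arg)
  have "-1 \<in> closure K"
    unfolding closure_approachable
  proof (intro allI impI)
    fix e :: real assume e: "e > 0"
    obtain M :: nat where M0: "2 * pi / e < real M" using reals_Archimedean2 by blast
    have "0 < 2 * pi / e" using e by simp
    then have "real M > 0" using M0 by linarith
    then have M: "M > 0" "2 * pi / real M < e" using M0 e by (auto simp: field_simps)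
    \<comment> \<open>Dirichlet approximation of the angle as a fraction of a full turn: a power of
      \<open>z\<close> has angle \<open>\<beta>\<close> with absolute value below
      \<open>2 * pi / M < e\<close>, and \<open>\<beta>\<close> is nonzero because \<open>z\<close>
      is not torsion.\<close>
    obtain j k where jk: "0 < k" "k \<le> int M" "\<bar>of_int k * (Arg z / (2*pi)) - of_int j\<bar> < 1 / real M"
      by (rule Dirichlet_approx[OF M(1), of "Arg z / (2*pi)"])
    define \<beta> where "\<beta> = of_int k * Arg z - 2 * pi * of_int j"
    have "z ^ nat k = cis (real (nat k) * Arg z)" using Complex.DeMoivre[of "Arg z" "nat k"] zc by simp
    also have "real (nat k) * Arg z = \<beta> + 2 * pi * of_int j" using jk(1) by (simp add: \<beta>_def)
    also have "cis \<dots> = cis \<beta>" using cis_multiple_2pi[of "of_int j"] by (simp add: cis_mult[symmetric])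
    finally have zk: "z ^ nat k = cis \<beta>" .
    have "\<beta> = 2 * pi * (of_int k * (Arg z / (2*pi)) - of_int j)" by (simp add: \<beta>_def algebra_simps)
    then have "\<bar>\<beta>\<bar> = 2 * pi * \<bar>of_int k * (Arg z / (2*pi)) - of_int j\<bar>" by (simp add: abs_mult)
    also have "\<dots> < 2 * pi * (1 / real M)" using jk(3) by (intro mult_strict_left_mono) auto
    finally have \<beta>e: "\<bar>\<beta>\<bar> < e" using M(2) by simp
    have \<beta>0: "\<beta> \<noteq> 0" using tf[OF z, of "nat k"] zk jk(1) z1 by auto
    \<comment> \<open>Steps of length \<open>\<bar>\<beta>\<bar>\<close> starting from 0 eventually
      pass \<open>pi\<close>; step \<open>s\<close> is the last one not beyond it and so misses
      \<open>pi\<close> by less than \<open>e\<close>.\<close>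
    define s where "s = nat \<lfloor>pi / \<bar>\<beta>\<bar>\<rfloor>"
    have s: "real s \<le> pi / \<bar>\<beta>\<bar>" "pi / \<bar>\<beta>\<bar> < real s + 1"
      using \<beta>0 by (auto simp: s_def)
    then have sb: "real s * \<bar>\<beta>\<bar> \<le> pi" "pi < real s * \<bar>\<beta>\<bar> + \<bar>\<beta>\<bar>"
      using \<beta>0 by (auto simp: field_simps)
    have "dist (cis (real s * \<beta>)) (-1) = dist (cis (real s * \<bar>\<beta>\<bar>)) (cis pi)"
    proof (cases "\<beta> \<ge> 0")
      case False
      then have "cis (real s * \<beta>) = cnj (cis (real s * \<bar>\<beta>\<bar>))" by (simp add: cis_cnj)
      then have "dist (cis (real s * \<beta>)) (-1) = dist (cnj (cis (real s * \<bar>\<beta>\<bar>))) (cnj (-1))" by simp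
      also have "\<dots> = dist (cis (real s * \<bar>\<beta>\<bar>)) (-1)"
        by (simp only: dist_norm complex_cnj_diff[symmetric] complex_mod_cnj)
      finally show ?thesis by simp
    qed simp
    also have "\<dots> \<le> \<bar>real s * \<bar>\<beta>\<bar> - pi\<bar>"
      unfolding dist_norm by (rule norm_cis_diff_le)
    also have "\<dots> < e" using sb \<beta>e by linarith
    finally have "dist ((z ^ nat k) ^ s) (-1) < e" using zk Complex.DeMoivre[of \<beta> s] by simp
    then show "\<exists>y\<in>K. dist y (-1) < e" using pow[OF pow[OF z]] by blast
  qed
  \<comment> \<open>The element -1 has order two, which contradicts the absence of torsion.\<close>
  then have "-1 \<in> K" using K(1) by simp
  then show False using tf[of "-1" 2] by simp
qed

text \<open>Any choice of \<open>m\<close>-th roots would do.\<close>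

lemma root_factor_hom:
  fixes f :: "complex \<Rightarrow> 'a"
  assumes G: "Group.group G" and f: "f \<in> hom circle_group G" and m: "m > 0"
    and one: "\<And>\<omega>. \<omega> ^ m = 1 \<Longrightarrow> f \<omega> = \<one>\<^bsub>G\<^esub>"
  defines "f' \<equiv> \<lambda>w. f (cis (Arg w / real m))"
  shows "z \<in> sphere 0 1 \<Longrightarrow> f' (z ^ m) = f z" "f' \<in> hom circle_group G" "f' (cis \<theta>) = f (cis (\<theta> / real m))"
proof -
  have root: "cis (Arg w / real m) ^ m = w" if "w \<in> sphere 0 1" for w
    using Complex.DeMoivre[of "Arg w / real m" m] unit_eq_cis_Arg[of w] that m by simp
  show *: "f' (z ^ m) = f z" if z: "z \<in> sphere 0 1" for z
  proof -
    have zm: "z ^ m \<in> sphere 0 1" using z by (simp add: norm_power)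
    define \<omega> where "\<omega> = cis (Arg (z ^ m) / real m) / z"
    have z0: "z \<noteq> 0" using z by auto
    have "\<omega> ^ m = 1" using root[OF zm] z0 by (simp add: \<omega>_def power_divide)
    moreover have "\<omega> \<in> sphere 0 1" using z by (simp add: \<omega>_def norm_divide)
    moreover have "cis (Arg (z ^ m) / real m) = z * \<omega>" using z0 by (simp add: \<omega>_def)
    ultimately have "f' (z ^ m) = f z \<otimes>\<^bsub>G\<^esub> \<one>\<^bsub>G\<^esub>"
      using hom_mult[OF f, of z \<omega>] one z by (simp add: f'_def)
    moreover have "f z \<in> carrier G" using hom_in_carrier[OF f, of z] z by simp
    ultimately show ?thesis using group.is_monoid[OF G] by (simp add: monoid.r_one)
  qed
  show "f' \<in> hom circle_group G"
  proof (rule homI)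
    fix w1 w2 assume w: "w1 \<in> carrier circle_group" "w2 \<in> carrier circle_group"
    define z1 z2 where "z1 = cis (Arg w1 / real m)" and "z2 = cis (Arg w2 / real m)"
    have z: "z1 \<in> sphere 0 1" "z2 \<in> sphere 0 1" "w1 = z1 ^ m" "w2 = z2 ^ m"
      using root w by (auto simp: z1_def z2_def)
    show "f' w1 \<in> carrier G" using *[OF z(1)] z hom_in_carrier[OF f, of z1] by simp
    have "f' (w1 * w2) = f (z1 * z2)" using *[of "z1 * z2"] z by (simp add: power_mult_distrib norm_mult)
    then show "f' (w1 \<otimes>\<^bsub>circle_group\<^esub> w2) = f' w1 \<otimes>\<^bsub>G\<^esub> f' w2"
      using hom_mult[OF f, of z1 z2] z *[OF z(1)] *[OF z(2)] by simp
  qed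
  show "f' (cis \<theta>) = f (cis (\<theta> / real m))"
    using *[of "cis (\<theta> / real m)"] Complex.DeMoivre[of "\<theta> / real m" m] m by simp
qed

lemma hom_circle_torusD:
  assumes "\<rho> \<in> hom circle_group torus_group"
  shows "z \<in> sphere 0 1 \<Longrightarrow> \<rho> z \<in> carrier torus_group"
    "z \<in> sphere 0 1 \<Longrightarrow> w \<in> sphere 0 1 \<Longrightarrow> \<rho> (z * w) = \<rho> z * \<rho> w" "\<rho> 1 = 1"
    "z \<in> sphere 0 1 \<Longrightarrow> \<rho> (z ^ N) = \<rho> z ^ N"
proof -
  show 1: "\<rho> z \<in> carrier torus_group" if "z \<in> sphere 0 1" for z using assms that by (auto simp: hom_def)
  show 2: "\<rho> (z * w) = \<rho> z * \<rho> w" if "z \<in> sphere 0 1" "w \<in> sphere 0 1" for z w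
    using assms that by (auto simp: hom_def)
  have "\<rho> 1 = \<rho> 1 * \<rho> 1" using 2[of 1 1] by simp
  then have "torus_inv (\<rho> 1) * \<rho> 1 = torus_inv (\<rho> 1) * \<rho> 1 * \<rho> 1" by (simp add: mult.assoc)
  then show 3: "\<rho> 1 = 1" using torus_inv(2)[OF 1[of 1]] by simp
  show "\<rho> (z ^ N) = \<rho> z ^ N" if "z \<in> sphere 0 1"
    by (induction N) (use 2 3 that in \<open>auto simp: norm_power\<close>)
qed

text \<open>Fibres are cosets of the finite kernel \<open>K\<close>. Arcs short enough to meet each
  coset at most once are mapped injectively, and the preimage of the image of one arc is the
  disjoint union of its translates by \<open>K\<close>.\<close>

lemma covering_space_circle_hom:
  fixes \<sigma> :: "complex \<Rightarrow> complex ^ 'n"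
  assumes hom: "\<sigma> \<in> hom circle_group torus_group" and cont: "continuous_on (sphere 0 1) \<sigma>"
    and fin: "finite (kernel circle_group torus_group \<sigma>)"
  shows "covering_space (sphere 0 1) \<sigma> (\<sigma> ` sphere 0 1)"
proof -
  let ?C = "sphere (0::complex) 1"
  define K where "K = {z \<in> ?C. \<sigma> z = 1}"
  have K: "finite K" using fin by (simp add: K_def kernel_def)
  note \<sigma> = hom_circle_torusD[OF hom]
  have K1: "1 \<in> K" using \<sigma>(3) by (simp add: K_def)
  have quot: "\<sigma> z = \<sigma> w \<longleftrightarrow> z / w \<in> K" if "z \<in> ?C" "w \<in> ?C" for z w
  proof -
    have zw: "z / w \<in> ?C" using that by (simp add: norm_divide)
    have "\<sigma> z = \<sigma> (z / w) * \<sigma> w" using \<sigma>(2)[OF zw that(2)] that by (cases "w = 0") auto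
    moreover have "s = 1 \<longleftrightarrow> s * \<sigma> w = \<sigma> w" for s
      using torus_inv(3)[OF \<sigma>(1)[OF that(2)]] by (metis mult.assoc mult.right_neutral mult_1)
    ultimately show ?thesis using zw by (auto simp: K_def)
  qed
  \<comment> \<open>A radius of \<open>e/2\<close> works: two points of such an arc have a quotient
    within \<open>e\<close> of 1, so if they lie in one fibre the quotient is 1.\<close>
  obtain e where e: "e > 0" "\<And>\<kappa>. \<kappa> \<in> K \<Longrightarrow> \<kappa> \<noteq> 1 \<Longrightarrow> dist 1 \<kappa> \<ge> e"
    using finite_set_avoid[OF K, of 1] by metis
  define B where "B z = ?C \<inter> ball z (e/2)" for z
  have opB: "openin (top_of_set ?C) (B z)" for z by (auto simp: B_def openin_open)
  have inj: "z = w" if "z \<in> B u" "w \<in> B u" "\<sigma> z = \<sigma> w" for u z w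
  proof (rule ccontr)
    assume ne: "z \<noteq> w"
    have C: "z \<in> ?C" "w \<in> ?C" using that by (auto simp: B_def)
    have w0: "w \<noteq> 0" using C by auto
    have "dist 1 (z / w) = norm ((w - z) / w)" using w0 by (simp add: dist_norm diff_divide_distrib)
    also have "\<dots> = norm (w - z)" using C by (simp add: norm_divide)
    also have "\<dots> < e"
    proof -
      have "norm (w - z) \<le> dist u z + dist u w" by (metis add.commute dist_commute dist_norm dist_triangle3)
      then show ?thesis using that by (simp add: B_def)
    qed
    finally have "dist 1 (z / w) < e" .
    moreover have "z / w \<in> K" using quot C that by simp
    moreover have "z / w \<noteq> 1" using ne w0 by simp
    ultimately show False using e(2) by fastforce
  qed
  have open_img: "openin (top_of_set (\<sigma> ` ?C)) (\<sigma> ` U)" if U: "openin (top_of_set ?C) U" for U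
  proof -
    have UC: "U \<subseteq> ?C" using U openin_imp_subset by blast
    \<comment> \<open>The saturation of \<open>U\<close>. The image of its compact complement is
      closed, and the image of \<open>U\<close> is what remains, so \<open>\<sigma>\<close> is open
      onto its image.\<close>
    define KU where "KU = (\<Union>\<kappa>\<in>K. (\<lambda>z. \<kappa> * z) ` U)"
    have "openin (top_of_set ?C) KU"
      unfolding KU_def
    proof (intro openin_Union, clarsimp)
      fix \<kappa> assume k: "\<kappa> \<in> K"
      then have k1: "norm \<kappa> = 1" by (simp add: K_def)
      then have k0: "\<kappa> \<noteq> 0" by auto
      obtain O' where O': "open O'" "U = ?C \<inter> O'" using U by (auto simp: openin_open)
      have "(\<lambda>z. \<kappa> * z) ` U = ?C \<inter> ((\<lambda>z. z / \<kappa>) -` O')"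
      proof (intro equalityI subsetI)
        fix w assume "w \<in> (\<lambda>z. \<kappa> * z) ` U"
        then show "w \<in> ?C \<inter> ((\<lambda>z. z / \<kappa>) -` O')" using O' k1 k0 by (auto simp: norm_mult)
      next
        fix w assume "w \<in> ?C \<inter> ((\<lambda>z. z / \<kappa>) -` O')"
        then show "w \<in> (\<lambda>z. \<kappa> * z) ` U" using O' k1 k0
          by (intro image_eqI[of _ _ "w / \<kappa>"]) (auto simp: norm_divide)
      qed
      moreover have "open ((\<lambda>z. z / \<kappa>) -` O')"
        by (rule open_vimage[OF O'(1)]) (use k0 in \<open>auto intro!: continuous_intros\<close>)
      ultimately show "openin (top_of_set ?C) ((\<lambda>z. \<kappa> * z) ` U)" by (auto simp: openin_open)
    qed
    then have "closedin (top_of_set ?C) (?C - KU)" by (simp add: closedin_diff)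
    then have "compact (?C - KU)" using closedin_compact compact_sphere by blast
    then have cl: "closed (\<sigma> ` (?C - KU))"
      by (intro compact_imp_closed compact_continuous_image continuous_on_subset[OF cont]) auto
    have "\<sigma> ` U = \<sigma> ` ?C - \<sigma> ` (?C - KU)"
    proof (intro equalityI subsetI)
      fix s assume "s \<in> \<sigma> ` U"
      then obtain u where u: "u \<in> U" "s = \<sigma> u" by blast
      have "s \<notin> \<sigma> ` (?C - KU)"
      proof
        assume "s \<in> \<sigma> ` (?C - KU)"
        then obtain w where w: "w \<in> ?C" "w \<notin> KU" "\<sigma> w = \<sigma> u" using u by auto
        then have "w / u \<in> K" using quot UC u by blast
        moreover have "w = (w / u) * u" using u UC by auto
        ultimately show False using w u unfolding KU_def by blast
      qed
      then show "s \<in> \<sigma> ` ?C - \<sigma> ` (?C - KU)" using u UC by blast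
    next
      fix s assume "s \<in> \<sigma> ` ?C - \<sigma> ` (?C - KU)"
      then obtain w where w: "w \<in> KU" "s = \<sigma> w" by blast
      then obtain \<kappa> u where ku: "\<kappa> \<in> K" "u \<in> U" "w = \<kappa> * u" unfolding KU_def by blast
      then have "\<sigma> w = \<sigma> u" using \<sigma>(2)[of \<kappa> u] UC by (auto simp: K_def)
      then show "s \<in> \<sigma> ` U" using w ku by blast
    qed
    then show ?thesis using cl by (metis closed_subset closedin_diff closedin_topspace image_mono Diff_subset openin_diff openin_topspace topspace_euclidean_subtopology)
  qed
  show ?thesis
    unfolding covering_space_def
  proof (intro conjI ballI cont refl)
    fix s assume "s \<in> \<sigma> ` ?C"
    then obtain z where z: "z \<in> ?C" "s = \<sigma> z" by blast
    define V where "V = {w \<in> ?C. \<sigma> w = s}"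
    have "V \<subseteq> (\<lambda>\<kappa>. \<kappa> * z) ` K"
    proof
      fix w assume "w \<in> V"
      then have "w / z \<in> K" "w = (w / z) * z" using quot z by (auto simp: V_def)
      then show "w \<in> (\<lambda>\<kappa>. \<kappa> * z) ` K" by blast
    qed
    then have finV: "finite V" using K finite_subset by blast
    define T where "T = \<sigma> ` B z"
    have img: "\<sigma> ` B w = T" if w: "w \<in> V" for w
    proof -
      have sub: "\<sigma> ` B w \<subseteq> \<sigma> ` B w'" if w: "w \<in> V" "w' \<in> V" for w w'
      proof
        fix s' assume "s' \<in> \<sigma> ` B w"
        then obtain u where u: "u \<in> B w" "s' = \<sigma> u" by blast
        have C: "w \<in> ?C" "w' \<in> ?C" "u \<in> ?C" using w u by (auto simp: V_def B_def)
        have k: "w' / w \<in> K" using quot C w by (auto simp: V_def)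
        have n: "norm (w' / w) = 1" "w \<noteq> 0" using C by (auto simp: norm_divide)
        have "dist w' (w' / w * u) = norm (w' / w * (w - u))" using n(2) by (simp add: dist_norm right_diff_distrib)
        also have "\<dots> = dist w u" unfolding norm_mult n(1) by (simp add: dist_norm)
        finally have "w' / w * u \<in> B w'" using u C n by (auto simp: B_def norm_mult norm_divide)
        moreover have "\<sigma> (w' / w * u) = \<sigma> u" using \<sigma>(2)[of "w' / w" u] k C by (auto simp: K_def)
        ultimately show "s' \<in> \<sigma> ` B w'" using u by (metis imageI)
      qed
      have "z \<in> V" using z by (simp add: V_def)
      then show ?thesis using sub w unfolding T_def by blast
    qed
    show "\<exists>T. s \<in> T \<and> openin (top_of_set (\<sigma> ` ?C)) T \<and>
      (\<exists>v. \<Union> v = ?C \<inter> \<sigma> -` T \<and> (\<forall>u\<in>v. openin (top_of_set ?C) u) \<and> pairwise disjnt v \<and>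
        (\<forall>u\<in>v. \<exists>q. homeomorphism u T \<sigma> q))"
    proof (intro exI[of _ T] conjI exI[of _ "B ` V"] ballI)
      show "s \<in> T" using z e by (auto simp: T_def B_def)
      show "openin (top_of_set (\<sigma> ` ?C)) T" unfolding T_def by (rule open_img[OF opB])
      show "\<Union> (B ` V) = ?C \<inter> \<sigma> -` T"
      proof (intro equalityI subsetI)
        fix w assume "w \<in> \<Union> (B ` V)"
        then obtain x where x: "x \<in> V" "w \<in> B x" by blast
        then have "\<sigma> w \<in> T" using img[OF x(1)] by blast
        then show "w \<in> ?C \<inter> \<sigma> -` T" using x(2) by (simp add: B_def)
      next
        fix w assume w: "w \<in> ?C \<inter> \<sigma> -` T"
        then obtain u where u: "u \<in> B z" "\<sigma> w = \<sigma> u" unfolding T_def by auto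
        have C: "w \<in> ?C" "u \<in> ?C" using w u by (auto simp: B_def)
        have k: "w / u \<in> K" using quot C u by blast
        have n: "norm (w / u) = 1" "u \<noteq> 0" using C by (auto simp: norm_divide)
        have "w / u * z \<in> V" using \<sigma>(2)[of "w / u" z] k z n C by (auto simp: K_def V_def norm_mult norm_divide)
        moreover have "dist (w / u * z) w = norm (w / u * (z - u))" using n(2) by (simp add: dist_norm right_diff_distrib)
        then have "dist (w / u * z) w = dist z u" unfolding norm_mult n(1) by (simp add: dist_norm)
        then have "w \<in> B (w / u * z)" using u C by (auto simp: B_def)
        ultimately show "w \<in> \<Union> (B ` V)" by blast
      qed
      show "pairwise disjnt (B ` V)"
        unfolding pairwise_def
      proof (intro ballI impI)
        fix X Y assume XY: "X \<in> B ` V" "Y \<in> B ` V" "X \<noteq> Y"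
        then obtain w w' where w: "w \<in> V" "w' \<in> V" "X = B w" "Y = B w'" by blast
        show "disjnt X Y"
        proof (rule ccontr)
          assume "\<not> disjnt X Y"
          then obtain u where u: "u \<in> B w" "u \<in> B w'" using w by (auto simp: disjnt_iff)
          have "w \<in> B u" "w' \<in> B u" using u w by (auto simp: B_def V_def dist_commute)
          moreover have "\<sigma> w = \<sigma> w'" using w by (auto simp: V_def)
          ultimately show False using inj XY w by blast
        qed
      qed
      fix U assume "U \<in> B ` V"
      then obtain w where w: "w \<in> V" "U = B w" by blast
      then show "openin (top_of_set ?C) U" using opB by simp
      have BC: "B w \<subseteq> ?C" by (auto simp: B_def)
      have TT: "T \<subseteq> \<sigma> ` ?C" by (auto simp: T_def B_def)
      have c: "continuous_on (B w) \<sigma>" using continuous_on_subset[OF cont BC] .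
      have i: "inj_on \<sigma> (B w)" using inj by (intro inj_onI) blast
      have o: "openin (top_of_set T) (\<sigma> ` O')" if O': "openin (top_of_set (B w)) O'" for O'
      proof -
        have "openin (top_of_set ?C) O'" using openin_trans[OF O' opB] by simp
        then have "openin (top_of_set (\<sigma> ` ?C)) (\<sigma> ` O')" by (rule open_img)
        moreover have "\<sigma> ` O' \<subseteq> T" using img[OF w(1)] openin_imp_subset[OF O'] by blast
        ultimately show ?thesis using openin_subset_trans TT by blast
      qed
      from homeomorphism_injective_open_map[OF c img[OF w(1)] i o]
      show "\<exists>q. homeomorphism U T \<sigma> q" using w by blast
    qed
  qed
qed

section \<open>Circle actions on charts\<close>

lemma continuous_on_linear_apply:
  fixes L :: "'a::topological_space \<Rightarrow> 'v::euclidean_space \<Rightarrow> 'w::real_normed_vector"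
  assumes lin: "\<And>z. z \<in> S \<Longrightarrow> linear (L z)" and L: "\<And>u. continuous_on S (\<lambda>z. L z u)"
    and f: "continuous_on S f"
  shows "continuous_on S (\<lambda>z. L z (f z))"
proof (rule continuous_on_eq)
  show "continuous_on S (\<lambda>z. \<Sum>b\<in>Basis. (f z \<bullet> b) *\<^sub>R L z b)"
    by (intro continuous_intros L f)
  show "(\<Sum>b\<in>Basis. (f z \<bullet> b) *\<^sub>R L z b) = L z (f z)" if "z \<in> S" for z
  proof -
    have "L z (f z) = L z (\<Sum>b\<in>Basis. (f z \<bullet> b) *\<^sub>R b)" by (simp add: euclidean_representation)
    also have "\<dots> = (\<Sum>b\<in>Basis. (f z \<bullet> b) *\<^sub>R L z b)"
      using lin[OF that] by (simp add: linear_sum linear_cmul)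
    finally show ?thesis by simp
  qed
qed

lemma curve_eventually_neq:
  fixes d :: "real \<Rightarrow> 'a::real_normed_vector"
  assumes "(d has_vector_derivative e) (at 0)" "d 0 = 0" "e \<noteq> 0"
  shows "\<forall>\<^sub>F t in at 0. d t \<noteq> 0"
proof -
  have "((\<lambda>h. norm (d (0 + h) - d 0 - h *\<^sub>R e) / norm h) \<longlongrightarrow> 0) (at 0)"
    using assms(1) unfolding has_vector_derivative_def has_derivative_at by blast
  then have "\<forall>\<^sub>F h in at 0. norm (d (0 + h) - d 0 - h *\<^sub>R e) / norm h < norm e"
    using assms(3) by (intro order_tendstoD) auto
  moreover have "\<forall>\<^sub>F h in at (0::real). h \<noteq> 0" by (simp add: eventually_at_filter)
  ultimately show ?thesis
  proof eventually_elim
    case (elim h)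
    show ?case
    proof
      assume "d h = 0"
      then have "norm (d (0 + h) - d 0 - h *\<^sub>R e) / norm h = norm e" using elim(2) assms(2) by simp
      then show False using elim(1) by simp
    qed
  qed
qed

lemma C1_at_vector_derivative:
  assumes "C1_at f v" "\<gamma> (0::real) = v" "(\<gamma> has_vector_derivative u) (at 0)"
  shows "((\<lambda>t. f (\<gamma> t)) has_vector_derivative deriv_at f v u) (at 0)"
proof -
  have "(f has_derivative deriv_at f v) (at (\<gamma> 0))" using C1_at_has_derivative[OF assms(1)] assms(2) by simp
  from has_derivative_compose[OF assms(3)[unfolded has_vector_derivative_def] this]
  have "((\<lambda>t. f (\<gamma> t)) has_derivative (\<lambda>t. deriv_at f v (t *\<^sub>R u))) (at 0)" .
  then show ?thesis unfolding has_vector_derivative_def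
    using C1_at_linear_deriv[OF assms(1)] by (simp add: linear_cmul)
qed

text \<open>A one-dimensional counterpart of \<open>C1_at_finite_choice\<close>, giving only the
  derivative along the curve. A difference with nonzero value or nonzero derivative at 0 has no
  zeros at small nonzero \<open>t\<close>, so if every \<open>h\<close> failed, no choice would be
  left at such \<open>t\<close>.\<close>

lemma curve_finite_choice:
  fixes f :: "'a::real_normed_vector \<Rightarrow> 'b::real_normed_vector"
  assumes H: "finite H" and f: "C1_at f v" and k: "\<And>h. h \<in> H \<Longrightarrow> C1_at (k h) v"
    and \<gamma>: "\<gamma> (0::real) = v" "(\<gamma> has_vector_derivative u) (at 0)"
    and ev: "\<forall>\<^sub>F t in nhds 0. \<exists>h\<in>H. f (\<gamma> t) = k h (\<gamma> t)"
  shows "\<exists>h\<in>H. f v = k h v \<and> deriv_at f v u = deriv_at (k h) v u"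
proof (rule ccontr)
  assume no: "\<not> ?thesis"
  have "\<forall>\<^sub>F t in at 0. f (\<gamma> t) - k h (\<gamma> t) \<noteq> 0" if h: "h \<in> H" for h
  proof -
    have D: "((\<lambda>t. f (\<gamma> t) - k h (\<gamma> t)) has_vector_derivative (deriv_at f v u - deriv_at (k h) v u)) (at 0)"
      by (intro has_vector_derivative_diff C1_at_vector_derivative f k h \<gamma>)
    show ?thesis
    proof (cases "f v = k h v")
      case True
      then have "deriv_at f v u - deriv_at (k h) v u \<noteq> 0" using no h by auto
      moreover have "f (\<gamma> 0) - k h (\<gamma> 0) = 0" using True \<gamma>(1) by simp
      ultimately show ?thesis using curve_eventually_neq[OF D] by blast
    next
      case False
      have "isCont (\<lambda>t. f (\<gamma> t) - k h (\<gamma> t)) 0"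
        using D has_vector_derivative_continuous by blast
      then have "((\<lambda>t. f (\<gamma> t) - k h (\<gamma> t)) \<longlongrightarrow> f v - k h v) (at 0)" using \<gamma>(1) by (simp add: isCont_def)
      then show ?thesis using False by (intro tendsto_imp_eventually_ne) auto
    qed
  qed
  then have "\<forall>\<^sub>F t in at 0. \<forall>h\<in>H. f (\<gamma> t) - k h (\<gamma> t) \<noteq> 0"
    by (intro eventually_ball_finite[OF H] ballI)
  moreover have "\<forall>\<^sub>F t in at 0. \<exists>h\<in>H. f (\<gamma> t) = k h (\<gamma> t)"
    using ev by (simp add: eventually_nhds_conv_at)
  ultimately have "\<forall>\<^sub>F t in at (0::real). False" by eventually_elim auto
  then show False by simp
qed

lemma deriv_chart_act_inv:
  assumes c: "orbifold_chart c" and h: "h \<in> carrier (chart_group c)" and v: "v \<in> cover c"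
  shows "deriv_at (chart_act c (inv\<^bsub>chart_group c\<^esub> h)) (chart_act c h v) (deriv_at (chart_act c h) v u) = u"
proof (rule inj_deriv_at_inverse(1))
  show "C1_at (chart_act c h) v" using C1_chart_act[OF c h v] .
  show "C1_at (chart_act c (inv\<^bsub>chart_group c\<^esub> h)) (chart_act c h v)"
    using C1_chart_act[OF c chart_inv_closed[OF c h] chart_act_closed[OF c h v]] .
  show "\<forall>\<^sub>F w in nhds v. chart_act c (inv\<^bsub>chart_group c\<^esub> h) (chart_act c h w) = w"
    using eventually_cover[OF c v] by eventually_elim (use chart_act_inv(1)[OF c h] in auto)
qed

section \<open>Lifts fixing a point, and families of them over the circle\<close>

context smooth_torus_orbifold
begin

text \<open>Any lift \<open>f0\<close> of the inverse element gives a composite lifting the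
  identity, hence equal to some \<open>h\<close> to first order; dividing by \<open>h\<close>
  produces an inverse at the level of derivatives.\<close>

lemma lift_inverse:
  assumes c: "c \<in> charts A" "c' \<in> charts A" and t: "t \<in> carrier torus_group"
    and f: "is_lift c v c' t f"
  obtains f' where "is_lift c' (f v) c (torus_inv t) f'" "f' (f v) = v"
    "\<And>u. deriv_at f' (f v) (deriv_at f v u) = u" "\<And>u. deriv_at f v (deriv_at f' (f v) u) = u"
proof -
  note oc = chartsD[OF c(1)] and fD = is_liftD[OF f]
  have "act (torus_inv t) (proj c' (f v)) = proj c v"
    using act_mult[OF torus_inv(1)[OF t] t, of "proj c v"] torus_inv(2)[OF t] fD(4) by (simp add: act_one)
  then obtain f0 where f0: "is_lift c' (f v) c (torus_inv t) f0" "f0 (f v) = v"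
    using is_lift_exists[OF c(2,1) torus_inv(1)[OF t] fD(3,1)] by blast
  have "is_lift c v c (torus_inv t * t) (\<lambda>w. f0 (f w))"
    by (rule is_lift_compose[OF f f0(1) torus_inv(1)[OF t] t])
  then have "is_lift c v c 1 (\<lambda>w. f0 (f w))" using torus_inv(2)[OF t] by simp
  from lift_one_jet[OF oc this] obtain h where h: "h \<in> carrier (chart_group c)"
    "v = chart_act c h v" "deriv_at (\<lambda>w. f0 (f w)) v = deriv_at (chart_act c h) v"
    using f0(2) by auto
  let ?k = "inv\<^bsub>chart_group c\<^esub> h"
  have k: "?k \<in> carrier (chart_group c)" using chart_inv_closed[OF oc h(1)] .
  have kv: "chart_act c ?k v = v" using chart_act_inv(1)[OF oc h(1) fD(1)] h(2) by simp
  define f' where "f' w = chart_act c ?k (f0 w)" for w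
  have ka: "is_lift c (f0 (f v)) c 1 (chart_act c ?k)" using is_lift_chart_act[OF oc fD(1) k] f0(2) by simp
  have f': "is_lift c' (f v) c (1 * torus_inv t) f'"
    unfolding f'_def by (rule is_lift_compose[OF f0(1) ka]) (use torus_inv(1)[OF t] in auto)
  have f'v: "f' (f v) = v" using f0(2) kv by (simp add: f'_def)
  have left: "deriv_at f' (f v) (deriv_at f v u) = u" for u
  proof -
    have "deriv_at f' (f v) (deriv_at f v u) = deriv_at (chart_act c ?k) v (deriv_at f0 (f v) (deriv_at f v u))"
      unfolding f'_def using C1_at_compose(2)[OF is_liftD(2)[OF f0(1)] is_liftD(2)[OF ka]] f0(2) by simp
    also have "deriv_at f0 (f v) (deriv_at f v u) = deriv_at (chart_act c h) v u"
      using C1_at_compose(2)[OF fD(2) is_liftD(2)[OF f0(1)]] h(3) by simp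
    also have "deriv_at (chart_act c ?k) v (deriv_at (chart_act c h) v u) = u"
      using deriv_chart_act_inv[OF oc h(1) fD(1), of u] h(2) by simp
    finally show ?thesis .
  qed
  have "linear (deriv_at f v)" "linear (deriv_at f' (f v))"
    using C1_at_linear_deriv is_liftD(2)[OF f] is_liftD(2)[OF f'] by blast+
  then have right: "deriv_at f v (deriv_at f' (f v) u) = u" for u
    using eucl.linear_inverse_left[of "deriv_at f v" "deriv_at f' (f v)"] left by (simp add: fun_eq_iff)
  have "is_lift c' (f v) c (torus_inv t) f'" using f' by simp
  from that[OF this f'v left right] show thesis .
qed

definition fixlift :: "('x, 'v, 'h) ochart \<Rightarrow> 'v \<Rightarrow> complex ^ 'n \<Rightarrow> ('v \<Rightarrow> 'v) \<Rightarrow> bool"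
  where "fixlift c v t g \<longleftrightarrow> is_lift c v c t g \<and> g v = v \<and> t \<in> carrier torus_group"

lemma fixlift_compose:
  assumes "fixlift c v t g" "fixlift c v s f"
  shows "fixlift c v (s * t) (\<lambda>w. f (g w))"
    "deriv_at (\<lambda>w. f (g w)) v u = deriv_at f v (deriv_at g v u)"
proof -
  have g: "is_lift c v c t g" "g v = v" "t \<in> carrier torus_group"
    and f: "is_lift c v c s f" "f v = v" "s \<in> carrier torus_group"
    using assms by (auto simp: fixlift_def)
  have f': "is_lift c (g v) c s f" using f g by simp
  show "fixlift c v (s * t) (\<lambda>w. f (g w))"
    unfolding fixlift_def using is_lift_compose[OF g(1) f' f(3) g(3)] f g by simp
  show "deriv_at (\<lambda>w. f (g w)) v u = deriv_at f v (deriv_at g v u)"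
    using C1_at_compose(2)[OF is_liftD(2)[OF g(1)] is_liftD(2)[OF f']] g(2) by simp
qed

lemma fixlift_linear: "fixlift c v t g \<Longrightarrow> linear (deriv_at g v)"
  unfolding fixlift_def using C1_at_linear_deriv is_liftD(2) by blast

lemma fixlift_inverse:
  assumes c: "c \<in> charts A" and f: "fixlift c v t f"
  obtains f' where "fixlift c v (torus_inv t) f'"
    "\<And>u. deriv_at f' v (deriv_at f v u) = u" "\<And>u. deriv_at f v (deriv_at f' v u) = u"
proof -
  have f: "is_lift c v c t f" "f v = v" "t \<in> carrier torus_group" using f by (auto simp: fixlift_def)
  obtain f' where f': "is_lift c (f v) c (torus_inv t) f'" "f' (f v) = v"
    "\<And>u. deriv_at f' (f v) (deriv_at f v u) = u" "\<And>u. deriv_at f v (deriv_at f' (f v) u) = u"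
    using lift_inverse[OF c c f(3,1)] by blast
  have "fixlift c v (torus_inv t) f'" using f' f torus_inv(1)[OF f(3)] by (simp add: fixlift_def)
  then show thesis using that f'(3,4) f(2) by simp
qed

lemma fixlift_chart_act:
  assumes "orbifold_chart c" "v \<in> cover c" "h \<in> carrier (chart_group c)" "chart_act c h v = v"
  shows "fixlift c v 1 (chart_act c h)"
  using is_lift_chart_act[OF assms(1-3)] assms(4) by (simp add: fixlift_def)

lemma fixlift_one_jet:
  assumes "orbifold_chart c" "fixlift c v 1 g"
  obtains h where "h \<in> carrier (chart_group c)" "chart_act c h v = v" "deriv_at g v = deriv_at (chart_act c h) v"
proof -
  have g: "is_lift c v c 1 g" "g v = v" using assms(2) by (auto simp: fixlift_def)
  from lift_one_jet[OF assms(1) g(1)] that g(2) show thesis by auto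
qed

text \<open>Lifts of the identity fixing \<open>v\<close> have derivatives in a finite set, and the
  circle is connected. Uniqueness and commutation of circle lifts rest on this.\<close>

lemma fixlift_family_const:
  assumes c: "orbifold_chart c" and g: "\<And>z. z \<in> sphere 0 1 \<Longrightarrow> fixlift c v 1 (g z)"
    and cont: "\<And>u. continuous_on (sphere (0::complex) 1) (\<lambda>z. deriv_at (g z) v u)" and z: "z \<in> sphere 0 1"
  shows "deriv_at (g z) v u = deriv_at (g 1) v u"
proof (rule continuous_circle_finite[where f = "\<lambda>z. deriv_at (g z) v u"
    and F = "(\<lambda>h. deriv_at (chart_act c h) v u) ` carrier (chart_group c)", OF cont _ _ z])
  show "finite ((\<lambda>h. deriv_at (chart_act c h) v u) ` carrier (chart_group c))"
    using finite_chart_group[OF c] by simp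
  fix w :: complex assume "w \<in> sphere 0 1"
  then obtain h where h: "h \<in> carrier (chart_group c)" "deriv_at (g w) v = deriv_at (chart_act c h) v"
    using fixlift_one_jet[OF c g] by metis
  show "deriv_at (g w) v u \<in> (\<lambda>h. deriv_at (chart_act c h) v u) ` carrier (chart_group c)"
    unfolding h(2) using h(1) by (rule imageI)
qed

text \<open>Only the derivatives at \<open>v\<close> have to be multiplicative and continuous; the
  germs themselves need not form an action. In this weak form the notion can be carried to charts on
  which the circle action does not lift.\<close>

definition circle_lift :: "('x, 'v, 'h) ochart \<Rightarrow> 'v \<Rightarrow> (complex \<Rightarrow> complex ^ 'n) \<Rightarrow> (complex \<Rightarrow> 'v \<Rightarrow> 'v) \<Rightarrow> bool"
  where "circle_lift c v \<rho> g \<longleftrightarrow> c \<in> charts A \<and> v \<in> cover c \<and> \<rho> \<in> hom circle_group torus_group \<and>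
    (\<forall>z\<in>sphere 0 1. fixlift c v (\<rho> z) (g z)) \<and>
    (\<forall>z\<in>sphere 0 1. \<forall>w\<in>sphere 0 1. \<forall>u. deriv_at (g (z * w)) v u = deriv_at (g z) v (deriv_at (g w) v u)) \<and>
    (\<forall>u. deriv_at (g 1) v u = u) \<and> (\<forall>u. continuous_on (sphere 0 1) (\<lambda>z. deriv_at (g z) v u))"

lemma circle_liftD:
  assumes "circle_lift c v \<rho> g"
  shows "c \<in> charts A" "orbifold_chart c" "v \<in> cover c" "\<rho> \<in> hom circle_group torus_group"
    "z \<in> sphere 0 1 \<Longrightarrow> fixlift c v (\<rho> z) (g z)"
    "z \<in> sphere 0 1 \<Longrightarrow> w \<in> sphere 0 1 \<Longrightarrow> deriv_at (g (z * w)) v u = deriv_at (g z) v (deriv_at (g w) v u)"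
    "deriv_at (g 1) v u = u" "continuous_on (sphere 0 1) (\<lambda>z. deriv_at (g z) v u)"
    "z \<in> sphere 0 1 \<Longrightarrow> linear (deriv_at (g z) v)"
  using assms chartsD fixlift_linear unfolding circle_lift_def by blast+

lemma circle_lift_inverse:
  assumes g: "circle_lift c v \<rho> g" and z: "z \<in> sphere 0 1"
  shows "inverse z \<in> sphere 0 1" "deriv_at (g (inverse z)) v (deriv_at (g z) v u) = u"
    "deriv_at (g z) v (deriv_at (g (inverse z)) v u) = u" "\<rho> z * \<rho> (inverse z) = 1"
proof -
  show i: "inverse z \<in> sphere 0 1" using z by (simp add: norm_inverse)
  have "z \<noteq> 0" using z by auto
  then have z0: "inverse z * z = 1" "z * inverse z = 1" by simp_all
  show "deriv_at (g (inverse z)) v (deriv_at (g z) v u) = u"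
    using circle_liftD(6)[OF g i z, of u] circle_liftD(7)[OF g, of u] z0 by simp
  show "deriv_at (g z) v (deriv_at (g (inverse z)) v u) = u"
    using circle_liftD(6)[OF g z i, of u] circle_liftD(7)[OF g, of u] z0 by simp
  show "\<rho> z * \<rho> (inverse z) = 1"
    using hom_circle_torusD(2)[OF circle_liftD(4)[OF g] z i] hom_circle_torusD(3)[OF circle_liftD(4)[OF g]] z0 by simp
qed

lemma circle_lift_power:
  assumes g: "circle_lift c v \<rho> g" and z: "z \<in> sphere 0 1" 
  shows "deriv_at (g (z ^ k)) v = deriv_at (g z) v ^^ k"
proof (induction k)
  case 0
  then show ?case using circle_liftD(7)[OF g] by auto
next
  case (Suc k)
  have "z ^ k \<in> sphere 0 1" using z by (simp add: norm_power)
  then show ?case using circle_liftD(6)[OF g z] Suc by (auto simp: fun_eq_iff)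
qed

lemma continuous_circle_lift_inverse:
  assumes g: "circle_lift c v \<rho> g"
  shows "continuous_on (sphere 0 1) (\<lambda>z. deriv_at (g (inverse z)) v u)"
  by (rule continuous_on_compose2[OF circle_liftD(8)[OF g, of u]]) (auto intro!: continuous_intros simp: norm_inverse)

text \<open>The quotient of the two lifts at \<open>z\<close> lifts the identity, so its derivative
  is constant in \<open>z\<close> and equal to its value at \<open>z = 1\<close>.\<close>

lemma circle_lift_unique:
  assumes g: "circle_lift c v \<rho> g" and g': "circle_lift c v \<rho> g'" and z: "z \<in> sphere 0 1"
  shows "deriv_at (g z) v u = deriv_at (g' z) v u"
proof -
  define k where "k z w = g' (inverse z) (g z w)" for z w
  have k: "fixlift c v 1 (k z)" "deriv_at (k z) v u = deriv_at (g' (inverse z)) v (deriv_at (g z) v u)"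
    if "z \<in> sphere 0 1" for z u
  proof -
    note i = circle_lift_inverse(1,4)[OF g that]
    note fl = circle_liftD(5)[OF g that] circle_liftD(5)[OF g' i(1)]
    show "fixlift c v 1 (k z)"
      using fixlift_compose(1)[OF fl] i(2) unfolding k_def by (simp add: mult.commute)
    show "deriv_at (k z) v u = deriv_at (g' (inverse z)) v (deriv_at (g z) v u)"
      using fixlift_compose(2)[OF fl] unfolding k_def .
  qed
  have "continuous_on (sphere 0 1) (\<lambda>z. deriv_at (k z) v u)" for u
  proof (rule continuous_on_eq)
    show "continuous_on (sphere 0 1) (\<lambda>z. deriv_at (g' (inverse z)) v (deriv_at (g z) v u))"
      by (rule continuous_on_linear_apply[OF circle_liftD(9)[OF g' circle_lift_inverse(1)[OF g']]
            continuous_circle_lift_inverse[OF g'] circle_liftD(8)[OF g]])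
  qed (simp add: k)
  from fixlift_family_const[OF circle_liftD(2)[OF g] k(1) this z]
  have "deriv_at (k z) v u = u"
    using k(2)[of 1 u] circle_liftD(7)[OF g] circle_liftD(7)[OF g'] by simp
  then have "deriv_at (g' (inverse z)) v (deriv_at (g z) v u) = u" using k(2)[OF z] by simp
  then show ?thesis using circle_lift_inverse(3)[OF g' z, of "deriv_at (g z) v u"] by simp
qed

text \<open>The commutator lifts the identity, so its derivative varies continuously in a finite set.\<close>

lemma circle_lift_commute:
  assumes g: "circle_lift c v \<rho> g" and f: "fixlift c v s f" and z: "z \<in> sphere 0 1"
  shows "deriv_at f v (deriv_at (g z) v u) = deriv_at (g z) v (deriv_at f v u)"
proof -
  note oc = circle_liftD(2)[OF g]
  have s: "s \<in> carrier torus_group" using f by (simp add: fixlift_def)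
  obtain f' where f': "fixlift c v (torus_inv s) f'"
    "\<And>u. deriv_at f' v (deriv_at f v u) = u" "\<And>u. deriv_at f v (deriv_at f' v u) = u"
    using fixlift_inverse[OF circle_liftD(1)[OF g] f] by blast
  define k where "k z w = f (g z (f' (g (inverse z) w)))" for z w
  have k: "fixlift c v 1 (k z)"
    "deriv_at (k z) v u = deriv_at f v (deriv_at (g z) v (deriv_at f' v (deriv_at (g (inverse z)) v u)))"
    if z: "z \<in> sphere 0 1" for z u
  proof -
    note i = circle_lift_inverse(1,4)[OF g z]
    note 1 = fixlift_compose[OF circle_liftD(5)[OF g i(1)] f'(1)]
    note 2 = fixlift_compose[OF 1(1) circle_liftD(5)[OF g z]]
    note 3 = fixlift_compose[OF 2(1) f]
    have "s * (\<rho> z * (torus_inv s * \<rho> (inverse z))) = (s * torus_inv s) * (\<rho> z * \<rho> (inverse z))"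
      by (simp add: mult_ac)
    then show "fixlift c v 1 (k z)"
      using 3(1) i(2) torus_inv(3)[OF s] unfolding k_def by simp
    show "deriv_at (k z) v u = deriv_at f v (deriv_at (g z) v (deriv_at f' v (deriv_at (g (inverse z)) v u)))"
      unfolding k_def 3(2) 2(2) 1(2) ..
  qed
  have "continuous_on (sphere 0 1) (\<lambda>z. deriv_at (k z) v u)" for u
  proof (rule continuous_on_eq)
    show "continuous_on (sphere 0 1) (\<lambda>z. deriv_at f v (deriv_at (g z) v (deriv_at f' v (deriv_at (g (inverse z)) v u))))"
      by (intro continuous_on_linear_apply[OF circle_liftD(9)[OF g] circle_liftD(8)[OF g]]
            linear_continuous_on_compose[OF _ fixlift_linear[OF f]] linear_continuous_on_compose[OF _ fixlift_linear[OF f'(1)]]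
            continuous_circle_lift_inverse[OF g])
  qed (simp add: k)
  from fixlift_family_const[OF oc k(1) this z]
  have "deriv_at (k z) v u = u" for u
    using k(2)[of 1 u] circle_liftD(7)[OF g] f'(3) by simp
  then have "deriv_at f v (deriv_at (g z) v (deriv_at f' v (deriv_at (g (inverse z)) v u))) = u" for u using k(2)[OF z] by simp
  from this[of "deriv_at (g z) v (deriv_at f v u)"] show ?thesis
    using circle_lift_inverse(2)[OF g z] f'(2) by simp
qed

text \<open>Conjugation by a transition germ and its inverse. The maps \<open>F\<close> and
  \<open>F'\<close> are their derivatives, exported so that triviality at \<open>z\<close> can be
  compared between charts.\<close>

lemma circle_lift_transport:
  assumes g: "circle_lift c v \<rho> g" and c': "c' \<in> charts A" "v' \<in> cover c'" "proj c v = proj c' v'"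
  obtains g' F F' where "circle_lift c' v' \<rho> g'" "\<And>u. F (F' u) = u" "\<And>u. F' (F u) = u"
    "\<And>z u. z \<in> sphere 0 1 \<Longrightarrow> deriv_at (g' z) v' u = F (deriv_at (g z) v (F' u))"
proof -
  note gD = circle_liftD[OF g]
  obtain \<tau> where \<tau>: "is_lift c v c' 1 \<tau>" "\<tau> v = v'" using is_lift_transition[OF gD(1) c'(1) gD(3) c'(2,3)] by blast
  obtain \<tau>' where \<tau>': "is_lift c' (\<tau> v) c (torus_inv 1) \<tau>'" "\<tau>' (\<tau> v) = v"
    "\<And>u. deriv_at \<tau>' (\<tau> v) (deriv_at \<tau> v u) = u" "\<And>u. deriv_at \<tau> v (deriv_at \<tau>' (\<tau> v) u) = u"
    using lift_inverse[OF gD(1) c'(1) torus_one_closed \<tau>(1)] by blast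
  have i1: "torus_inv 1 = (1 :: complex ^ 'n)" by (simp add: torus_inv_def vec_eq_iff)
  have \<tau>'l: "is_lift c' v' c 1 \<tau>'" "\<tau>' v' = v" using \<tau>' \<tau>(2) i1 by auto
  define g' where "g' z w = \<tau> (g z (\<tau>' w))" for z w
  let ?F = "deriv_at \<tau> v" and ?F' = "deriv_at \<tau>' v'"
  have FF': "?F (?F' u) = u" "?F' (?F u) = u" for u using \<tau>'(3,4) \<tau>(2) by auto
  have lift: "fixlift c' v' (\<rho> z) (g' z)" "deriv_at (g' z) v' u = ?F (deriv_at (g z) v (?F' u))"
    if z: "z \<in> sphere 0 1" for z u
  proof -
    have gz: "is_lift c v c (\<rho> z) (g z)" "g z v = v" "\<rho> z \<in> carrier torus_group"
      using gD(5)[OF z] by (auto simp: fixlift_def)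
    have a: "is_lift c (\<tau>' v') c (\<rho> z) (g z)" using gz \<tau>'l by simp
    have 1: "is_lift c' v' c (\<rho> z * 1) (\<lambda>w. g z (\<tau>' w))"
      by (rule is_lift_compose[OF \<tau>'l(1) a gz(3)]) simp
    have b: "is_lift c (g z (\<tau>' v')) c' 1 \<tau>" using gz \<tau>'l \<tau> by simp
    have 2: "is_lift c' v' c' (1 * (\<rho> z * 1)) (g' z)"
      unfolding g'_def by (rule is_lift_compose[OF 1 b]) (use gz in auto)
    show "fixlift c' v' (\<rho> z) (g' z)" using 2 gz \<tau>'l \<tau> by (simp add: fixlift_def g'_def)
    show "deriv_at (g' z) v' u = ?F (deriv_at (g z) v (?F' u))"
      unfolding g'_def
      using C1_at_compose(2)[OF is_liftD(2)[OF 1] is_liftD(2)[OF b]] C1_at_compose(2)[OF is_liftD(2)[OF \<tau>'l(1)] is_liftD(2)[OF a]]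
        gz \<tau>'l by simp
  qed
  have lF: "linear ?F" using C1_at_linear_deriv is_liftD(2)[OF \<tau>(1)] by blast
  have "circle_lift c' v' \<rho> g'"
    unfolding circle_lift_def
  proof (intro conjI ballI allI c' gD(4) lift(1))
    fix z w u assume zw: "z \<in> sphere (0::complex) 1" "w \<in> sphere (0::complex) 1"
    have m: "z * w \<in> sphere 0 1" using zw by (simp add: norm_mult)
    show "deriv_at (g' (z * w)) v' u = deriv_at (g' z) v' (deriv_at (g' w) v' u)"
      unfolding lift(2)[OF m] lift(2)[OF zw(1)] lift(2)[OF zw(2)] FF' gD(6)[OF zw] ..
  next
    fix u show "deriv_at (g' 1) v' u = u" using lift(2)[of 1 u] gD(7) FF' by simp
  next
    fix u show "continuous_on (sphere 0 1) (\<lambda>z. deriv_at (g' z) v' u)"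
    proof (rule continuous_on_eq)
      show "continuous_on (sphere 0 1) (\<lambda>z. ?F (deriv_at (g z) v (?F' u)))"
        by (rule linear_continuous_on_compose[OF gD(8) lF])
    qed (simp add: lift)
  qed
  from that[OF this FF' lift(2)] show thesis .
qed

text \<open>Over \<open>N\<close> the lift merely permutes fibres. Along a curve in the preimage it
  is therefore given by chart group elements, so the derivative at \<open>u\<close> takes finitely
  many values, and continuity in \<open>z\<close> leaves only the value at
  \<open>z = 1\<close>.\<close>

lemma circle_lift_tangent:
  assumes g: "circle_lift c v \<rho> g" and fixed: "\<And>z y. z \<in> sphere 0 1 \<Longrightarrow> y \<in> N \<Longrightarrow> act (\<rho> z) y = y"
    and u: "u \<in> tangent_space (chart_preimage c N) v" and z: "z \<in> sphere 0 1"
  shows "deriv_at (g z) v u = u"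
proof -
  note gD = circle_liftD[OF g]
  obtain \<gamma> where \<gamma>: "\<gamma> 0 = v" "\<forall>\<^sub>F t in nhds 0. \<gamma> t \<in> chart_preimage c N" "(\<gamma> has_vector_derivative u) (at (0::real))"
    using u by (auto simp: tangent_space_def)
  have cont: "filterlim \<gamma> (nhds v) (nhds 0)"
    using has_vector_derivative_continuous[OF \<gamma>(3)] \<gamma>(1) tendsto_at_iff_tendsto_nhds[of \<gamma> 0]
    by (simp add: isCont_def)
  let ?F = "(\<lambda>h. deriv_at (chart_act c h) v u) ` carrier (chart_group c)"
  have inF: "deriv_at (g z) v u \<in> ?F" if z: "z \<in> sphere 0 1" for z
  proof -
    have gz: "is_lift c v c (\<rho> z) (g z)" using gD(5)[OF z] by (auto simp: fixlift_def)
    have "\<forall>\<^sub>F t in nhds 0. g z (\<gamma> t) \<in> cover c \<and> proj c (g z (\<gamma> t)) = act (\<rho> z) (proj c (\<gamma> t))"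
      using is_liftD(5)[OF gz] cont by (rule eventually_compose_filterlim)
    with \<gamma>(2) have "\<forall>\<^sub>F t in nhds 0. \<exists>h\<in>carrier (chart_group c). g z (\<gamma> t) = chart_act c h (\<gamma> t)"
    proof eventually_elim
      case (elim t)
      then have "\<gamma> t \<in> cover c" "proj c (\<gamma> t) = proj c (g z (\<gamma> t))"
        using fixed[OF z] by (auto simp: chart_preimage_def)
      then show ?case using proj_eq_iff[OF gD(2), of "\<gamma> t" "g z (\<gamma> t)"] elim by blast
    qed
    from curve_finite_choice[OF finite_chart_group[OF gD(2)] is_liftD(2)[OF gz] C1_chart_act[OF gD(2) _ gD(3)] \<gamma>(1,3) this]
    show ?thesis by blast
  qed
  have "deriv_at (g z) v u = deriv_at (g 1) v u"
    by (rule continuous_circle_finite[OF gD(8) _ inF z]) (use finite_chart_group[OF gD(2)] in auto)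
  then show ?thesis using gD(7) by simp
qed

section \<open>Genuine circle actions on a chart\<close>

definition chart_circle_action ::
  "(complex \<Rightarrow> complex ^ 'n) \<Rightarrow> ('x, 'v, 'h) ochart \<Rightarrow> (complex \<Rightarrow> 'v \<Rightarrow> 'v) \<Rightarrow> bool"
  where "chart_circle_action \<rho> c \<psi> \<longleftrightarrow> group_action circle_group (cover c) \<psi> \<and>
       smooth_map_on (UNIV \<times> cover c) (\<lambda>(\<theta> :: real, v). \<psi> (cis \<theta>) v) \<and>
       (\<forall>z \<in> carrier circle_group. \<forall>v \<in> cover c. proj c (\<psi> z v) = act (\<rho> z) (proj c v))"

text \<open>The derivative in \<open>v\<close> at a fixed angle is the derivative of the joint map
  in the direction \<open>(0, u)\<close>. Its continuity in the angle descends to the circle by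
  \<open>continuous_on_circleI\<close>.\<close>

lemma chart_circle_action_C1:
  assumes c: "orbifold_chart c" and \<psi>: "chart_circle_action \<rho> c \<psi>" and v: "v \<in> cover c" and z: "z \<in> sphere 0 1"
  shows "C1_at (\<psi> z) v" "\<And>u. continuous_on (sphere 0 1) (\<lambda>z. deriv_at (\<psi> z) v u)"
    "continuous_on (sphere 0 1) (\<lambda>z. \<psi> z v)"
proof -
  let ?\<Psi> = "\<lambda>(\<theta> :: real, v). \<psi> (cis \<theta>) v"
  have op: "open (UNIV \<times> cover c :: (real \<times> 'v) set)" using open_cover[OF c] by (intro open_Times) auto
  have sm: "smooth_map_on (UNIV \<times> cover c) ?\<Psi>" using \<psi> by (simp add: chart_circle_action_def)
  have C: "C1_at ?\<Psi> (\<theta>, v)" for \<theta>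
    by (rule smooth_map_on_imp_C1_at[OF op sm]) (use v in auto)
  have P: "C1_at (\<lambda>w. (\<theta>, w)) v" "deriv_at (\<lambda>w. (\<theta>, w)) v = (\<lambda>u. (0, u))" for \<theta> :: real
  proof -
    have L: "bounded_linear (\<lambda>w::'v. (0::real, w))" by (intro bounded_linear_Pair bounded_linear_zero bounded_linear_ident)
    have "(\<lambda>w. (\<theta>, w)) = (\<lambda>w::'v. (\<theta>, 0) + (0, w))" by (simp add: fun_eq_iff)
    then show "C1_at (\<lambda>w. (\<theta>, w)) v" "deriv_at (\<lambda>w. (\<theta>, w)) v = (\<lambda>u. (0, u))"
      using C1_at_add[OF C1_at_const, of "\<lambda>w::'v. (0::real, w)" v "(\<theta>, 0)"] C1_at_bounded_linear[OF L, of v] by auto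
  qed
  have D: "C1_at (\<psi> (cis \<theta>)) v" "deriv_at (\<psi> (cis \<theta>)) v u = deriv_at ?\<Psi> (\<theta>, v) (0, u)" for \<theta> u
    using C1_at_compose[OF P(1) C, of \<theta>] P(2) by simp_all
  show "C1_at (\<psi> z) v" using D(1)[of "Arg z"] unit_eq_cis_Arg[of z] z by simp
  have pc: "filterlim (\<lambda>\<theta>'. (\<theta>', v)) (nhds (\<theta>, v)) (at \<theta>)" for \<theta> :: real
    by (intro tendsto_intros)
  show "continuous_on (sphere 0 1) (\<lambda>z. deriv_at (\<psi> z) v u)" for u
  proof (rule continuous_on_circleI)
    have "isCont (\<lambda>\<theta>. deriv_at ?\<Psi> (\<theta>, v) (0, u)) \<theta>" for \<theta>
      unfolding isCont_def by (rule filterlim_compose[OF C1_at_deriv_tendsto[OF C] pc])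
    then show "continuous_on UNIV (\<lambda>\<theta>. deriv_at (\<psi> (cis \<theta>)) v u)"
      unfolding D(2) by (simp add: continuous_at_imp_continuous_on)
  qed
  show "continuous_on (sphere 0 1) (\<lambda>z. \<psi> z v)"
  proof (rule continuous_on_circleI)
    have "isCont (\<lambda>\<theta>. ?\<Psi> (\<theta>, v)) \<theta>" for \<theta>
      unfolding isCont_def by (rule filterlim_compose[OF C1_at_filterlim[OF C] pc])
    then show "continuous_on UNIV (\<lambda>\<theta>. \<psi> (cis \<theta>) v)" by (simp add: continuous_at_imp_continuous_on)
  qed
qed

lemma chart_circle_actionD:
  assumes "chart_circle_action \<rho> c \<psi>"
  shows "z \<in> sphere 0 1 \<Longrightarrow> v \<in> cover c \<Longrightarrow> \<psi> z v \<in> cover c"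
    "z \<in> sphere 0 1 \<Longrightarrow> w \<in> sphere 0 1 \<Longrightarrow> v \<in> cover c \<Longrightarrow> \<psi> (z * w) v = \<psi> z (\<psi> w v)"
    "v \<in> cover c \<Longrightarrow> \<psi> 1 v = v"
    "z \<in> sphere 0 1 \<Longrightarrow> v \<in> cover c \<Longrightarrow> proj c (\<psi> z v) = act (\<rho> z) (proj c v)"
proof -
  have G: "group_action circle_group (cover c) \<psi>" using assms by (simp add: chart_circle_action_def)
  show "z \<in> sphere 0 1 \<Longrightarrow> v \<in> cover c \<Longrightarrow> \<psi> z v \<in> cover c"
    using group_action.element_image[OF G, of z v] by simp
  show "z \<in> sphere 0 1 \<Longrightarrow> w \<in> sphere 0 1 \<Longrightarrow> v \<in> cover c \<Longrightarrow> \<psi> (z * w) v = \<psi> z (\<psi> w v)"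
    using group_action.composition_rule[OF G, of v z w] by simp
  show "v \<in> cover c \<Longrightarrow> \<psi> 1 v = v"
    using group_action.id_eq_one[OF G] by (metis circle_group_simps(3) restrict_apply')
  show "z \<in> sphere 0 1 \<Longrightarrow> v \<in> cover c \<Longrightarrow> proj c (\<psi> z v) = act (\<rho> z) (proj c v)"
    using assms by (simp add: chart_circle_action_def)
qed

text \<open>The circle keeps \<open>v\<close> in the finite fibre over a fixed point, so by
  connectedness it fixes \<open>v\<close>.\<close>

lemma circle_lift_of_action:
  assumes cA: "c \<in> charts A" and \<psi>: "chart_circle_action \<rho> c \<psi>" and \<rho>: "\<rho> \<in> hom circle_group torus_group"
    and v: "v \<in> cover c" and fixed: "\<And>z. z \<in> sphere 0 1 \<Longrightarrow> act (\<rho> z) (proj c v) = proj c v"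
  shows "circle_lift c v \<rho> \<psi>"
proof -
  note c = chartsD[OF cA]
  note \<psi>D = chart_circle_actionD[OF \<psi>]
  note C1 = chart_circle_action_C1[OF c \<psi> v]
  have one: "(1::complex) \<in> sphere 0 1" by simp
  have fv: "\<psi> z v = v" if z: "z \<in> sphere 0 1" for z
  proof -
    have "\<psi> z v = \<psi> 1 v"
    proof (rule continuous_circle_finite[OF C1(3)[OF one] _ _ z])
      show "finite ((\<lambda>h. chart_act c h v) ` carrier (chart_group c))" using finite_chart_group[OF c] by simp
      fix w :: complex assume w: "w \<in> sphere 0 1"
      have "proj c v = proj c (\<psi> w v)" using \<psi>D(4)[OF w v] fixed[OF w] by simp
      then show "\<psi> w v \<in> (\<lambda>h. chart_act c h v) ` carrier (chart_group c)"
        using proj_eq_iff[OF c v \<psi>D(1)[OF w v]] by blast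
    qed
    then show ?thesis using \<psi>D(3)[OF v] by simp
  qed
  have lift: "fixlift c v (\<rho> z) (\<psi> z)" if z: "z \<in> sphere 0 1" for z
  proof -
    have "\<forall>\<^sub>F w in nhds v. \<psi> z w \<in> cover c \<and> proj c (\<psi> z w) = act (\<rho> z) (proj c w)"
      using eventually_cover[OF c v] by eventually_elim (use \<psi>D(1,4)[OF z] in auto)
    then show ?thesis
      using v C1(1)[OF z] fv[OF z] hom_circle_torusD(1)[OF \<rho> z] by (simp add: fixlift_def is_lift_def)
  qed
  show ?thesis
    unfolding circle_lift_def
  proof (intro conjI ballI allI cA v \<rho> lift C1(2)[OF one])
    fix z w u assume zw: "z \<in> sphere (0::complex) 1" "w \<in> sphere (0::complex) 1"
    have "\<forall>\<^sub>F y in nhds v. \<psi> z (\<psi> w y) = \<psi> (z * w) y"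
      using eventually_cover[OF c v] by eventually_elim (use \<psi>D(2)[OF zw] in auto)
    from C1_at_cong(2)[OF _ this] C1_at_compose[OF C1(1)[OF zw(2)], of "\<psi> z"] C1(1)[OF zw(1)] fv[OF zw(2)]
    show "deriv_at (\<psi> (z * w)) v u = deriv_at (\<psi> z) v (deriv_at (\<psi> w) v u)" by simp
  next
    fix u
    have "\<forall>\<^sub>F y in nhds v. y = \<psi> 1 y"
      using eventually_cover[OF c v] by eventually_elim (use \<psi>D(3) in auto)
    from C1_at_cong(2)[OF C1_at_ident this] show "deriv_at (\<psi> 1) v u = u" by simp
  qed
qed

text \<open>Continuation as in \<open>torsion_eq_one\<close>, but upstairs: the finite order belongs
  to the action itself, so no chart group elements intervene.\<close>

lemma chart_circle_action_trivial:
  assumes cA: "c \<in> charts A" and \<psi>: "chart_circle_action \<rho> c \<psi>" and conn: "connected (cover c)"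
    and \<zeta>: "\<zeta> \<in> sphere 0 1" "\<zeta> ^ N = 1" "N > 0"
    and v: "v \<in> cover c" "\<psi> \<zeta> v = v" "deriv_at (\<psi> \<zeta>) v = (\<lambda>u. u)"
    and w: "w \<in> cover c"
  shows "\<psi> \<zeta> w = w"
proof -
  note c = chartsD[OF cA]
  note \<psi>D = chart_circle_actionD[OF \<psi>]
  have pow: "(\<psi> \<zeta> ^^ k) y = \<psi> (\<zeta> ^ k) y" if y: "y \<in> cover c" for k y
  proof (induction k)
    case 0
    then show ?case using \<psi>D(3)[OF y] by simp
  next
    case (Suc k)
    have "\<zeta> ^ k \<in> sphere 0 1" using \<zeta>(1) by (simp add: norm_power)
    then show ?case using Suc \<psi>D(2)[OF \<zeta>(1) _ y] by simp
  qed
  have triv: "\<forall>\<^sub>F z in nhds y. \<psi> \<zeta> z = z"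
    if y: "y \<in> cover c" "\<psi> \<zeta> y = y" "deriv_at (\<psi> \<zeta>) y = (\<lambda>u. u)" for y
  proof (rule finite_order_trivial_jet[OF chart_circle_action_C1(1)[OF c \<psi> y(1) \<zeta>(1)] y(2,3) \<zeta>(3)])
    show "\<forall>\<^sub>F w in nhds y. (\<psi> \<zeta> ^^ N) w = w"
      using eventually_cover[OF c y(1)] by eventually_elim (simp add: pow \<zeta> \<psi>D(3))
  qed
  define Y where "Y = cover c \<inter> {y. \<forall>\<^sub>F z in nhds y. \<psi> \<zeta> z = z}"
  have "Y = cover c"
  proof (rule connected_clopen_eq[OF conn])
    show "Y \<subseteq> cover c" "v \<in> Y" using triv[OF v] v(1) by (auto simp: Y_def)
    show "open Y" unfolding Y_def by (intro open_Int open_cover[OF c] open_eventually_nhds)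
    fix y assume y: "y \<in> cover c" and fr: "\<exists>\<^sub>F z in nhds y. z \<in> Y"
    \<comment> \<open>The one-element index set \<open>{()}\<close> casts comparison with the
      identity as an instance of \<open>C1_at_jet_limit\<close>.\<close>
    have "\<exists>\<^sub>F z in nhds y. \<exists>h\<in>{()}. \<psi> \<zeta> z = z \<and> deriv_at (\<psi> \<zeta>) z = deriv_at (\<lambda>z. z) z"
      using fr
    proof (rule frequently_elim1)
      fix z assume z: "z \<in> Y"
      then have zc: "z \<in> cover c" and ev: "\<forall>\<^sub>F x in nhds z. x = \<psi> \<zeta> x"
        by (auto simp: Y_def elim: eventually_mono)
      from C1_at_cong(2)[OF C1_at_ident ev] eventually_nhds_x_imp_x[OF ev]
      show "\<exists>h\<in>{()}. \<psi> \<zeta> z = z \<and> deriv_at (\<psi> \<zeta>) z = deriv_at (\<lambda>z. z) z" by simp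
    qed
    from C1_at_jet_limit[OF _ chart_circle_action_C1(1)[OF c \<psi> y \<zeta>(1)] C1_at_ident this]
    have "\<psi> \<zeta> y = y" "deriv_at (\<psi> \<zeta>) y = (\<lambda>u. u)" by simp_all
    from triv[OF y this] show "y \<in> Y" using y by (simp add: Y_def)
  qed
  then have "\<forall>\<^sub>F z in nhds w. \<psi> \<zeta> z = z" using w by (auto simp: Y_def)
  then show ?thesis using eventually_nhds_x_imp_x by blast
qed

end

section \<open>Minimal coverings act effectively on the normal plane\<close>

lemma disk_chartD:
  assumes "disk_chart A x c"
  shows "c \<in> charts A" "connected (cover c)" "0 \<in> cover c" "proj c 0 = x" "x \<in> base c" "reduced_chart A x c"
    "h \<in> carrier (chart_group c) \<Longrightarrow> \<exists>L. linear L \<and> (\<forall>v \<in> cover c. chart_act c h v = L v)"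
proof -
  obtain r where r: "r > 0" "cover c = ball 0 r" using assms by (auto simp: disk_chart_def)
  show "connected (cover c)" "0 \<in> cover c" using r by auto
  show "c \<in> charts A" "x \<in> base c" "proj c 0 = x" "reduced_chart A x c"
    using assms by (auto simp: disk_chart_def reduced_chart_def)
  show "h \<in> carrier (chart_group c) \<Longrightarrow> \<exists>L. linear L \<and> (\<forall>v \<in> cover c. chart_act c h v = L v)"
    using assms by (simp add: disk_chart_def)
qed

lemma finite_covering_group_image:
  assumes "finite_covering_group S \<rho>"
  shows "\<rho> ` sphere 0 1 = S" "continuous_on (sphere 0 1) \<rho>" "\<rho> \<in> hom circle_group torus_group"
  using assms covering_space_imp_surjective covering_space_imp_continuous
  unfolding finite_covering_group_def by fastforce+

text \<open>The first \<open>m\<close> powers of \<open>\<zeta>\<close> are distinct roots of unity,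
  and there are only \<open>m\<close> such roots.\<close>

lemma roots_of_unity_powers:
  fixes \<zeta> :: complex
  assumes m: "m > 0" "\<zeta> ^ m = 1" and least: "\<And>j. 0 < j \<Longrightarrow> j < m \<Longrightarrow> \<zeta> ^ j \<noteq> 1" and \<omega>: "\<omega> ^ m = 1"
  shows "\<exists>j. \<omega> = \<zeta> ^ j"
proof -
  have z0: "\<zeta> \<noteq> 0" using m by (auto simp: power_0_left)
  have inj: "inj_on (\<lambda>j. \<zeta> ^ j) {..<m}"
  proof (rule linorder_inj_onI)
    fix i j assume ij: "i < j" "i \<in> {..<m}" "j \<in> {..<m}"
    show "\<zeta> ^ i \<noteq> \<zeta> ^ j"
    proof
      assume "\<zeta> ^ i = \<zeta> ^ j"
      then have "\<zeta> ^ i * \<zeta> ^ (j - i) = \<zeta> ^ i * 1" using power_add[of \<zeta> i "j - i"] ij by simp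
      then have "\<zeta> ^ (j - i) = 1" using z0 by simp
      then show False using least[of "j - i"] ij by (auto simp: less_imp_diff_less)
    qed
  qed auto
  have sub: "(\<lambda>j. \<zeta> ^ j) ` {..<m} \<subseteq> {z. z ^ m = 1}"
    using m by (auto simp: power_mult[symmetric] mult.commute[of _ m]) (simp add: power_mult)
  have "finite {z::complex. z ^ m = 1}" using finite_roots_unity[of m] m by simp
  moreover have "card {z::complex. z ^ m = 1} = card ((\<lambda>j. \<zeta> ^ j) ` {..<m})"
    using card_roots_unity_eq[of m] m card_image[OF inj] by simp
  ultimately have "(\<lambda>j. \<zeta> ^ j) ` {..<m} = {z. z ^ m = 1}" using sub card_subset_eq by metis
  then show ?thesis using \<omega> by blast
qed

context effective_torus_orbifold
begin

lemma action_lifts_iff: "action_lifts act \<rho> c \<longleftrightarrow> (\<exists>\<psi>. chart_circle_action \<rho> c \<psi>)"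
  by (simp add: action_lifts_def chart_circle_action_def)

lemma lifting_coveringE:
  assumes "lifting_covering A act N S \<rho>" "x \<in> N"
  obtains c \<psi> where "disk_chart A x c" "chart_circle_action \<rho> c \<psi>"
  using assms unfolding lifting_covering_def action_lifts_iff by blast

lemma lifting_covering_fixes:
  assumes "lifting_covering A act N S \<rho>" "N \<subseteq> fixed_set act S" "z \<in> sphere 0 1" "y \<in> N"
  shows "act (\<rho> z) y = y"
proof -
  have "\<rho> z \<in> S" using finite_covering_group_image(1) assms(1,3) unfolding lifting_covering_def by blast
  then show ?thesis using assms(2,4) by (auto simp: fixed_set_def)
qed

lemma lifting_covering_hom: "lifting_covering A act N S \<rho> \<Longrightarrow> \<rho> \<in> hom circle_group torus_group"
  using finite_covering_group_image(3) unfolding lifting_covering_def by blast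

lemma circle_lift_exists:
  assumes l: "lifting_covering A act N S \<rho>" and N: "N \<subseteq> fixed_set act S"
    and c: "c \<in> charts A" "v \<in> cover c" "proj c v \<in> N"
  shows "\<exists>g. circle_lift c v \<rho> g"
proof -
  obtain d \<psi> where d: "disk_chart A (proj c v) d" "chart_circle_action \<rho> d \<psi>"
    using lifting_coveringE[OF l c(3)] .
  note dD = disk_chartD[OF d(1)]
  have "circle_lift d 0 \<rho> \<psi>"
    by (rule circle_lift_of_action[OF dD(1) d(2) lifting_covering_hom[OF l] dD(3)])
       (use lifting_covering_fixes[OF l N _ c(3)] dD(4) in auto)
  from circle_lift_transport[OF this c(1,2)] dD(4) show ?thesis by metis
qed

lemma circle_lift_trivial_transfer:
  assumes g: "circle_lift c v \<rho> g" "circle_lift c' v' \<rho> g'" "proj c v = proj c' v'"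
    and z: "z \<in> sphere 0 1" and triv: "\<And>u. deriv_at (g z) v u = u"
  shows "deriv_at (g' z) v' u = u"
proof -
  obtain k F F' where k: "circle_lift c' v' \<rho> k" "\<And>u. F (F' u) = u" "\<And>u. F' (F u) = u"
    "\<And>z u. z \<in> sphere 0 1 \<Longrightarrow> deriv_at (k z) v' u = F (deriv_at (g z) v (F' u))"
    using circle_lift_transport[OF g(1) circle_liftD(1,3)[OF g(2)] g(3)] by metis
  have "deriv_at (g' z) v' u = deriv_at (k z) v' u" by (rule circle_lift_unique[OF g(2) k(1) z])
  then show ?thesis using k(2,4) z triv by simp
qed

text \<open>Triviality of the derivative at \<open>\<zeta>\<close> is locally constant along
  \<open>N\<close>: in a disk chart it spreads over the connected cover by
  \<open>chart_circle_action_trivial\<close>, hence to all points of \<open>N\<close> under that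
  chart. Connectedness of \<open>N\<close> finishes the argument.\<close>

lemma circle_lift_trivial_everywhere:
  assumes l: "lifting_covering A act N S \<rho>" and N: "N \<subseteq> fixed_set act S" "connected N"
    and \<zeta>: "\<zeta> \<in> sphere 0 1" "\<zeta> ^ K = 1" "K > 0"
    and g: "circle_lift c v \<rho> g" "proj c v \<in> N" "\<And>u. deriv_at (g \<zeta>) v u = u"
    and g': "circle_lift c' v' \<rho> g'" "proj c' v' \<in> N"
  shows "deriv_at (g' \<zeta>) v' u = u"
proof -
  note \<rho> = lifting_covering_hom[OF l]
  define P where "P y \<longleftrightarrow> (\<exists>c v g. circle_lift c v \<rho> g \<and> proj c v = y \<and> (\<forall>u. deriv_at (g \<zeta>) v u = u))" for y
  have Pall: "deriv_at (g \<zeta>) v u = u" if "P (proj c v)" "circle_lift c v \<rho> g" for c v g u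
    using that circle_lift_trivial_transfer[OF _ that(2) _ \<zeta>(1)] unfolding P_def by metis
  have loc: "P y2" if d: "disk_chart A y d" "chart_circle_action \<rho> d \<psi>" and y: "y1 \<in> N \<inter> base d" "y2 \<in> N \<inter> base d" "P y1"
    for y d \<psi> y1 y2
  proof -
    note dD = disk_chartD[OF d(1)]
    have od: "orbifold_chart d" using chartsD[OF dD(1)] .
    obtain v1 where v1: "v1 \<in> cover d" "proj d v1 = y1" using y(1) proj_image[OF od] by (metis IntE imageE)
    obtain v2 where v2: "v2 \<in> cover d" "proj d v2 = y2" using y(2) proj_image[OF od] by (metis IntE imageE)
    have c1: "circle_lift d v1 \<rho> \<psi>"
      by (rule circle_lift_of_action[OF dD(1) d(2) \<rho> v1(1)]) (use lifting_covering_fixes[OF l N(1)] y v1 in auto)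
    have c2: "circle_lift d v2 \<rho> \<psi>"
      by (rule circle_lift_of_action[OF dD(1) d(2) \<rho> v2(1)]) (use lifting_covering_fixes[OF l N(1)] y v2 in auto)
    have t1: "deriv_at (\<psi> \<zeta>) v1 = (\<lambda>u. u)" using Pall[OF _ c1] y(3) v1(2) by blast
    have "\<psi> \<zeta> v1 = v1" using circle_liftD(5)[OF c1 \<zeta>(1)] by (simp add: fixlift_def)
    then have all: "\<psi> \<zeta> w = w" if "w \<in> cover d" for w
      using chart_circle_action_trivial[OF dD(1) d(2) dD(2) \<zeta> v1(1) _ t1 that] by blast
    have "\<forall>\<^sub>F w in nhds v2. w = \<psi> \<zeta> w" using eventually_cover[OF od v2(1)] by eventually_elim (simp add: all)
    from C1_at_cong(2)[OF C1_at_ident this] have "deriv_at (\<psi> \<zeta>) v2 u = u" for u by simp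
    then show ?thesis unfolding P_def using c2 v2(2) by blast
  qed
  define D where "D y = (SOME d. disk_chart A y d \<and> (\<exists>\<psi>. chart_circle_action \<rho> d \<psi>))" for y
  have D: "disk_chart A y (D y)" "\<exists>\<psi>. chart_circle_action \<rho> (D y) \<psi>" if "y \<in> N" for y
  proof -
    have "\<exists>d. disk_chart A y d \<and> (\<exists>\<psi>. chart_circle_action \<rho> d \<psi>)" using lifting_coveringE[OF l that] by metis
    from someI_ex[OF this] show "disk_chart A y (D y)" "\<exists>\<psi>. chart_circle_action \<rho> (D y) \<psi>" unfolding D_def by auto
  qed
  have yD: "y \<in> base (D y)" "open (base (D y))" if "y \<in> N" for y
    using disk_chartD(1,5)[OF D(1)[OF that]] open_base[OF chartsD] by blast+
  \<comment> \<open>By \<open>loc\<close>, the property \<open>P\<close> is constant on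
    \<open>N\<close> within each \<open>base (D y)\<close>. The charts around points with and
    without \<open>P\<close> thus give open sets that cover \<open>N\<close> and do not meet inside
    it.\<close>
  define U where "U = (\<Union>y\<in>{y \<in> N. P y}. base (D y))"
  define V where "V = (\<Union>y\<in>{y \<in> N. \<not> P y}. base (D y))"
  have UP: "P y" if y: "y \<in> U \<inter> N" for y
  proof -
    obtain y0 where y0: "y0 \<in> N" "P y0" "y \<in> base (D y0)" using y by (auto simp: U_def)
    obtain \<psi> where "chart_circle_action \<rho> (D y0) \<psi>" using D(2)[OF y0(1)] by blast
    from loc[OF D(1)[OF y0(1)] this _ _ y0(2)] show ?thesis using y0 y yD by blast
  qed
  have VP: "\<not> P y" if y: "y \<in> V \<inter> N" for y
  proof
    assume Py: "P y"
    obtain y0 where y0: "y0 \<in> N" "\<not> P y0" "y \<in> base (D y0)" using y by (auto simp: V_def)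
    obtain \<psi> where "chart_circle_action \<rho> (D y0) \<psi>" using D(2)[OF y0(1)] by blast
    from loc[OF D(1)[OF y0(1)] this _ _ Py] show False using y0 y yD by blast
  qed
  have "open U" "open V" unfolding U_def V_def using yD(2) by auto
  moreover have "N \<subseteq> U \<union> V" unfolding U_def V_def using yD(1) by blast
  moreover have "U \<inter> V \<inter> N = {}" using UP VP by blast
  ultimately have "U \<inter> N = {} \<or> V \<inter> N = {}" using connectedD[OF N(2)] by blast
  moreover have Px: "P (proj c v)" unfolding P_def using g by blast
  then have "proj c v \<in> U \<inter> N" using g(2) yD(1) unfolding U_def by blast
  ultimately have "proj c' v' \<in> U" using \<open>N \<subseteq> U \<union> V\<close> g'(2) by blast
  then have "P (proj c' v')" using UP g'(2) by blast
  then show ?thesis using Pall g'(1) by blast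
qed

text \<open>If the roots of unity of order \<open>m\<close> act trivially, then \<open>\<rho>\<close> and the lifted actions factor through
  the \<open>m\<close>-th power map, which yields a lifting covering of smaller degree.\<close>

lemma minimal_covering_torsion:
  assumes ml: "minimal_lifting_covering A act N S \<rho>" and N: "N \<subseteq> fixed_set act S" "connected N"
    and \<zeta>: "\<zeta> \<in> sphere 0 1" "\<zeta> ^ K = 1" "K > 0"
    and g: "circle_lift c v \<rho> g" "proj c v \<in> N" "\<And>u. deriv_at (g \<zeta>) v u = u"
  shows "\<zeta> = 1"
proof (rule ccontr)
  assume \<zeta>1: "\<zeta> \<noteq> 1"
  have l: "lifting_covering A act N S \<rho>" using ml by (simp add: minimal_lifting_covering_def)
  note \<rho> = lifting_covering_hom[OF l]
  have fcg: "finite_covering_group S \<rho>" using l by (simp add: lifting_covering_def)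
  note cov = finite_covering_group_image[OF fcg]
  have triv: "\<psi> \<zeta> w = w" if y: "y \<in> N" and d: "disk_chart A y d" "chart_circle_action \<rho> d \<psi>" and w: "w \<in> cover d" for y d \<psi> w
  proof -
    note dD = disk_chartD[OF d(1)]
    have c1: "circle_lift d 0 \<rho> \<psi>"
      by (rule circle_lift_of_action[OF dD(1) d(2) \<rho> dD(3)]) (use lifting_covering_fixes[OF l N(1)] y dD(4) in auto)
    have t1: "deriv_at (\<psi> \<zeta>) 0 = (\<lambda>u. u)"
      using circle_lift_trivial_everywhere[OF l N \<zeta> g c1] y dD(4) by auto
    have "\<psi> \<zeta> 0 = 0" using circle_liftD(5)[OF c1 \<zeta>(1)] by (simp add: fixlift_def)
    then show ?thesis using chart_circle_action_trivial[OF dD(1) d(2) dD(2) \<zeta> dD(3) _ t1 w] by blast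
  qed
  \<comment> \<open>Since \<open>\<zeta>\<close> acts trivially on a whole chart,
    \<open>\<rho> \<zeta>\<close> acts trivially near a point; being torsion, it is 1.\<close>
  have r1: "\<rho> \<zeta> = 1"
  proof -
    obtain d \<psi> where d: "disk_chart A (proj c v) d" "chart_circle_action \<rho> d \<psi>" using lifting_coveringE[OF l g(2)] .
    note dD = disk_chartD[OF d(1)]
    have od: "orbifold_chart d" using chartsD[OF dD(1)] .
    have "\<forall>\<^sub>F w in nhds 0. act (\<rho> \<zeta>) (proj d w) = proj d w"
      using eventually_cover[OF od dD(3)]
      by eventually_elim (use triv[OF g(2) d] chart_circle_actionD(4)[OF d(2) \<zeta>(1)] in auto)
    then have "\<forall>\<^sub>F y in nhds (proj d 0). act (\<rho> \<zeta>) y = y"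
      using eventually_proj[OF od dD(3), of "\<lambda>y. act (\<rho> \<zeta>) y = y"] by simp
    moreover have "\<rho> \<zeta> ^ K = 1" using hom_circle_torusD(3,4)[OF \<rho>] \<zeta> by metis
    ultimately show ?thesis using torsion_eq_one[OF hom_circle_torusD(1)[OF \<rho> \<zeta>(1)] _ \<zeta>(3)] by blast
  qed
  \<comment> \<open>The exact order of \<open>\<zeta>\<close>, so that all \<open>m\<close>-th roots
    of unity are powers of \<open>\<zeta>\<close> and act trivially along with it.\<close>
  define m where "m = (LEAST m. m > 0 \<and> \<zeta> ^ m = 1)"
  have m: "m > 0" "\<zeta> ^ m = 1" using LeastI[of "\<lambda>m. m > 0 \<and> \<zeta> ^ m = 1" K] \<zeta> unfolding m_def by auto
  have least: "\<zeta> ^ j \<noteq> 1" if "0 < j" "j < m" for j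
    using not_less_Least[of j "\<lambda>m. m > 0 \<and> \<zeta> ^ m = 1"] that unfolding m_def by blast
  have pow: "\<exists>j. \<omega> = \<zeta> ^ j" if "\<omega> ^ m = 1" for \<omega> using roots_of_unity_powers[OF m least that] .
  have onC: "z \<in> sphere 0 1" if "z ^ m = 1" for z :: complex
    using that m(1) by (metis mem_sphere_0 norm_ge_zero norm_one norm_power power_eq_1_iff not_gr0)
  define \<sigma> where "\<sigma> w = \<rho> (cis (Arg w / real m))" for w
  have ker1: "\<rho> \<omega> = \<one>\<^bsub>torus_group\<^esub>" if "\<omega> ^ m = 1" for \<omega>
    using pow[OF that] hom_circle_torusD(4)[OF \<rho> \<zeta>(1)] r1 by auto
  have grpT: "Group.group (torus_group :: (complex ^ 'n) monoid)" using comm_group_torus comm_group_def by blast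
  have fac: "\<And>z. z \<in> sphere 0 1 \<Longrightarrow> \<sigma> (z ^ m) = \<rho> z" "\<sigma> \<in> hom circle_group torus_group"
    "\<And>\<theta>. \<sigma> (cis \<theta>) = \<rho> (cis (\<theta> / real m))"
    unfolding \<sigma>_def[abs_def] by (rule root_factor_hom[OF grpT \<rho> m(1) ker1]; assumption)+
  have img: "\<sigma> ` sphere 0 1 = \<rho> ` sphere 0 1"
  proof (intro equalityI subsetI)
    fix s assume "s \<in> \<sigma> ` sphere 0 1"
    then show "s \<in> \<rho> ` sphere 0 1" unfolding \<sigma>_def by (auto intro!: imageI)
  next
    fix s assume "s \<in> \<rho> ` sphere 0 1"
    then obtain z where z: "z \<in> sphere 0 1" "s = \<rho> z" by blast
    then have "s = \<sigma> (z ^ m)" "z ^ m \<in> sphere 0 1" using fac(1) by (auto simp: norm_power)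
    then show "s \<in> \<sigma> ` sphere 0 1" by (metis imageI)
  qed
  have cont: "continuous_on (sphere 0 1) \<sigma>"
  proof (rule continuous_on_circleI)
    have "continuous_on UNIV (\<lambda>\<theta>::real. \<rho> (cis (\<theta> / real m)))"
      by (rule continuous_on_compose2[OF cov(2)]) (use m(1) in \<open>auto intro!: continuous_intros\<close>)
    then show "continuous_on UNIV (\<lambda>\<theta>. \<sigma> (cis \<theta>))" unfolding fac(3) .
  qed
  have ker\<rho>: "kernel circle_group torus_group \<rho> = {z \<in> sphere 0 1. \<rho> z = 1}"
    and ker\<sigma>: "kernel circle_group torus_group \<sigma> = {z \<in> sphere 0 1. \<sigma> z = 1}" by (auto simp: kernel_def)
  have kereq: "kernel circle_group torus_group \<sigma> = (\<lambda>z. z ^ m) ` kernel circle_group torus_group \<rho>"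
  proof (intro equalityI subsetI)
    fix w assume "w \<in> kernel circle_group torus_group \<sigma>"
    then have w: "w \<in> sphere 0 1" "\<sigma> w = 1" by (auto simp: ker\<sigma>)
    define z where "z = cis (Arg w / real m)"
    have "z ^ m = w" using Complex.DeMoivre[of "Arg w / real m" m] unit_eq_cis_Arg[of w] w(1) m(1) by (simp add: z_def)
    moreover have "z \<in> kernel circle_group torus_group \<rho>" using w by (simp add: ker\<rho> z_def \<sigma>_def)
    ultimately show "w \<in> (\<lambda>z. z ^ m) ` kernel circle_group torus_group \<rho>" by blast
  next
    fix w assume "w \<in> (\<lambda>z. z ^ m) ` kernel circle_group torus_group \<rho>"
    then show "w \<in> kernel circle_group torus_group \<sigma>" unfolding ker\<rho> ker\<sigma> using fac(1) by (auto simp: norm_power)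
  qed
  have fin: "finite (kernel circle_group torus_group \<rho>)" using fcg by (simp add: finite_covering_group_def)
  have "lifting_covering A act N S \<sigma>"
    unfolding lifting_covering_def
  proof (intro conjI ballI)
    have fs: "finite (kernel circle_group torus_group \<sigma>)" using fin kereq by simp
    from covering_space_circle_hom[OF fac(2) cont fs] show "finite_covering_group S \<sigma>"
      unfolding finite_covering_group_def using fac(2) fs img cov(1) by simp
    fix y assume y: "y \<in> N"
    obtain d \<psi> where d: "disk_chart A y d" "chart_circle_action \<rho> d \<psi>" using lifting_coveringE[OF l y] .
    note dD = disk_chartD[OF d(1)]
    have od: "orbifold_chart d" using chartsD[OF dD(1)] .
    define \<psi>' where "\<psi>' w = \<psi> (cis (Arg w / real m))" for w
    have ga: "group_action circle_group (cover d) \<psi>" using d(2) by (simp add: chart_circle_action_def)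
    have hom: "\<psi> \<in> hom circle_group (BijGroup (cover d))"
      using group_hom.homh[OF group_action.group_hom[OF ga]] .
    have \<psi>pow: "\<psi> (\<zeta> ^ j) w = w" if "w \<in> cover d" for j w
    proof (induction j)
      case 0
      then show ?case using chart_circle_actionD(3)[OF d(2) that] by simp
    next
      case (Suc j)
      have "\<zeta> ^ j \<in> sphere 0 1" using \<zeta>(1) by (simp add: norm_power)
      then show ?case using Suc chart_circle_actionD(2)[OF d(2) \<zeta>(1) _ that] triv[OF y d that] by simp
    qed
    have \<psi>1: "\<psi> \<omega> = \<one>\<^bsub>BijGroup (cover d)\<^esub>" if \<omega>: "\<omega> ^ m = 1" for \<omega>
    proof -
      \<comment> \<open>Equality in \<open>BijGroup\<close> also compares values outside the cover,
        where both maps are \<open>undefined\<close> by extensionality.\<close>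
      have "\<psi> \<omega> \<in> Bij (cover d)" using group_action.bij_prop0[OF ga, of \<omega>] onC[OF \<omega>] by simp
      then have ext: "\<psi> \<omega> \<in> extensional (cover d)" by (rule Bij_imp_extensional)
      have "\<psi> \<omega> w = (\<lambda>w\<in>cover d. w) w" for w
        using pow[OF \<omega>] \<psi>pow[of w] ext by (cases "w \<in> cover d") (auto simp: extensional_def)
      then show ?thesis by (auto simp: BijGroup_def)
    qed
    have fac': "\<psi>' \<in> hom circle_group (BijGroup (cover d))"
      "\<And>\<theta>. \<psi>' (cis \<theta>) = \<psi> (cis (\<theta> / real m))"
      unfolding \<psi>'_def[abs_def] by (rule root_factor_hom(2-)[OF group_BijGroup hom m(1) \<psi>1]; assumption)+
    have "chart_circle_action \<sigma> d \<psi>'"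
      unfolding chart_circle_action_def
    proof (intro conjI ballI)
      show "group_action circle_group (cover d) \<psi>'"
        by (intro group_action.intro group_hom.intro group_hom_axioms.intro group_BijGroup fac'(1))
           (use comm_group_circle comm_group_def in blast)
      let ?L = "\<lambda>p :: real \<times> 'v. (fst p / real m, snd p)"
      have bl: "bounded_linear ?L"
        by (intro bounded_linear_Pair bounded_linear_divide bounded_linear_compose[OF bounded_linear_divide bounded_linear_fst, unfolded o_def] bounded_linear_snd)
      have op: "open (UNIV \<times> cover d :: (real \<times> 'v) set)" using open_cover[OF od] by (intro open_Times) auto
      have "smooth_map_on (UNIV \<times> cover d) (\<lambda>p. (\<lambda>(\<theta> :: real, v). \<psi> (cis \<theta>) v) (?L p))"
        by (rule smooth_map_on_compose[OF op op _ smooth_map_on_bounded_linear[OF bl]])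
           (use d(2) in \<open>auto simp: chart_circle_action_def\<close>)
      then show "smooth_map_on (UNIV \<times> cover d) (\<lambda>(\<theta> :: real, v). \<psi>' (cis \<theta>) v)"
        by (simp add: fac'(2) case_prod_unfold)
      fix z w assume z: "z \<in> carrier circle_group" and w: "w \<in> cover d"
      show "proj d (\<psi>' z w) = act (\<sigma> z) (proj d w)"
        unfolding \<psi>'_def \<sigma>_def by (rule chart_circle_actionD(4)[OF d(2) _ w]) simp
    qed
    then show "\<exists>c. disk_chart A y c \<and> action_lifts act \<sigma> c" unfolding action_lifts_iff using d(1) by blast
  qed
  \<comment> \<open>Minimality forces the \<open>m\<close>-th power map, which carries the kernel of
    \<open>\<rho>\<close> onto that of \<open>\<sigma>\<close>, to be injective on the former; but
    it identifies the kernel elements \<open>\<zeta>\<close> and 1.\<close>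
  then have "card (kernel circle_group torus_group \<rho>) \<le> card (kernel circle_group torus_group \<sigma>)"
    using ml by (simp add: minimal_lifting_covering_def)
  then have "card ((\<lambda>z. z ^ m) ` kernel circle_group torus_group \<rho>) = card (kernel circle_group torus_group \<rho>)"
    unfolding kereq using card_image_le[OF fin, of "\<lambda>z. z ^ m"] by linarith
  then have "inj_on (\<lambda>z. z ^ m) (kernel circle_group torus_group \<rho>)" by (rule eq_card_imp_inj_on[OF fin])
  moreover have "\<zeta> \<in> kernel circle_group torus_group \<rho>" "1 \<in> kernel circle_group torus_group \<rho>"
    using r1 \<zeta>(1) hom_circle_torusD(3)[OF \<rho>] by (auto simp: ker\<rho>)
  ultimately show False using inj_onD[of "\<lambda>z. z ^ m" _ \<zeta> 1] m(2) \<zeta>1 by simp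
qed

text \<open>The elements with trivial derivative form a closed subgroup, which is torsion-free by
  \<open>minimal_covering_torsion\<close> and therefore trivial.\<close>

lemma minimal_covering_faithful:
  assumes ml: "minimal_lifting_covering A act N S \<rho>" and N: "N \<subseteq> fixed_set act S" "connected N"
    and g: "circle_lift c v \<rho> g" "proj c v \<in> N"
    and z: "z \<in> sphere 0 1" "\<And>u. deriv_at (g z) v u = u"
  shows "z = 1"
proof -
  define K where "K = (\<Inter>u. {z \<in> sphere 0 1. deriv_at (g z) v u \<in> {u}})"
  have "closed {z \<in> sphere 0 1. deriv_at (g z) v u \<in> {u}}" for u
    using continuous_closed_preimage[OF circle_liftD(8)[OF g(1)] _ closed_singleton, of u u]
    by (simp add: Int_def vimage_def)
  then have "closed K" unfolding K_def by blast
  moreover have "K \<subseteq> sphere 0 1" "1 \<in> K" using circle_liftD(7)[OF g(1)] by (auto simp: K_def)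
  moreover have "x * y \<in> K" if "x \<in> K" "y \<in> K" for x y
    using that circle_liftD(6)[OF g(1)] by (auto simp: K_def norm_mult)
  moreover have "x = 1" if "x \<in> K" "M > 0" "x ^ M = 1" for x M
    by (rule minimal_covering_torsion[OF ml N _ that(3,2) g]) (use that in \<open>auto simp: K_def\<close>)
  ultimately show ?thesis
    using torsion_free_closed_subgroup_circle[of K z] z by (auto simp: K_def)
qed

end

section \<open>Circle representations fixing a subspace of codimension two\<close>

lemma neg_eq_self_imp_zero: "- x = x \<Longrightarrow> x = (0 :: 'a::real_vector)"
  by (simp add: neg_eq_iff_add_eq_0 flip: scaleR_2)

locale plane_rotation =
  fixes R :: "complex \<Rightarrow> 'v::euclidean_space \<Rightarrow> 'v" and W :: "'v set"
  assumes linear_R: "z \<in> sphere 0 1 \<Longrightarrow> linear (R z)"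
    and R_mult: "z \<in> sphere 0 1 \<Longrightarrow> w \<in> sphere 0 1 \<Longrightarrow> R (z * w) u = R z (R w u)"
    and R_one: "R 1 u = u"
    and continuous_R: "continuous_on (sphere 0 1) (\<lambda>z. R z u)"
    and subspace_W: "subspace W" and dim_W: "dim W + 2 = DIM('v)"
    and R_fixes_W: "z \<in> sphere 0 1 \<Longrightarrow> u \<in> W \<Longrightarrow> R z u = u"
    and R_faithful: "z \<in> sphere 0 1 \<Longrightarrow> (\<And>u. R z u = u) \<Longrightarrow> z = 1"
begin

text \<open>The normal plane, obtained algebraically: -1 is an involution, so its two eigenspaces
  are complementary, and any map commuting with it preserves both.\<close>

definition V :: "'v set" where "V = {u. R (-1) u = - u}"

lemma minus_one_circle: "(-1::complex) \<in> sphere 0 1" "\<i> \<in> sphere 0 1" by auto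

lemma linear_J: "linear (R (-1))" and linear_Q: "linear (R \<i>)"
  using linear_R minus_one_circle by blast+

lemma JJ: "R (-1) (R (-1) u) = u"
  using R_mult[OF minus_one_circle(1,1), of u] R_one by simp

lemma QQ: "R \<i> (R \<i> u) = R (-1) u"
  using R_mult[OF minus_one_circle(2,2), of u] by simp

lemma R_commute: "z \<in> sphere 0 1 \<Longrightarrow> w \<in> sphere 0 1 \<Longrightarrow> R z (R w u) = R w (R z u)"
  using R_mult[of z w u] R_mult[of w z u] by (simp add: mult.commute)

lemma subspace_V: "subspace V"
  using linear_J by (auto simp: V_def subspace_def linear_add linear_cmul linear_0)

lemma commuting_preserves_V:
  assumes "linear L" "\<And>u. L (R (-1) u) = R (-1) (L u)" "u \<in> V"
  shows "L u \<in> V"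
  using assms(2)[of u] assms(3) linear_neg[OF assms(1), of u] by (simp add: V_def)

lemma Q_V: "u \<in> V \<Longrightarrow> R \<i> u \<in> V"
  by (rule commuting_preserves_V[OF linear_Q]) (use R_commute minus_one_circle in auto)

lemma QQ_V: "u \<in> V \<Longrightarrow> R \<i> (R \<i> u) = - u"
  using QQ by (simp add: V_def)

text \<open>On \<open>V\<close> the map \<open>R \<i>\<close> squares to minus the identity, so it
  is a complex structure; eliminating leaves \<open>p\<^sup>2 + q\<^sup>2\<close> as the coefficient
  of \<open>v\<close>.\<close>

lemma Q_independent:
  assumes v: "v \<in> V" "v \<noteq> 0" and "p *\<^sub>R v + q *\<^sub>R R \<i> v = 0"
  shows "p = 0 \<and> q = 0"
proof -
  have "R \<i> (p *\<^sub>R v + q *\<^sub>R R \<i> v) = 0" using assms(3) linear_0[OF linear_Q] by simp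
  then have 2: "p *\<^sub>R R \<i> v - q *\<^sub>R v = 0"
    using linear_Q QQ_V[OF v(1)] by (simp add: linear_add linear_cmul)
  have "p *\<^sub>R (p *\<^sub>R v + q *\<^sub>R R \<i> v) - q *\<^sub>R (p *\<^sub>R R \<i> v - q *\<^sub>R v) = (p\<^sup>2 + q\<^sup>2) *\<^sub>R v"
    by (simp add: algebra_simps power2_eq_square)
  then have "(p\<^sup>2 + q\<^sup>2) *\<^sub>R v = 0" using assms(3) 2 by simp
  then have "p\<^sup>2 + q\<^sup>2 = 0" using v(2) by simp
  then show ?thesis by (simp add: sum_power2_eq_zero_iff)
qed

lemma independent_Q:
  assumes v: "v \<in> V" "v \<noteq> 0"
  shows "v \<noteq> R \<i> v" "independent {v, R \<i> v}"
proof -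
  show "v \<noteq> R \<i> v" using Q_independent[OF v, of 1 "-1"] by auto
  show "independent {v, R \<i> v}"
  proof (rule independent_insertI)
    show "independent {R \<i> v}" using Q_independent[OF v, of 0 1] by auto
    show "v \<notin> span {R \<i> v}"
    proof
      assume "v \<in> span {R \<i> v}"
      then obtain q where q: "v = q *\<^sub>R R \<i> v" by (auto simp: span_singleton)
      have "v - q *\<^sub>R R \<i> v = 0" by (rule right_minus_eq[THEN iffD2]) (rule q)
      then have "1 *\<^sub>R v + (- q) *\<^sub>R R \<i> v = 0"
        by (simp only: scaleR_one scaleR_minus_left add_uminus_conv_diff)
      from Q_independent[OF v this] show False by simp
    qed
  qed
qed

text \<open>Faithfulness at -1 yields \<open>u\<close> with \<open>R (-1) u \<noteq> u\<close>, and
  the difference of the two vectors is negated by \<open>R (-1)\<close>.\<close>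

lemma V_nontrivial: obtains v where "v \<in> V" "v \<noteq> 0"
proof -
  have "\<exists>u. R (-1) u \<noteq> u" using R_faithful[OF minus_one_circle(1)] by fastforce
  then obtain u where u: "R (-1) u \<noteq> u" by blast
  have "u - R (-1) u \<in> V" using linear_J JJ by (simp add: V_def linear_diff)
  then show thesis using that[of "u - R (-1) u"] u by simp
qed

lemma dim_fixed_V:
  "dim {u. R (-1) u = u} + dim V = DIM('v)" "subspace {u. R (-1) u = u}"
proof -
  let ?F = "{u. R (-1) u = u}"
  show F: "subspace ?F" using linear_J by (auto simp: subspace_def linear_add linear_cmul linear_0)
  have "{x + y |x y. x \<in> ?F \<and> y \<in> V} = UNIV"
  proof -
    have "\<exists>x y. u = x + y \<and> x \<in> ?F \<and> y \<in> V" for u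
    proof (intro exI conjI)
      show "u = (1/2) *\<^sub>R (u + R (-1) u) + (1/2) *\<^sub>R (u - R (-1) u)"
        by (simp add: scaleR_add_right scaleR_diff_right flip: scaleR_add_left)
      show "(1/2) *\<^sub>R (u + R (-1) u) \<in> ?F" "(1/2) *\<^sub>R (u - R (-1) u) \<in> V"
        using linear_J JJ by (auto simp: V_def linear_add linear_diff linear_cmul algebra_simps)
    qed
    then show ?thesis by blast
  qed
  moreover have "?F \<inter> V = {0}"
  proof -
    have "x = 0" if "R (-1) x = x" "R (-1) x = - x" for x
      by (rule neg_eq_self_imp_zero) (use that in simp)
    then have "?F \<inter> V \<subseteq> {0}" unfolding V_def by blast
    then show ?thesis using linear_0[OF linear_J] by (auto simp: V_def)
  qed
  ultimately show "dim ?F + dim V = DIM('v)"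
    using dim_sums_Int[OF F subspace_V] by simp
qed

text \<open>A dimension count: \<open>V\<close> contains the independent pair \<open>v\<close>,
  \<open>R \<i> v\<close>, the fixed space contains \<open>W\<close>, and the two lower bounds
  already add up to the full dimension.\<close>

lemma dim_V: "dim V = 2" and fixed_eq_W: "{u. R (-1) u = u} = W"
proof -
  obtain v where v: "v \<in> V" "v \<noteq> 0" by (rule V_nontrivial)
  note ne = independent_Q(1)[OF v] and ind = independent_Q(2)[OF v]
  have "{v, R \<i> v} \<subseteq> V" using v Q_V by auto
  then have "2 \<le> dim V" using ind independent_card_le_dim[of "{v, R \<i> v}" V] ne by simp
  have WF: "W \<subseteq> {u. R (-1) u = u}" using R_fixes_W minus_one_circle by auto
  have "dim W \<le> dim {u. R (-1) u = u}" using WF by (rule dim_subset)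
  then have *: "dim {u. R (-1) u = u} = dim W" "dim V = 2"
    using dim_fixed_V(1) dim_W \<open>2 \<le> dim V\<close> by linarith+
  show "dim V = 2" by fact
  show "{u. R (-1) u = u} = W"
    using subspace_dim_equal[OF subspace_W dim_fixed_V(2) WF] * by simp
qed

definition proj_V :: "'v \<Rightarrow> 'v" where "proj_V u = (1/2) *\<^sub>R (u - R (-1) u)"

lemma linear_proj_V: "linear proj_V"
  unfolding proj_V_def by (intro linearI) (use linear_J in \<open>auto simp: linear_add linear_cmul algebra_simps\<close>)

lemma proj_V_in: "proj_V u \<in> V"
  using linear_J JJ by (auto simp: proj_V_def V_def linear_diff linear_cmul algebra_simps)

lemma proj_V_id: "u \<in> V \<Longrightarrow> proj_V u = u"
  by (simp add: proj_V_def V_def scaleR_2[symmetric] flip: scaleR_2)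

lemma proj_V_eq_0_iff: "proj_V u = 0 \<longleftrightarrow> u \<in> W"
  by (auto simp: proj_V_def fixed_eq_W[symmetric])

lemma diff_proj_V: "u - proj_V u \<in> W"
  using linear_diff[OF linear_proj_V, of u "proj_V u"] proj_V_id[OF proj_V_in, of u] proj_V_eq_0_iff by simp

lemma linear_eq_on_W_V:
  assumes "linear L" "linear M" "\<And>u. u \<in> W \<Longrightarrow> L u = M u" "\<And>u. u \<in> V \<Longrightarrow> L u = M u"
  shows "L u = M u"
proof -
  have u: "u = (u - proj_V u) + proj_V u" by simp
  have "L u = L (u - proj_V u) + L (proj_V u)" by (subst u) (rule linear_add[OF assms(1)])
  also have "\<dots> = M (u - proj_V u) + M (proj_V u)" using assms(3)[OF diff_proj_V] assms(4)[OF proj_V_in] by simp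
  also have "\<dots> = M u" by (subst (3) u) (rule linear_add[OF assms(2), symmetric])
  finally show ?thesis .
qed

text \<open>Multiplication by complex numbers for the complex structure \<open>R \<i>\<close> on
  \<open>V\<close>.\<close>

definition scal :: "complex \<Rightarrow> 'v \<Rightarrow> 'v" where "scal \<kappa> u = Re \<kappa> *\<^sub>R u + Im \<kappa> *\<^sub>R R \<i> u"

lemma scal_V: "u \<in> V \<Longrightarrow> scal \<kappa> u \<in> V"
  unfolding scal_def using subspace_V Q_V by (intro subspace_add subspace_scale) auto

lemma scal_mult: "u \<in> V \<Longrightarrow> scal (\<kappa> * \<mu>) u = scal \<kappa> (scal \<mu> u)"
  using linear_Q QQ_V[of u] by (simp add: scal_def linear_add linear_cmul algebra_simps)

lemma scal_power: "u \<in> V \<Longrightarrow> scal (\<kappa> ^ k) u = (scal \<kappa> ^^ k) u"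
proof (induction k arbitrary: u)
  case (Suc k)
  then show ?case using scal_mult[of u "\<kappa> ^ k" \<kappa>] scal_V[of u \<kappa>] by (simp add: funpow_Suc_right mult.commute del: funpow.simps)
qed (simp add: scal_def)

lemma scal_inj: "v \<in> V \<Longrightarrow> v \<noteq> 0 \<Longrightarrow> scal \<kappa> v = scal \<mu> v \<Longrightarrow> \<kappa> = \<mu>"
proof -
  assume v: "v \<in> V" "v \<noteq> 0" "scal \<kappa> v = scal \<mu> v"
  then have "(Re \<kappa> - Re \<mu>) *\<^sub>R v + (Im \<kappa> - Im \<mu>) *\<^sub>R R \<i> v = 0"
    by (simp add: scal_def algebra_simps)
  then show "\<kappa> = \<mu>" using Q_independent[OF v(1,2), of "Re \<kappa> - Re \<mu>" "Im \<kappa> - Im \<mu>"] by (simp add: complex_eq_iff)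
qed

lemma V_eq_scal:
  assumes v: "v \<in> V" "v \<noteq> 0" and u: "u \<in> V"
  shows "\<exists>\<kappa>. u = scal \<kappa> v"
proof -
  let ?S = "{u. \<exists>\<kappa>. u = scal \<kappa> v}"
  have S: "?S = span {v, R \<i> v}"
  proof (intro equalityI subsetI)
    fix w assume "w \<in> ?S"
    then show "w \<in> span {v, R \<i> v}"
    proof -
      obtain \<kappa> where "w = Re \<kappa> *\<^sub>R v + Im \<kappa> *\<^sub>R R \<i> v" using \<open>w \<in> ?S\<close> by (auto simp: scal_def)
      moreover have "Re \<kappa> *\<^sub>R v + Im \<kappa> *\<^sub>R R \<i> v \<in> span {v, R \<i> v}"
        by (intro span_add span_scale span_base) auto
      ultimately show ?thesis by simp
    qed
  next
    fix w assume "w \<in> span {v, R \<i> v}"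
    then obtain p q where "w = p *\<^sub>R v + q *\<^sub>R R \<i> v"
      by (auto simp: span_insert span_singleton algebra_simps)
    then show "w \<in> ?S" by (intro CollectI exI[of _ "Complex p q"]) (simp add: scal_def)
  qed
  note ne = independent_Q(1)[OF v] and ind = independent_Q(2)[OF v]
  have "dim (span {v, R \<i> v}) = 2" using ind dim_eq_card_independent[of "{v, R \<i> v}"] ne by simp
  moreover have "span {v, R \<i> v} \<subseteq> V" using v Q_V by (intro span_minimal subspace_V) auto
  ultimately have "span {v, R \<i> v} = V"
    using subspace_dim_equal[OF subspace_span subspace_V] dim_V by simp
  then show ?thesis using u S by blast
qed

text \<open>For this structure \<open>V\<close> is a complex line, and a map commuting with
  \<open>R \<i>\<close> is complex linear, hence a scalar.\<close>

lemma commuting_scal: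
  assumes L: "linear L" and comm: "\<And>z u. z \<in> sphere 0 1 \<Longrightarrow> L (R z u) = R z (L u)"
  obtains \<kappa> where "\<And>u. u \<in> V \<Longrightarrow> L u = scal \<kappa> u"
proof -
  obtain v where v: "v \<in> V" "v \<noteq> 0" by (rule V_nontrivial)
  have "L v \<in> V" by (rule commuting_preserves_V[OF L _ v(1)]) (use comm minus_one_circle in auto)
  then obtain \<kappa> where \<kappa>: "L v = scal \<kappa> v" using V_eq_scal[OF v] by blast
  have "L u = scal \<kappa> u" if u: "u \<in> V" for u
  proof -
    obtain \<mu> where \<mu>: "u = scal \<mu> v" using V_eq_scal[OF v u] by blast
    have "L u = scal \<mu> (L v)"
      unfolding \<mu> scal_def using L comm minus_one_circle(2) by (simp add: linear_add linear_cmul)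
    also have "\<dots> = scal \<kappa> u" unfolding \<kappa> \<mu> using scal_mult[OF v(1)] by (metis mult.commute)
    finally show ?thesis .
  qed
  then show thesis by (rule that)
qed

section \<open>The character by which the circle acts on the plane\<close>

definition is_character :: "(complex \<Rightarrow> complex) \<Rightarrow> bool"
  where "is_character \<xi> \<longleftrightarrow> continuous_on (sphere 0 1) \<xi> \<and>
    (\<forall>z\<in>sphere 0 1. \<forall>u\<in>V. R z u = scal (\<xi> z) u) \<and>
    (\<forall>z\<in>sphere 0 1. \<forall>w\<in>sphere 0 1. \<xi> (z * w) = \<xi> z * \<xi> w) \<and> \<xi> 1 = 1 \<and> \<xi> (-1) = -1 \<and>
    (\<forall>z\<in>sphere 0 1. norm (\<xi> z) = 1)"

lemma character_exists: "\<exists>\<xi>. is_character \<xi>"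
proof -
  have "\<exists>\<kappa>. \<forall>u\<in>V. R z u = scal \<kappa> u" if "z \<in> sphere 0 1" for z
    using commuting_scal[OF linear_R[OF that]] R_commute[OF that] by metis
  then obtain \<xi> where \<xi>: "\<And>z u. z \<in> sphere 0 1 \<Longrightarrow> u \<in> V \<Longrightarrow> R z u = scal (\<xi> z) u" by metis
  obtain v where v: "v \<in> V" "v \<noteq> 0" by (rule V_nontrivial)
  have Qv: "R \<i> v \<in> V" using Q_V[OF v(1)] .
  have mult: "\<xi> (z * w) = \<xi> z * \<xi> w" if "z \<in> sphere 0 1" "w \<in> sphere 0 1" for z w
  proof (rule scal_inj[OF v])
    have "z * w \<in> sphere 0 1" using that by (simp add: norm_mult)
    then have "scal (\<xi> (z * w)) v = R z (R w v)" using \<xi> v(1) R_mult[OF that] by metis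
    also have "\<dots> = scal (\<xi> z * \<xi> w) v" using \<xi> that scal_V v(1) scal_mult by metis
    finally show "scal (\<xi> (z * w)) v = scal (\<xi> z * \<xi> w) v" .
  qed
  have one: "\<xi> 1 = 1"
    by (rule scal_inj[OF v]) (use \<xi>[of 1 v] v R_one in \<open>simp add: scal_def\<close>)
  have mone: "\<xi> (-1) = -1"
    by (rule scal_inj[OF v]) (use \<xi>[of "-1" v] v in \<open>simp add: scal_def V_def\<close>)
  note ne = independent_Q(1)[OF v] and ind = independent_Q(2)[OF v]
  \<comment> \<open>A linear coordinate on the plane that sends \<open>v\<close> to 1 and
    \<open>R \<i> v\<close> to the imaginary unit; it reads \<open>\<xi> z\<close> off
    \<open>R z v\<close>, which shows continuity.\<close>
  obtain \<phi> :: "'v \<Rightarrow> complex" where \<phi>: "linear \<phi>" "\<phi> v = 1" "\<phi> (R \<i> v) = \<i>"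
    using linear_independent_extend[OF ind, of "\<lambda>u. if u = v then 1 else \<i>"] ne by auto
  have \<phi>\<xi>: "\<phi> (R z v) = \<xi> z" if "z \<in> sphere 0 1" for z
    unfolding \<xi>[OF that v(1)] scal_def using \<phi>
    by (simp add: linear_add linear_cmul complex_eq_iff)
  have cont: "continuous_on (sphere 0 1) \<xi>"
    by (rule continuous_on_eq[OF linear_continuous_on_compose[OF continuous_R \<phi>(1)]]) (rule \<phi>\<xi>)
  \<comment> \<open>The values of \<open>\<xi>\<close> are bounded by compactness, so all powers of
    each value are bounded and its norm is at most 1; the inverse element gives the opposite
    inequality.\<close>
  obtain B where B: "\<And>z. z \<in> sphere 0 1 \<Longrightarrow> norm (\<xi> z) \<le> B"
    using compact_imp_bounded[OF compact_continuous_image[OF cont compact_sphere]] unfolding bounded_iff by blast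
  have le: "norm (\<xi> z) \<le> 1" if z: "z \<in> sphere 0 1" for z
  proof (rule ccontr)
    assume "\<not> norm (\<xi> z) \<le> 1"
    then obtain k where k: "B < norm (\<xi> z) ^ k" using real_arch_pow[of "norm (\<xi> z)" B] by auto
    have zk: "z ^ k \<in> sphere 0 1 \<and> \<xi> (z ^ k) = \<xi> z ^ k"
      by (induction k) (use z one mult in \<open>auto simp: norm_mult norm_power\<close>)
    then have "norm (\<xi> z) ^ k \<le> B" using B[of "z ^ k"] by (simp add: norm_power)
    then show False using k by simp
  qed
  have "norm (\<xi> z) = 1" if z: "z \<in> sphere 0 1" for z
  proof -
    have z0: "z \<noteq> 0" and i: "inverse z \<in> sphere 0 1" using z by (auto simp: norm_inverse)
    have "norm (\<xi> z) * norm (\<xi> (inverse z)) = 1"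
      using mult[OF z i] one z0 by (simp flip: norm_mult)
    moreover have "norm (\<xi> z) * norm (\<xi> (inverse z)) \<le> norm (\<xi> z) * 1"
      using le[OF i] by (intro mult_left_mono) auto
    ultimately show ?thesis using le[OF z] by simp
  qed
  then show ?thesis unfolding is_character_def using cont \<xi> mult one mone by (intro exI[of _ \<xi>]) simp
qed

text \<open>Surjectivity of the character onto the unit circle without degrees: the real part runs
  from 1 at \<open>z = 1\<close> to -1 at \<open>z = -1\<close>, so it takes the value
  \<open>Re \<kappa>\<close>. Then the value is \<open>\<kappa>\<close> or its conjugate, and
  inverting \<open>z\<close> exchanges the two.\<close>

lemma scal_eq_R:
  assumes "norm \<kappa> = 1"
  obtains z where "z \<in> sphere 0 1" "\<And>u. u \<in> V \<Longrightarrow> R z u = scal \<kappa> u"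
proof -
  obtain \<xi> where "is_character \<xi>" using character_exists by blast
  then have cont: "continuous_on (sphere 0 1) \<xi>"
    and \<xi>: "\<And>z u. z \<in> sphere 0 1 \<Longrightarrow> u \<in> V \<Longrightarrow> R z u = scal (\<xi> z) u"
    and mult: "\<And>z w. z \<in> sphere 0 1 \<Longrightarrow> w \<in> sphere 0 1 \<Longrightarrow> \<xi> (z * w) = \<xi> z * \<xi> w"
    and one: "\<xi> 1 = 1" "\<xi> (-1) = -1" and nrm: "\<And>z. z \<in> sphere 0 1 \<Longrightarrow> norm (\<xi> z) = 1"
    unfolding is_character_def by simp_all
  have c: "continuous_on {0..pi} (\<lambda>\<theta>. Re (\<xi> (cis \<theta>)))"
    by (intro continuous_on_Re continuous_on_compose2[OF cont]) (auto intro!: continuous_intros)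
  have "\<bar>Re \<kappa>\<bar> \<le> 1" using abs_Re_le_cmod[of \<kappa>] assms by simp
  then have "-1 \<le> Re \<kappa>" "Re \<kappa> \<le> 1" by linarith+
  then obtain \<theta> where \<theta>: "Re (\<xi> (cis \<theta>)) = Re \<kappa>"
    using IVT2'[of "\<lambda>\<theta>. Re (\<xi> (cis \<theta>))" pi "Re \<kappa>" 0] c one by auto
  define z where "z = cis \<theta>"
  have z: "z \<in> sphere 0 1" "z \<noteq> 0" by (auto simp: z_def)
  have "(Re (\<xi> z))\<^sup>2 + (Im (\<xi> z))\<^sup>2 = (Re \<kappa>)\<^sup>2 + (Im \<kappa>)\<^sup>2"
    using nrm[OF z(1)] assms by (metis cmod_power2)
  then have "(Im (\<xi> z))\<^sup>2 = (Im \<kappa>)\<^sup>2" using \<theta> by (simp add: z_def)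
  then consider "Im (\<xi> z) = Im \<kappa>" | "Im (\<xi> z) = - Im \<kappa>" by (auto simp: power2_eq_iff)
  then show thesis
  proof cases
    case 1
    then have "\<xi> z = \<kappa>" using \<theta> by (simp add: complex_eq_iff z_def)
    then show thesis using that[OF z(1)] \<xi>[OF z(1)] by simp
  next
    case 2
    then have cz: "\<xi> z = cnj \<kappa>" using \<theta> by (simp add: complex_eq_iff z_def)
    have i: "inverse z \<in> sphere 0 1" using z by (simp add: norm_inverse)
    have "cnj \<kappa> * \<xi> (inverse z) = 1" using mult[OF z(1) i] one z(2) cz by simp
    moreover have "\<kappa> * cnj \<kappa> = 1" using assms by (simp add: complex_norm_square[symmetric])
    ultimately have "\<xi> (inverse z) = \<kappa>"
      by (metis mult.assoc mult.commute mult_1)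
    then show thesis using that[OF i] \<xi>[OF i] by simp
  qed
qed

text \<open>The scalar by which \<open>L\<close> acts on \<open>V\<close> is a root of unity, hence
  of norm 1, hence a value of the character. This turns chart group elements into points of the
  covering circle.\<close>

lemma commuting_finite_order:
  assumes L: "linear L" and comm: "\<And>z u. z \<in> sphere 0 1 \<Longrightarrow> L (R z u) = R z (L u)"
    and N: "N > 0" "\<And>u. (L ^^ N) u = u"
  obtains z where "z \<in> sphere 0 1" "\<And>u. u \<in> V \<Longrightarrow> L u = R z u"
proof -
  obtain \<kappa> where \<kappa>: "\<And>u. u \<in> V \<Longrightarrow> L u = scal \<kappa> u" using commuting_scal[OF L comm] by blast
  have pow: "(L ^^ k) u = (scal \<kappa> ^^ k) u \<and> (scal \<kappa> ^^ k) u \<in> V" if "u \<in> V" for k u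
    by (induction k) (use \<kappa> that scal_V in auto)
  obtain v where v: "v \<in> V" "v \<noteq> 0" by (rule V_nontrivial)
  have "scal (\<kappa> ^ N) v = (L ^^ N) v" unfolding scal_power[OF v(1)] using pow[OF v(1), of N] by simp
  then have "scal (\<kappa> ^ N) v = scal 1 v" unfolding N(2) by (simp add: scal_def)
  then have "\<kappa> ^ N = 1" by (rule scal_inj[OF v])
  then have "norm \<kappa> ^ N = 1" by (metis norm_one norm_power)
  then have "norm \<kappa> = 1" using N(1) power_eq_imp_eq_base[of "norm \<kappa>" N 1] by simp
  then obtain z where "z \<in> sphere 0 1" "\<And>u. u \<in> V \<Longrightarrow> R z u = scal \<kappa> u" using scal_eq_R by blast
  then show thesis using that[of z] \<kappa> by simp
qed

lemma R_eq_on_V: 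
  assumes "z \<in> sphere 0 1" "w \<in> sphere 0 1" "\<And>u. u \<in> V \<Longrightarrow> R z u = R w u"
  shows "z = w"
proof -
  have w0: "w \<noteq> 0" and i: "inverse w \<in> sphere 0 1" using assms by (auto simp: norm_inverse)
  have zw: "inverse w * z \<in> sphere 0 1" using assms i by (simp add: norm_mult)
  have all: "R z u = R w u" for u
    by (rule linear_eq_on_W_V[OF linear_R[OF assms(1)] linear_R[OF assms(2)]]) (use R_fixes_W assms in auto)
  have "R (inverse w * z) u = u" for u
    using R_mult[OF i assms(1), of u] all[of u] R_mult[OF i assms(2), of u] w0 R_one by simp
  then have "inverse w * z = 1" by (rule R_faithful[OF zw])
  then show ?thesis using w0 by (simp add: field_simps)
qed

end

text \<open>If \<open>V\<close> is not inside \<open>W'\<close>, the projection \<open>u\<close> of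
  some vector of \<open>V\<close> to the plane of \<open>R'\<close> is nonzero and stays in
  \<open>V\<close>, because \<open>R'\<close> commutes with \<open>R (-1)\<close>. The planes share
  \<open>u\<close> and \<open>R \<i> u\<close>, so they coincide. The projection of any
  \<open>w \<in> W\<close> to the common plane is then both fixed and negated by
  \<open>R (-1)\<close>, hence zero.\<close>

lemma plane_rotation_dichotomy:
  assumes "plane_rotation R W" "plane_rotation R' W'"
    and comm: "\<And>z w u. z \<in> sphere 0 1 \<Longrightarrow> w \<in> sphere 0 1 \<Longrightarrow> R z (R' w u) = R' w (R z u)"
  shows "plane_rotation.V R \<subseteq> W' \<or> W = W'"
proof -
  interpret P: plane_rotation R W by fact
  interpret P': plane_rotation R' W' by fact
  show ?thesis
  proof (cases "P.V \<subseteq> W'")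
    case False
    then obtain v where v: "v \<in> P.V" "v \<notin> W'" by blast
    define u where "u = P'.proj_V v"
    have u0: "u \<noteq> 0" using v P'.proj_V_eq_0_iff by (simp add: u_def)
    have J': "R' (-1) w \<in> P.V" if "w \<in> P.V" for w
      by (rule P.commuting_preserves_V[OF P'.linear_J _ that]) (use comm P.minus_one_circle in auto)
    have u: "u \<in> P.V" unfolding u_def P'.proj_V_def
      using v J' P.subspace_V by (intro subspace_scale subspace_diff) auto
    have uV': "u \<in> P'.V" unfolding u_def by (rule P'.proj_V_in)
    have sub: "P.V \<subseteq> P'.V"
    proof
      fix w assume "w \<in> P.V"
      then obtain \<kappa> where w: "w = P.scal \<kappa> u" using P.V_eq_scal[OF u u0] by blast
      have "R \<i> u \<in> P'.V"
        by (rule P'.commuting_preserves_V[OF P.linear_Q _ uV']) (use comm P.minus_one_circle in auto)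
      then show "w \<in> P'.V" unfolding w P.scal_def using uV' P'.subspace_V
        by (intro subspace_add subspace_scale) auto
    qed
    then have VV': "P.V = P'.V"
      using subspace_dim_equal[OF P.subspace_V P'.subspace_V] P.dim_V P'.dim_V by simp
    have "W \<subseteq> W'"
    proof
      fix w assume w: "w \<in> W"
      have "R (-1) w = w" using w P.fixed_eq_W by blast
      then have "R (-1) (P'.proj_V w) = P'.proj_V w"
        unfolding P'.proj_V_def using P.linear_J comm[of "-1" "-1" w] by (simp add: linear_cmul linear_diff)
      moreover have "R (-1) (P'.proj_V w) = - P'.proj_V w"
        using P'.proj_V_in[of w] VV' by (auto simp: P.V_def)
      ultimately have "P'.proj_V w = 0" using neg_eq_self_imp_zero[of "P'.proj_V w"] by simp
      then show "w \<in> W'" using P'.proj_V_eq_0_iff by blast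
    qed
    then have "W = W'"
      using subspace_dim_equal[OF P.subspace_W P'.subspace_W] P.dim_W P'.dim_W by simp
    then show ?thesis by blast
  qed simp
qed

section \<open>Submanifolds\<close>

lemma vector_derivative_in_closed_subspace:
  fixes d :: "real \<Rightarrow> 'a::euclidean_space"
  assumes d: "(d has_vector_derivative e) (at 0)" "d 0 = 0"
    and L: "subspace L" "\<forall>\<^sub>F t in nhds 0. d t \<in> L"
  shows "e \<in> L"
proof (rule Lim_in_closed_set)
  show "closed L" using L(1) by (rule closed_subspace)
  have "((\<lambda>h. norm (d (0 + h) - d 0 - h *\<^sub>R e) / norm h) \<longlongrightarrow> 0) (at 0)"
    using d(1) unfolding has_vector_derivative_def has_derivative_at by blast
  then have "((\<lambda>h. norm ((1 / h) *\<^sub>R d h - e)) \<longlongrightarrow> 0) (at 0)"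
  proof (rule Lim_transform_eventually)
    have "\<forall>\<^sub>F h in at (0::real). h \<noteq> 0" by (simp add: eventually_at_filter)
    then show "\<forall>\<^sub>F h in at 0. norm (d (0 + h) - d 0 - h *\<^sub>R e) / norm h = norm ((1 / h) *\<^sub>R d h - e)"
    proof eventually_elim
      case (elim h)
      have "(1 / h) *\<^sub>R d h - e = (1 / h) *\<^sub>R (d (0 + h) - d 0 - h *\<^sub>R e)" using elim d(2) by (simp add: scaleR_diff_right)
      then show ?case by simp
    qed
  qed
  then show "((\<lambda>h. (1 / h) *\<^sub>R d h) \<longlongrightarrow> e) (at 0)"
    using tendsto_norm_zero_iff LIM_zero_iff by blast
  show "\<forall>\<^sub>F h in at 0. (1 / h) *\<^sub>R d h \<in> L"
    using L(2) unfolding eventually_nhds_conv_at by (auto elim!: eventually_mono intro: subspace_scale[OF L(1)])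
qed simp

text \<open>A straightening normalized to have identity derivative at \<open>v\<close> and to
  flatten \<open>N\<close> into its own tangent space; straightenings of several submanifolds
  through \<open>v\<close> can then be combined by projections.\<close>

lemma submanifold_chart:
  fixes N :: "'v::euclidean_space set"
  assumes N: "submanifold k V N" "v \<in> N"
  defines "T \<equiv> tangent_space N v"
  obtains \<xi> where "subspace T" "dim T + k = DIM('v)" "C1_at \<xi> v" "\<xi> v = 0" "deriv_at \<xi> v = (\<lambda>u. u)"
    "\<forall>\<^sub>F w in nhds v. w \<in> N \<longleftrightarrow> \<xi> w \<in> T"
proof -
  from bspec[OF conjunct2[OF N(1)[unfolded submanifold_def]] N(2)]
  obtain W and \<Phi> \<Psi> :: "'v \<Rightarrow> 'v" and L where *: "open W \<and> v \<in> W \<and> W \<subseteq> V \<and> open (\<Phi> ` W) \<and>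
       smooth_map_on W \<Phi> \<and> smooth_map_on (\<Phi> ` W) \<Psi> \<and> (\<forall>w\<in>W. \<Psi> (\<Phi> w) = w) \<and>
       subspace L \<and> dim L + k = DIM('v) \<and> \<Phi> ` (N \<inter> W) = \<Phi> ` W \<inter> L"
    by (elim exE) (rule that)
  then have W: "open W" "v \<in> W" "W \<subseteq> V" "open (\<Phi> ` W)"
    and sm: "smooth_map_on W \<Phi>" "smooth_map_on (\<Phi> ` W) \<Psi>" and inv: "\<And>w. w \<in> W \<Longrightarrow> \<Psi> (\<Phi> w) = w"
    and L: "subspace L" "dim L + k = DIM('v)" "\<Phi> ` (N \<inter> W) = \<Phi> ` W \<inter> L"
    by simp_all
  have C: "C1_at \<Phi> v" "C1_at \<Psi> (\<Phi> v)"
    using smooth_map_on_imp_C1_at[OF W(1) sm(1) W(2)] smooth_map_on_imp_C1_at[OF W(4) sm(2) imageI[OF W(2)]] .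
  have Wev: "\<forall>\<^sub>F w in nhds v. w \<in> W" using W(1,2) eventually_nhds by blast
  have ev: "\<forall>\<^sub>F w in nhds v. \<Psi> (\<Phi> w) = w" using Wev by eventually_elim (rule inv)
  let ?D = "deriv_at \<Phi> v" and ?E = "deriv_at \<Psi> (\<Phi> v)"
  have ED: "?E (?D u) = u" for u by (rule inj_deriv_at_inverse(1)[OF C ev])
  have lin: "linear ?D" "linear ?E" using C1_at_linear_deriv C by blast+
  have DE: "?D (?E u) = u" for u
    using eucl.linear_inverse_left[OF lin(2,1)] ED by (simp add: fun_eq_iff)
  have NL: "w \<in> N \<longleftrightarrow> \<Phi> w \<in> L" if w: "w \<in> W" for w
  proof
    assume "w \<in> N"
    then show "\<Phi> w \<in> L" using L(3) w by blast
  next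
    assume "\<Phi> w \<in> L"
    then have "\<Phi> w \<in> \<Phi> ` (N \<inter> W)" unfolding L(3) using w by simp
    then obtain w' where w': "\<Phi> w = \<Phi> w'" "w' \<in> N \<inter> W" by (rule imageE)
    have "w = w'" using inv[OF w] inv[of w'] w' by simp
    then show "w \<in> N" using w'(2) by simp
  qed
  have vL: "\<Phi> v \<in> L" using NL W(2) N(2) by blast
  have T: "T = ?E ` L"
  proof (intro equalityI subsetI)
    fix u assume "u \<in> T"
    then obtain \<gamma> where \<gamma>: "\<gamma> 0 = v" "\<forall>\<^sub>F t in nhds 0. \<gamma> t \<in> N" "(\<gamma> has_vector_derivative u) (at (0::real))"
      by (auto simp: T_def tangent_space_def)
    have "filterlim \<gamma> (nhds v) (nhds 0)"
      using has_vector_derivative_continuous[OF \<gamma>(3)] \<gamma>(1) tendsto_at_iff_tendsto_nhds[of \<gamma> 0]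
      by (simp add: isCont_def)
    then have "\<forall>\<^sub>F t in nhds 0. \<gamma> t \<in> W" using Wev eventually_compose_filterlim by blast
    with \<gamma>(2) have "\<forall>\<^sub>F t in nhds 0. \<Phi> (\<gamma> t) - \<Phi> v \<in> L"
      by eventually_elim (use NL vL subspace_diff[OF L(1)] in auto)
    moreover have "((\<lambda>t. \<Phi> (\<gamma> t) - \<Phi> v) has_vector_derivative ?D u) (at 0)"
      using has_vector_derivative_diff[OF C1_at_vector_derivative[OF C(1) \<gamma>(1,3)] has_vector_derivative_const[of "\<Phi> v"]] by simp
    ultimately have "?D u \<in> L" using vector_derivative_in_closed_subspace[OF _ _ L(1)] \<gamma>(1) by simp
    then show "u \<in> ?E ` L" using ED by (metis imageI)
  next
    fix u assume "u \<in> ?E ` L"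
    then obtain l where l: "l \<in> L" "u = ?E l" by blast
    define \<delta> where "\<delta> t = \<Phi> v + t *\<^sub>R l" for t :: real
    have d: "(\<delta> has_vector_derivative l) (at 0)" unfolding \<delta>_def by (auto intro!: derivative_eq_intros)
    have d0: "\<delta> 0 = \<Phi> v" by (simp add: \<delta>_def)
    define \<gamma> where "\<gamma> t = \<Psi> (\<delta> t)" for t
    have "(\<gamma> has_vector_derivative u) (at 0)"
      unfolding \<gamma>_def l(2) by (rule C1_at_vector_derivative[OF C(2) d0 d])
    moreover have "\<gamma> 0 = v" using inv W(2) d0 by (simp add: \<gamma>_def)
    moreover have "\<forall>\<^sub>F t in nhds 0. \<gamma> t \<in> N"
    proof -
      have "filterlim \<delta> (nhds (\<Phi> v)) (nhds 0)"
        using has_vector_derivative_continuous[OF d] d0 tendsto_at_iff_tendsto_nhds[of \<delta> 0]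
        by (simp add: isCont_def)
      moreover have "\<forall>\<^sub>F y in nhds (\<Phi> v). y \<in> \<Phi> ` W" using W eventually_nhds by blast
      ultimately have "\<forall>\<^sub>F t in nhds 0. \<delta> t \<in> \<Phi> ` W" using eventually_compose_filterlim by blast
      then show ?thesis
      proof eventually_elim
        case (elim t)
        then obtain w where w: "w \<in> W" "\<delta> t = \<Phi> w" by blast
        have "\<delta> t \<in> L" unfolding \<delta>_def using vL l(1) L(1) by (intro subspace_add subspace_scale) auto
        then show ?case using w NL inv by (simp add: \<gamma>_def)
      qed
    qed
    ultimately show "u \<in> T" unfolding T_def tangent_space_def by blast
  qed
  have sT: "subspace T" unfolding T by (rule linear_subspace_image[OF lin(2) L(1)])
  have "inj_on ?E (span L)" using DE by (metis inj_onI)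
  then have dT: "dim T + k = DIM('v)" unfolding T using eucl.dim_image_eq[OF lin(2)] L(2) by simp
  \<comment> \<open>The given flattening recentred at \<open>v\<close> and followed by the inverse
    \<open>?E\<close> of its derivative, which carries \<open>L\<close> to the tangent
    space.\<close>
  define \<xi> where "\<xi> w = ?E (\<Phi> w + (- \<Phi> v))" for w
  have C1: "C1_at (\<lambda>w. \<Phi> w + (- \<Phi> v)) v" "deriv_at (\<lambda>w. \<Phi> w + (- \<Phi> v)) v = ?D"
    using C1_at_add[OF C(1) C1_at_const, of "- \<Phi> v"] by simp_all
  have CE: "C1_at ?E y \<and> deriv_at ?E y = ?E" for y by (rule C1_at_linear[OF lin(2)])
  have "C1_at \<xi> v" unfolding \<xi>_def by (rule C1_at_compose(1)[OF C1(1)]) (use CE in blast)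
  moreover have "deriv_at \<xi> v = (\<lambda>u. u)"
  proof -
    have "deriv_at \<xi> v u = u" for u
      unfolding \<xi>_def using C1_at_compose(2)[OF C1(1) conjunct1[OF CE]] C1(2) conjunct2[OF CE] ED by simp
    then show ?thesis by blast
  qed
  moreover have "\<xi> v = 0" using linear_0[OF lin(2)] by (simp add: \<xi>_def)
  moreover have "\<forall>\<^sub>F w in nhds v. w \<in> N \<longleftrightarrow> \<xi> w \<in> T"
    using Wev
  proof eventually_elim
    case (elim w)
    have "\<xi> w \<in> T \<longleftrightarrow> \<Phi> w + (- \<Phi> v) \<in> L"
      unfolding T \<xi>_def using DE by (metis (no_types, lifting) image_iff)
    also have "\<dots> \<longleftrightarrow> \<Phi> w \<in> L"
      using subspace_add[OF L(1), of "\<Phi> w + (- \<Phi> v)" "\<Phi> v"] subspace_diff[OF L(1), of "\<Phi> w" "\<Phi> v"] vL by auto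
    finally show ?case using NL[OF elim] by simp
  qed
  ultimately show thesis using that sT dT by blast
qed

section \<open>Characteristic suborbifolds through a point\<close>

lemma in_cover_torus_iff: "z \<in> carrier (cover_torus I) \<longleftrightarrow> z \<in> (\<Pi>\<^sub>E i\<in>I. sphere 0 1)"
  by (simp add: cover_torus_def product_group_def)

text \<open>One of the finitely many closed sets has interior, and a proper subspace has
  none.\<close>

lemma finite_union_subspaces_UNIV:
  fixes C :: "'a \<Rightarrow> 'v::euclidean_space set"
  assumes "finite H" "\<And>h. h \<in> H \<Longrightarrow> subspace (C h)" "(\<Union>h\<in>H. C h) = UNIV"
  shows "\<exists>h\<in>H. C h = UNIV"
proof -
  have "\<exists>h\<in>H. interior (C h) \<noteq> {}"
    by (rule interior_finite_Union_closed[OF assms(1)]) (use assms closed_subspace in auto)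
  then obtain h where h: "h \<in> H" "interior (C h) \<noteq> {}" by blast
  have "dim (C h) = DIM('v)"
    using empty_interior_lowdim[of "C h"] h(2) dim_subset_UNIV[of "C h"] by fastforce
  then have "C h = UNIV" using dim_eq_full[of "C h"] span_eq_iff assms(2)[OF h(1)] by metis
  then show ?thesis using h(1) by blast
qed

context smooth_torus_orbifold
begin

lemma deriv_chart_act_finite_order:
  assumes c: "orbifold_chart c" and h: "h \<in> carrier (chart_group c)" and v: "v \<in> cover c" "chart_act c h v = v"
  shows "(deriv_at (chart_act c h) v ^^ order (chart_group c)) u = u"
proof -
  note f = C1_at_funpow[OF C1_chart_act[OF c h v(1)] v(2), of "order (chart_group c)"]
  have "\<forall>\<^sub>F w in nhds v. w = (chart_act c h ^^ order (chart_group c)) w"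
    using chart_act_finite_order(1)[OF c h v(1)] by eventually_elim simp
  from C1_at_cong(2)[OF C1_at_ident this] show ?thesis using f by simp
qed

text \<open>The power \<open>f ^^ N\<close> lifts the identity and so has the derivative of a chart
  group element; the exponent is therefore \<open>N\<close> times the order of that group.\<close>

lemma fixlift_torsion_finite_order:
  assumes c: "orbifold_chart c" and f: "fixlift c v s f" and s: "s ^ N = 1" "N > 0"
  obtains M where "M > 0" "s ^ M = 1" "\<And>u. (deriv_at f v ^^ M) u = u"
proof -
  have f: "is_lift c v c s f" "f v = v" "s \<in> carrier torus_group" using f by (auto simp: fixlift_def)
  note fp = C1_at_funpow[OF is_liftD(2)[OF f(1)] f(2), of N]
  have "fixlift c v 1 (f ^^ N)"
    using is_lift_funpow[OF c f, of N] fp s by (simp add: fixlift_def)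
  then obtain h where h: "h \<in> carrier (chart_group c)" "chart_act c h v = v" "deriv_at (f ^^ N) v = deriv_at (chart_act c h) v"
    using fixlift_one_jet[OF c] by metis
  let ?o = "order (chart_group c)"
  have o: "?o > 0" using chart_act_finite_order(2)[OF c h(1) is_liftD(1)[OF f(1)]] .
  have "deriv_at f v ^^ (N * ?o) = (deriv_at (chart_act c h) v) ^^ ?o"
    using fp h(3) by (simp add: funpow_mult mult.commute)
  then have "(deriv_at f v ^^ (N * ?o)) u = u" for u
    using deriv_chart_act_finite_order[OF c h(1) is_liftD(1)[OF f(1)] h(2)] by simp
  moreover have "s ^ (N * ?o) = 1" using s by (simp add: power_mult)
  ultimately show thesis using that[of "N * ?o"] o s(2) by simp
qed

end

context effective_torus_orbifold
begin

lemma torsion_fixlift_eq_one: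
  assumes "orbifold_chart c" "fixlift c v t f" "t ^ N = 1" "N > 0" "\<And>u. deriv_at f v u = u"
  shows "t = 1"
proof -
  have f: "is_lift c v c t f" "f v = v" "t \<in> carrier torus_group" using assms(2) by (auto simp: fixlift_def)
  have "deriv_at f v = (\<lambda>u. u)" using assms(5) by blast
  from torsion_trivial_jet_local[OF assms(1) f(3) assms(3,4) f(1,2) this]
  show ?thesis using torsion_eq_one[OF f(3) assms(3,4)] by blast
qed

end

section \<open>Circles and tangent spaces of the characteristic suborbifolds\<close>

locale characteristic_setup = effective_torus_orbifold A act
  for A :: "('x::t2_space, 'v::euclidean_space, 'h) ochart set" and act :: "complex ^ 'n \<Rightarrow> 'x \<Rightarrow> 'x" +
  fixes d :: nat and Mc :: "nat \<Rightarrow> 'x set" and Sc :: "nat \<Rightarrow> (complex ^ 'n) set"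
    and \<rho> :: "nat \<Rightarrow> complex \<Rightarrow> complex ^ 'n"
  assumes characteristic: "bij_betw Mc {1..d} {N. characteristic_suborbifold A act N}"
    and Mc_fixed: "\<And>i. i \<in> {1..d} \<Longrightarrow> Mc i \<subseteq> fixed_set act (Sc i)"
    and minimal: "\<And>i. i \<in> {1..d} \<Longrightarrow> minimal_lifting_covering A act (Mc i) (Sc i) (\<rho> i)"
begin

lemma Mc_characteristic: "i \<in> {1..d} \<Longrightarrow> characteristic_suborbifold A act (Mc i)"
  using bij_betw_apply[OF characteristic] by blast

lemma Mc_componentE:
  assumes "i \<in> {1..d}"
  obtains S where "circle_subgroup S" "Mc i \<in> components (fixed_set act S)"
  using Mc_characteristic[OF assms] unfolding characteristic_suborbifold_def by blast

lemma Mc_connected: "i \<in> {1..d} \<Longrightarrow> connected (Mc i)"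
  using Mc_componentE in_components_connected by metis

lemma lifting: "i \<in> {1..d} \<Longrightarrow> lifting_covering A act (Mc i) (Sc i) (\<rho> i)"
  using minimal by (simp add: minimal_lifting_covering_def)

lemma Sc_eq: "i \<in> {1..d} \<Longrightarrow> Sc i = \<rho> i ` sphere 0 1"
  and \<rho>_hom: "i \<in> {1..d} \<Longrightarrow> \<rho> i \<in> hom circle_group torus_group"
  and \<rho>_continuous: "i \<in> {1..d} \<Longrightarrow> continuous_on (sphere 0 1) (\<rho> i)"
  using lifting finite_covering_group_image unfolding lifting_covering_def by metis+

lemma Sc_closed: "i \<in> {1..d} \<Longrightarrow> closed (Sc i)"
  unfolding Sc_eq by (intro compact_imp_closed compact_continuous_image \<rho>_continuous compact_sphere)

abbreviation normal_tangent :: "('x, 'v, 'h) ochart \<Rightarrow> 'v \<Rightarrow> nat \<Rightarrow> 'v set"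
  where "normal_tangent c v i \<equiv> tangent_space (chart_preimage c (Mc i)) v"

lemma Mc_submanifold:
  "i \<in> {1..d} \<Longrightarrow> c \<in> charts A \<Longrightarrow> submanifold 2 (cover c) (chart_preimage c (Mc i))"
  using Mc_characteristic unfolding characteristic_suborbifold_def suborbifold_def by blast

text \<open>Minimality of the covering enters as faithfulness of the rotation; fixing of the tangent
  space comes from \<open>circle_lift_tangent\<close>.\<close>

lemma plane_rotation_at:
  assumes i: "i \<in> {1..d}" and g: "circle_lift c v (\<rho> i) g" and v: "proj c v \<in> Mc i"
  shows "plane_rotation (\<lambda>z. deriv_at (g z) v) (normal_tangent c v i)"
proof -
  note gD = circle_liftD[OF g]
  have vN: "v \<in> chart_preimage c (Mc i)" using gD(3) v by (simp add: chart_preimage_def)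
  have T: "subspace (normal_tangent c v i)" "dim (normal_tangent c v i) + 2 = DIM('v)"
    using submanifold_chart[OF Mc_submanifold[OF i gD(1)] vN] by metis+
  show ?thesis
  proof (rule plane_rotation.intro)
    fix z u assume "z \<in> sphere (0::complex) 1" "u \<in> normal_tangent c v i"
    then show "deriv_at (g z) v u = u"
      by (rule_tac circle_lift_tangent[OF g lifting_covering_fixes[OF lifting[OF i] Mc_fixed[OF i]]])
  next
    fix z assume "z \<in> sphere (0::complex) 1" "\<And>u. deriv_at (g z) v u = u"
    then show "z = 1" using minimal_covering_faithful[OF minimal[OF i] Mc_fixed[OF i] Mc_connected[OF i] g v] by blast
  qed (fact gD T)+
qed

text \<open>The derivative of \<open>f\<close> commutes with the rotations and has finite order, so
  on the normal plane it is the rotation by some \<open>w\<close>; fixing the tangent space as well,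
  it equals that of \<open>G\<close> at \<open>w\<close> up to the name of the lift. Hence
  \<open>s\<close> divided by \<open>\<rho> i w\<close> is torsion with a lift of trivial
  derivative, so it is 1.\<close>

lemma torsion_in_circle:
  assumes i: "i \<in> {1..d}" and g: "circle_lift c v (\<rho> i) g" and v: "proj c v \<in> Mc i"
    and f: "fixlift c v s f" and s: "s ^ N = 1" "N > 0"
    and W: "\<And>u. u \<in> normal_tangent c v i \<Longrightarrow> deriv_at f v u = u"
  shows "s \<in> Sc i"
proof -
  note gD = circle_liftD[OF g]
  interpret P: plane_rotation "\<lambda>z. deriv_at (g z) v" "normal_tangent c v i"
    by (rule plane_rotation_at[OF i g v])
  obtain M where M: "M > 0" "s ^ M = 1" "\<And>u. (deriv_at f v ^^ M) u = u"
    using fixlift_torsion_finite_order[OF gD(2) f s] by blast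
  obtain w where w: "w \<in> sphere 0 1" "\<And>u. u \<in> P.V \<Longrightarrow> deriv_at f v u = deriv_at (g w) v u"
    using P.commuting_finite_order[OF fixlift_linear[OF f] circle_lift_commute[OF g f] M(1,3)] by blast
  have eq: "deriv_at f v u = deriv_at (g w) v u" for u
    by (rule P.linear_eq_on_W_V[OF fixlift_linear[OF f] gD(9)[OF w(1)]]) (use W w P.R_fixes_W in auto)
  then have eqf: "deriv_at f v = deriv_at (g w) v" by blast
  have wM: "w ^ M = 1"
  proof (rule P.R_faithful)
    show "w ^ M \<in> sphere 0 1" using w(1) by (simp add: norm_power)
    show "deriv_at (g (w ^ M)) v u = u" for u using circle_lift_power[OF g w(1), of M] eqf M(3) by simp
  qed
  note inv = circle_lift_inverse[OF g w(1)]
  note comp = fixlift_compose[OF f gD(5)[OF inv(1)]]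
  have "deriv_at (\<lambda>x. g (inverse w) (f x)) v u = u" for u
    unfolding comp(2) eq by (rule inv(2))
  moreover have "(\<rho> i (inverse w) * s) ^ M = 1"
    using hom_circle_torusD(3,4)[OF \<rho>_hom[OF i]] inv(1) wM M(2)
    by (metis mult_1 power_inverse power_mult_distrib inverse_1)
  ultimately have "\<rho> i (inverse w) * s = 1"
    using torsion_fixlift_eq_one[OF gD(2) comp(1) _ M(1)] by blast
  then have "\<rho> i w * (\<rho> i (inverse w) * s) = \<rho> i w" by simp
  then have "s = \<rho> i w" using inv(4) by (simp add: mult.assoc[symmetric])
  then show ?thesis using Sc_eq[OF i] w(1) by blast
qed

text \<open>Links the circle in the definition of a characteristic suborbifold to the given circle \<open>Sc i\<close>.\<close>

lemma fixing_circle_subset: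
  assumes i: "i \<in> {1..d}" and S: "circle_subgroup S" "Mc i \<subseteq> fixed_set act S"
  shows "S \<subseteq> Sc i"
proof -
  obtain \<phi> where \<phi>: "\<phi> \<in> hom circle_group torus_group" "continuous_on (sphere 0 1) \<phi>" "S = \<phi> ` sphere 0 1"
    using S(1) unfolding circle_subgroup_def by blast
  obtain x where x: "x \<in> Mc i"
    using Mc_characteristic[OF i] unfolding characteristic_suborbifold_def by blast
  obtain c v where c: "c \<in> charts A" "v \<in> cover c" "proj c v = x" by (rule chart_at)
  note oc = chartsD[OF c(1)]
  have pv: "proj c v \<in> Mc i" using x c by simp
  obtain g where g: "circle_lift c v (\<rho> i) g"
    using circle_lift_exists[OF lifting[OF i] Mc_fixed[OF i] c(1,2) pv] by blast
  interpret P: plane_rotation "\<lambda>z. deriv_at (g z) v" "normal_tangent c v i"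
    by (rule plane_rotation_at[OF i g pv])
  let ?H = "{h \<in> carrier (chart_group c). chart_act c h v = v}"
  have finH: "finite ?H" using finite_chart_group[OF oc] by simp
  have tor: "\<phi> z \<in> Sc i" if z: "z \<in> sphere 0 1" "N > 0" "z ^ N = 1" for z N
  proof -
    define s where "s = \<phi> z"
    have sT: "s \<in> carrier torus_group" using hom_circle_torusD(1)[OF \<phi>(1) z(1)] by (simp add: s_def)
    have sN: "s ^ N = 1" using hom_circle_torusD(3,4)[OF \<phi>(1)] z unfolding s_def by metis
    have fixed: "act s y = y" if "y \<in> Mc i" for y
      using S(2) \<phi>(3) z(1) that unfolding fixed_set_def s_def by blast
    obtain f where f: "is_lift c v c s f" "f v = v"
      using is_lift_exists[OF c(1,1) sT c(2,2)] fixed[OF pv] by auto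
    have fl: "fixlift c v s f" using f sT by (simp add: fixlift_def)
    \<comment> \<open>Since \<open>s\<close> fixes \<open>Mc i\<close> only downstairs,
      \<open>f\<close> need not fix the preimage; along each tangent direction it agrees to first
      order with an \<open>h\<close> that may depend on \<open>u\<close>.\<close>
    have choice: "\<exists>h\<in>?H. deriv_at f v u = deriv_at (chart_act c h) v u" if u: "u \<in> normal_tangent c v i" for u
    proof -
      obtain \<gamma> where \<gamma>: "\<gamma> 0 = v" "\<forall>\<^sub>F t in nhds 0. \<gamma> t \<in> chart_preimage c (Mc i)" "(\<gamma> has_vector_derivative u) (at (0::real))"
        using u by (auto simp: tangent_space_def)
      have cont: "filterlim \<gamma> (nhds v) (nhds 0)"
        using has_vector_derivative_continuous[OF \<gamma>(3)] \<gamma>(1) tendsto_at_iff_tendsto_nhds[of \<gamma> 0]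
        by (simp add: isCont_def)
      have "\<forall>\<^sub>F t in nhds 0. f (\<gamma> t) \<in> cover c \<and> proj c (f (\<gamma> t)) = act s (proj c (\<gamma> t))"
        using is_liftD(5)[OF f(1)] cont by (rule eventually_compose_filterlim)
      with \<gamma>(2) have "\<forall>\<^sub>F t in nhds 0. \<exists>h\<in>carrier (chart_group c). f (\<gamma> t) = chart_act c h (\<gamma> t)"
      proof eventually_elim
        case (elim t)
        then have "\<gamma> t \<in> cover c" "proj c (\<gamma> t) = proj c (f (\<gamma> t))"
          using fixed by (auto simp: chart_preimage_def)
        then show ?case using proj_eq_iff[OF oc, of "\<gamma> t" "f (\<gamma> t)"] elim by blast
      qed
      from curve_finite_choice[OF finite_chart_group[OF oc] is_liftD(2)[OF f(1)] C1_chart_act[OF oc _ c(2)] \<gamma>(1,3) this]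
      show ?thesis using f(2) by auto
    qed
    define pr where "pr u = u - P.proj_V u" for u
    have lpr: "linear pr" unfolding pr_def by (intro linear_compose_sub linear_id[unfolded id_def] P.linear_proj_V)
    have linh: "linear (deriv_at (chart_act c h) v)" if "h \<in> ?H" for h
      using C1_at_linear_deriv C1_chart_act[OF oc _ c(2)] that by blast
    \<comment> \<open>To make \<open>h\<close> independent of the direction: precomposed with the
      projection \<open>pr\<close> onto the tangent space, the conditions define subspaces covering
      the whole space, so one of them is everything.\<close>
    have "\<exists>h\<in>?H. {u. deriv_at f v (pr u) = deriv_at (chart_act c h) v (pr u)} = UNIV"
    proof (rule finite_union_subspaces_UNIV[OF finH])
      show "subspace {u. deriv_at f v (pr u) = deriv_at (chart_act c h) v (pr u)}" if "h \<in> ?H" for h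
        using fixlift_linear[OF fl] linh[OF that] lpr
        by (auto simp: subspace_def linear_add linear_cmul linear_0)
      show "(\<Union>h\<in>?H. {u. deriv_at f v (pr u) = deriv_at (chart_act c h) v (pr u)}) = UNIV"
        using choice P.diff_proj_V unfolding pr_def by blast
    qed
    then obtain h where h: "h \<in> ?H" "\<And>u. deriv_at f v (pr u) = deriv_at (chart_act c h) v (pr u)" by blast
    have hW: "deriv_at f v u = deriv_at (chart_act c h) v u" if "u \<in> normal_tangent c v i" for u
      using h(2)[of u] that P.proj_V_eq_0_iff[of u] by (simp add: pr_def)
    have fh: "fixlift c v 1 (chart_act c h)" using fixlift_chart_act[OF oc c(2)] h(1) by blast
    obtain k where k: "fixlift c v (torus_inv 1) k" "\<And>u. deriv_at k v (deriv_at (chart_act c h) v u) = u"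
      "\<And>u. deriv_at (chart_act c h) v (deriv_at k v u) = u"
      using fixlift_inverse[OF c(1) fh] by blast
    have i1: "torus_inv 1 = (1 :: complex ^ 'n)" by (simp add: torus_inv_def vec_eq_iff)
    note comp = fixlift_compose[OF fl k(1)]
    have "fixlift c v s (\<lambda>w. k (f w))" using comp(1) i1 by simp
    moreover have "deriv_at (\<lambda>w. k (f w)) v u = u" if "u \<in> normal_tangent c v i" for u
      unfolding comp(2) hW[OF that] by (rule k(2))
    ultimately show ?thesis using torsion_in_circle[OF i g pv _ sN z(2)] by (simp add: s_def)
  qed
  have "\<phi> z \<in> Sc i" if z: "z \<in> sphere 0 1" for z
  proof (rule circle_closed_torsion[OF \<phi>(2) Sc_closed[OF i] _ z])
    fix w N assume "w \<in> sphere (0::complex) 1" "N > (0::nat)" "w ^ N = 1"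
    then show "\<phi> w \<in> Sc i" by (rule tor)
  qed
  then show ?thesis unfolding \<phi>(3) by (rule image_subsetI)
qed

text \<open>If the tangent spaces agree, torsion elements of circle \<open>j\<close> act trivially
  on the tangent space of \<open>Mc i\<close> and hence lie in \<open>Sc i\<close>; by density the
  whole circle does. Then \<open>Mc i\<close> is fixed by a circle of which \<open>Mc j\<close> is a
  fixed component, so \<open>Mc i \<subseteq> Mc j\<close>, and the argument is symmetric.\<close>

lemma normal_tangent_inj:
  assumes ij: "i \<in> {1..d}" "j \<in> {1..d}" and c: "c \<in> charts A" "v \<in> cover c" "proj c v \<in> Mc i" "proj c v \<in> Mc j"
    and eq: "normal_tangent c v i = normal_tangent c v j"
  shows "i = j"
proof -
  have sub: "Mc i \<subseteq> Mc j"
    if ij: "i \<in> {1..d}" "j \<in> {1..d}" and pv: "proj c v \<in> Mc i" "proj c v \<in> Mc j"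
      and eq: "normal_tangent c v i = normal_tangent c v j" for i j
  proof -
    obtain gi where gi: "circle_lift c v (\<rho> i) gi"
      using circle_lift_exists[OF lifting[OF ij(1)] Mc_fixed[OF ij(1)] c(1,2) pv(1)] by blast
    obtain gj where gj: "circle_lift c v (\<rho> j) gj"
      using circle_lift_exists[OF lifting[OF ij(2)] Mc_fixed[OF ij(2)] c(1,2) pv(2)] by blast
    interpret Pj: plane_rotation "\<lambda>z. deriv_at (gj z) v" "normal_tangent c v j"
      by (rule plane_rotation_at[OF ij(2) gj pv(2)])
    have tor: "\<rho> j z \<in> Sc i" if z: "z \<in> sphere 0 1" "N > 0" "z ^ N = 1" for z N
    proof (rule torsion_in_circle[OF ij(1) gi pv(1) circle_liftD(5)[OF gj z(1)] _ z(2)])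
      show "\<rho> j z ^ N = 1" using hom_circle_torusD(3,4)[OF \<rho>_hom[OF ij(2)]] z by metis
      show "deriv_at (gj z) v u = u" if "u \<in> normal_tangent c v i" for u
        using Pj.R_fixes_W[OF z(1)] that eq by blast
    qed
    have "\<rho> j z \<in> Sc i" if z: "z \<in> sphere 0 1" for z
    proof (rule circle_closed_torsion[OF \<rho>_continuous[OF ij(2)] Sc_closed[OF ij(1)] _ z])
      fix w N assume "w \<in> sphere (0::complex) 1" "N > (0::nat)" "w ^ N = 1"
      then show "\<rho> j w \<in> Sc i" by (rule tor)
    qed
    then have "Sc j \<subseteq> Sc i" unfolding Sc_eq[OF ij(2)] by (rule image_subsetI)
    obtain S where S: "circle_subgroup S" "Mc j \<in> components (fixed_set act S)" by (rule Mc_componentE[OF ij(2)])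
    \<comment> \<open>\<open>Mc j\<close> is known to be a component of the fixed set of
      \<open>S\<close>, not of \<open>Sc j\<close>; the inclusions
      \<open>S \<subseteq> Sc j \<subseteq> Sc i\<close> bridge the gap.\<close>
    have "S \<subseteq> Sc j" by (rule fixing_circle_subset[OF ij(2) S(1) in_components_subset[OF S(2)]])
    then have "Mc i \<subseteq> fixed_set act S"
      using Mc_fixed[OF ij(1)] \<open>Sc j \<subseteq> Sc i\<close> unfolding fixed_set_def by blast
    then show ?thesis using components_maximal[OF S(2) Mc_connected[OF ij(1)]] pv by blast
  qed
  have "Mc i = Mc j" using sub[OF ij c(3,4) eq] sub[OF ij(2,1) c(4,3) eq[symmetric]] by blast
  then show ?thesis using characteristic ij unfolding bij_betw_def by (auto dest: inj_onD)
qed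

end

section \<open>The isotropy group\<close>

locale reduced_setup = characteristic_setup A act d Mc Sc \<rho>
  for A :: "('x::t2_space, 'v::euclidean_space, 'h) ochart set" and act :: "complex ^ 'n \<Rightarrow> 'x \<Rightarrow> 'x"
    and d Mc Sc and \<rho> :: "nat \<Rightarrow> complex \<Rightarrow> complex ^ 'n" +
  fixes I :: "nat set" and c :: "('x, 'v, 'h) ochart" and v :: 'v
  assumes I: "I \<subseteq> {1..d}" and cA: "c \<in> charts A" and v: "v \<in> cover c"
    and stab: "\<And>h. h \<in> carrier (chart_group c) \<Longrightarrow> chart_act c h v = v"
    and vI: "\<And>i. i \<in> I \<Longrightarrow> proj c v \<in> Mc i"
    and principal: "multiplicity A (proj c v) = (INF y \<in> connected_component_set (M_inter Mc I) (proj c v). multiplicity A y)"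
begin

lemma oc: "orbifold_chart c" by (rule chartsD[OF cA])

lemma I_range: "i \<in> I \<Longrightarrow> i \<in> {1..d}" using I by (rule subsetD)

lemma finite_I: "finite I" using I finite_subset by blast

definition G where "G i = (SOME g. circle_lift c v (\<rho> i) g)"

abbreviation R where "R i z \<equiv> deriv_at (G i z) v"
abbreviation W where "W i \<equiv> normal_tangent c v i"
abbreviation V where "V i \<equiv> plane_rotation.V (\<lambda>z. R i z)"
abbreviation pV where "pV i \<equiv> plane_rotation.proj_V (\<lambda>z. R i z)"
abbreviation D where "D h \<equiv> deriv_at (chart_act c h) v"

lemma G:
  assumes "i \<in> I" shows "circle_lift c v (\<rho> i) (G i)"
  unfolding G_def
  by (rule someI_ex[OF circle_lift_exists[OF lifting[OF I_range[OF assms]] Mc_fixed[OF I_range[OF assms]] cA v vI[OF assms]]])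

lemma rot: "i \<in> I \<Longrightarrow> plane_rotation (\<lambda>z. R i z) (W i)"
  by (rule plane_rotation_at[OF I_range G vI])

text \<open>The other alternative of the dichotomy, equal tangent spaces, is excluded by
  \<open>normal_tangent_inj\<close>.\<close>

lemma V_sub_W:
  assumes ij: "i \<in> I" "j \<in> I" "i \<noteq> j" shows "V i \<subseteq> W j"
proof -
  have "R i z (R j w u) = R j w (R i z u)" if "z \<in> sphere 0 1" "w \<in> sphere 0 1" for z w u
    using circle_lift_commute[OF G[OF ij(2)] circle_liftD(5)[OF G[OF ij(1)] that(1)] that(2)] .
  then have "V i \<subseteq> W j \<or> W i = W j" by (rule plane_rotation_dichotomy[OF rot[OF ij(1)] rot[OF ij(2)]])
  then show ?thesis
    using normal_tangent_inj[OF I_range[OF ij(1)] I_range[OF ij(2)] cA v vI[OF ij(1)] vI[OF ij(2)]] ij(3) by blast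
qed

lemma fixlift_h: "h \<in> carrier (chart_group c) \<Longrightarrow> fixlift c v 1 (chart_act c h)"
  using fixlift_chart_act[OF oc v _ stab] .

lemma linear_D: "h \<in> carrier (chart_group c) \<Longrightarrow> linear (D h)"
  using fixlift_linear[OF fixlift_h] .

lemma linear_pV: "i \<in> I \<Longrightarrow> linear (pV i)"
  using plane_rotation.linear_proj_V[OF rot] .

lemma pV_in: "i \<in> I \<Longrightarrow> pV i u \<in> V i"
  using plane_rotation.proj_V_in[OF rot] .

lemma pV_pV: "i \<in> I \<Longrightarrow> j \<in> I \<Longrightarrow> pV j (pV i u) = (if i = j then pV i u else 0)"
proof (cases "i = j")
  case False
  assume i: "i \<in> I" and j: "j \<in> I"
  have "pV i u \<in> W j" using V_sub_W[OF i j False] pV_in[OF i] by (rule subsetD)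
  then show ?thesis using plane_rotation.proj_V_eq_0_iff[OF rot[OF j]] False by simp
qed (simp add: plane_rotation.proj_V_id[OF rot pV_in])

text \<open>The projection onto the intersection of the \<open>W i\<close> along the planes
  \<open>V i\<close>; it completes the mutually annihilating \<open>pV i\<close> to a decomposition
  of the identity.\<close>

definition p0 where "p0 u = u - (\<Sum>i\<in>I. pV i u)"

lemma linear_p0: "linear p0"
  unfolding p0_def by (intro linear_compose_sub linear_id[unfolded id_def] linear_compose_sum ballI linear_pV)

lemma pV_sum: "j \<in> I \<Longrightarrow> pV j (\<Sum>i\<in>I. pV i (a i)) = pV j (a j)"
  using linear_sum[OF linear_pV, of j "\<lambda>i. pV i (a i)" I] by (simp add: pV_pV finite_I sum.delta)

lemma pV_p0: "j \<in> I \<Longrightarrow> pV j (p0 u) = 0"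
  unfolding p0_def using linear_diff[OF linear_pV] pV_sum[of j "\<lambda>_. u"] by simp

lemma p0_in: "p0 u \<in> (\<Inter>i\<in>I. W i)"
  using pV_p0 plane_rotation.proj_V_eq_0_iff[OF rot] by blast

lemma linear_eq_decomp:
  fixes L M :: "'v \<Rightarrow> 'v"
  assumes "linear L" "linear M" "\<And>u. u \<in> (\<Inter>i\<in>I. W i) \<Longrightarrow> L u = M u" "\<And>i u. i \<in> I \<Longrightarrow> u \<in> V i \<Longrightarrow> L u = M u"
  shows "L u = M u"
proof -
  have u: "p0 u + (\<Sum>i\<in>I. pV i u) = u" by (simp add: p0_def)
  have K: "K u = K (p0 u) + (\<Sum>i\<in>I. K (pV i u))" if "linear K" for K :: "'v \<Rightarrow> 'v"
    using linear_add[OF that, of "p0 u" "\<Sum>i\<in>I. pV i u"] linear_sum[OF that, of "\<lambda>i. pV i u" I] u by simp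
  have "(\<Sum>i\<in>I. L (pV i u)) = (\<Sum>i\<in>I. M (pV i u))"
    by (rule sum.cong[OF refl assms(4)[OF _ pV_in]])
  then show ?thesis unfolding K[OF assms(1)] K[OF assms(2)] assms(3)[OF p0_in] by simp
qed

lemma stabilizer_v: "stabilizer (chart_group c) (chart_act c) v = carrier (chart_group c)"
  using stab by (auto simp: stabilizer_def)

text \<open>Near \<open>v\<close> the preimage of the intersection of the \<open>Mc i\<close> is a connected submanifold with tangent
  space the intersection of the \<open>W i\<close>. By minimality of the multiplicity at \<open>v\<close> the whole group
  fixes it pointwise.\<close>

lemma group_fixes_tangent:
  assumes h: "h \<in> carrier (chart_group c)" and u: "u \<in> (\<Inter>i\<in>I. W i)"
  shows "D h u = u"
proof -
  let ?WI = "\<Inter>i\<in>I. W i"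
  have "\<exists>\<xi>. C1_at \<xi> v \<and> \<xi> v = 0 \<and> deriv_at \<xi> v = (\<lambda>u. u) \<and>
      (\<forall>\<^sub>F w in nhds v. w \<in> chart_preimage c (Mc i) \<longleftrightarrow> \<xi> w \<in> W i)" if i: "i \<in> I" for i
  proof -
    have vN: "v \<in> chart_preimage c (Mc i)" using v vI[OF i] by (simp add: chart_preimage_def)
    have sm: "submanifold 2 (cover c) (chart_preimage c (Mc i))" using Mc_submanifold[OF I_range[OF i] cA] .
    show ?thesis by (rule submanifold_chart[OF sm vN]) blast
  qed
  then have "\<forall>i\<in>I. \<exists>\<xi>. C1_at \<xi> v \<and> \<xi> v = 0 \<and> deriv_at \<xi> v = (\<lambda>u. u) \<and>
      (\<forall>\<^sub>F w in nhds v. w \<in> chart_preimage c (Mc i) \<longleftrightarrow> \<xi> w \<in> W i)" ..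
  from bchoice[OF this] obtain \<xi> where "\<forall>i\<in>I. C1_at (\<xi> i) v \<and> \<xi> i v = 0 \<and> deriv_at (\<xi> i) v = (\<lambda>u. u) \<and>
      (\<forall>\<^sub>F w in nhds v. w \<in> chart_preimage c (Mc i) \<longleftrightarrow> \<xi> i w \<in> W i)" by (elim exE)
  then have \<xi>: "\<And>i. i \<in> I \<Longrightarrow> C1_at (\<xi> i) v" "\<And>i. i \<in> I \<Longrightarrow> \<xi> i v = 0"
    "\<And>i. i \<in> I \<Longrightarrow> deriv_at (\<xi> i) v = (\<lambda>u. u)"
    "\<And>i. i \<in> I \<Longrightarrow> \<forall>\<^sub>F w in nhds v. w \<in> chart_preimage c (Mc i) \<longleftrightarrow> \<xi> i w \<in> W i"
    by simp_all
  \<comment> \<open>Simultaneous straightening: the component of \<open>F w\<close> in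
    \<open>V i\<close> is taken from \<open>\<xi> i w\<close>, the rest from \<open>w - v\<close>.
    The projections sum to the identity, so the derivative at \<open>v\<close> is the identity, and
    \<open>F w\<close> lies in the intersection exactly when each \<open>\<xi> i w\<close> lies in
    \<open>W i\<close>.\<close>
  define F where "F w = (\<Sum>i\<in>I. pV i (\<xi> i w)) + p0 (w + (- v))" for w
  have Cp: "C1_at (\<lambda>w. pV i (\<xi> i w)) v" "deriv_at (\<lambda>w. pV i (\<xi> i w)) v = pV i" if i: "i \<in> I" for i
    using C1_at_compose[OF \<xi>(1)[OF i], of "pV i"] C1_at_linear[OF linear_pV[OF i]] \<xi>(3)[OF i] by simp_all
  have Cs: "C1_at (\<lambda>w. \<Sum>i\<in>I. pV i (\<xi> i w)) v \<and>
      deriv_at (\<lambda>w. \<Sum>i\<in>I. pV i (\<xi> i w)) v = (\<lambda>u. \<Sum>i\<in>I. pV i u)"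
    using C1_at_sum[OF finite_I, of "\<lambda>i w. pV i (\<xi> i w)" v] Cp by simp
  have Ct: "C1_at (\<lambda>w. w + (- v)) v" "deriv_at (\<lambda>w. w + (- v)) v = (\<lambda>u. u)"
    using C1_at_add[OF C1_at_ident C1_at_const, of "- v" v] by simp_all
  have C0: "C1_at (\<lambda>w. p0 (w + (- v))) v" "deriv_at (\<lambda>w. p0 (w + (- v))) v = p0"
    using C1_at_compose[OF Ct(1), of p0] C1_at_linear[OF linear_p0] Ct(2) by simp_all
  have F: "C1_at F v" "deriv_at F v = (\<lambda>u. u)" "F v = 0"
  proof -
    show "C1_at F v" unfolding F_def by (rule C1_at_add(1)) (use Cs C0 in auto)
    have "deriv_at F v u = u" for u
      unfolding F_def using C1_at_add(2)[of "\<lambda>w. \<Sum>i\<in>I. pV i (\<xi> i w)" v "\<lambda>w. p0 (w + (- v))"] Cs C0 by (simp add: p0_def)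
    then show "deriv_at F v = (\<lambda>u. u)" by blast
    show "F v = 0" using \<xi>(2) linear_0[OF linear_pV] linear_0[OF linear_p0] by (simp add: F_def)
  qed
  obtain g U V' where U: "open U" "v \<in> U" "open V'" "0 \<in> V'" "homeomorphism U V' F g" "C1_at g 0"
    "\<And>u. deriv_at g 0 u = u"
    using C1_at_inverse[OF F(1)] F(2,3) by (metis injI)
  have g0: "g 0 = v" using homeomorphism_apply1[OF U(5,2)] F(3) by simp
  have inN: "w \<in> chart_preimage c (Mc j)" if "j \<in> I" "F w \<in> ?WI" "w \<in> chart_preimage c (Mc j) \<longleftrightarrow> \<xi> j w \<in> W j" for j w
  proof -
    have "pV j (F w) = pV j (\<xi> j w)"
      unfolding F_def using linear_add[OF linear_pV[OF that(1)]] pV_sum[OF that(1), of "\<lambda>i. \<xi> i w"] pV_p0[OF that(1)] by simp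
    moreover have "pV j (F w) = 0" using that plane_rotation.proj_V_eq_0_iff[OF rot[OF that(1)]] by blast
    ultimately show ?thesis using that(1,3) plane_rotation.proj_V_eq_0_iff[OF rot[OF that(1)]] by simp
  qed
  have "\<forall>\<^sub>F w in nhds v. \<forall>i\<in>I. w \<in> chart_preimage c (Mc i) \<longleftrightarrow> \<xi> i w \<in> W i"
    by (intro eventually_ball_finite[OF finite_I] ballI \<xi>(4))
  then have "\<forall>\<^sub>F y in nhds 0. \<forall>i\<in>I. g y \<in> chart_preimage c (Mc i) \<longleftrightarrow> \<xi> i (g y) \<in> W i"
    using C1_at_eventually_compose[OF U(6)] g0 by simp
  moreover have "\<forall>\<^sub>F y in nhds 0. g y \<in> cover c"
    using C1_at_eventually_compose[OF U(6)] g0 eventually_cover[OF oc v] by simp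
  moreover have "\<forall>\<^sub>F y in nhds 0. y \<in> V'" using U(3,4) eventually_nhds by blast
  ultimately have "\<forall>\<^sub>F y in nhds 0. (\<forall>i\<in>I. g y \<in> chart_preimage c (Mc i) \<longleftrightarrow> \<xi> i (g y) \<in> W i) \<and> g y \<in> cover c \<and> y \<in> V'"
    by eventually_elim simp
  then obtain e where e: "e > 0" and eb: "\<And>y. dist y 0 < e \<Longrightarrow>
      (\<forall>i\<in>I. g y \<in> chart_preimage c (Mc i) \<longleftrightarrow> \<xi> i (g y) \<in> W i) \<and> g y \<in> cover c \<and> y \<in> V'"
    unfolding eventually_nhds_metric by blast
  \<comment> \<open>A convex slice: its image is connected, contains the base point and lies in
    \<open>M_inter Mc I\<close>, hence in the component over which the multiplicity at
    \<open>v\<close> is minimal.\<close>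
  define B where "B = ball 0 e \<inter> ?WI"
  have gB: "g y \<in> cover c" "i \<in> I \<Longrightarrow> g y \<in> chart_preimage c (Mc i)" if y: "y \<in> B" for y i
  proof -
    have y': "dist y 0 < e" "y \<in> ?WI" using y by (auto simp: B_def)
    show "g y \<in> cover c" using eb[OF y'(1)] by blast
    have Fgy: "F (g y) = y" using homeomorphism_apply2[OF U(5)] eb[OF y'(1)] by blast
    show "g y \<in> chart_preimage c (Mc i)" if i: "i \<in> I"
    proof (rule inN[OF i])
      show "F (g y) \<in> ?WI" unfolding Fgy by (rule y'(2))
      show "g y \<in> chart_preimage c (Mc i) \<longleftrightarrow> \<xi> i (g y) \<in> W i" using eb[OF y'(1)] i by blast
    qed
  qed
  have sWI: "subspace ?WI" using subspace_Inter[of "W ` I"] plane_rotation.subspace_W[OF rot] by blast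
  have convB: "convex B" unfolding B_def by (intro convex_Int convex_ball subspace_imp_convex sWI)
  have zB: "0 \<in> B" unfolding B_def using e subspace_0[OF sWI] by simp
  have "continuous_on B g"
    using eb by (intro continuous_on_subset[OF homeomorphism_cont2[OF U(5)]]) (auto simp: B_def)
  then have "continuous_on B (\<lambda>y. proj c (g y))"
    using gB(1) by (intro continuous_on_compose2[OF continuous_on_proj[OF oc]]) auto
  then have conn: "connected ((\<lambda>y. proj c (g y)) ` B)"
    using connected_continuous_image convex_connected[OF convB] by blast
  have MI: "(\<lambda>y. proj c (g y)) ` B \<subseteq> M_inter Mc I"
    using gB(2) by (auto simp: M_inter_def chart_preimage_def)
  have comp: "proj c (g y) \<in> connected_component_set (M_inter Mc I) (proj c v)" if "y \<in> B" for y
    using connected_component_maximal[OF _ conn MI, of "proj c v"] that zB g0 by force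
  have fixB: "chart_act c h (g y) = g y" if y: "y \<in> B" for y
  proof -
    \<comment> \<open>The stabilizer of \<open>v\<close> is the whole finite group, so minimality
      forces the stabilizer of \<open>g y\<close>, a subset of it, to be everything.\<close>
    have "multiplicity A (proj c v) \<le> multiplicity A (proj c (g y))"
      unfolding principal by (rule cINF_lower[OF _ comp[OF y]]) simp
    then have "card (carrier (chart_group c)) \<le> card (stabilizer (chart_group c) (chart_act c) (g y))"
      using multiplicity_eq[OF orb cA v] multiplicity_eq[OF orb cA gB(1)[OF y]] stabilizer_v by simp
    then have "stabilizer (chart_group c) (chart_act c) (g y) = carrier (chart_group c)"
      using card_seteq[OF finite_chart_group[OF oc]] by (auto simp: stabilizer_def)
    then show ?thesis using h by (auto simp: stabilizer_def)
  qed
  define \<delta> where "\<delta> t = t *\<^sub>R u" for t :: real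
  have \<delta>: "\<delta> 0 = 0" "(\<delta> has_vector_derivative u) (at 0)" unfolding \<delta>_def by (auto intro!: derivative_eq_intros)
  define \<gamma> where "\<gamma> t = g (\<delta> t)" for t
  have \<gamma>: "\<gamma> 0 = v" "(\<gamma> has_vector_derivative u) (at 0)"
    using C1_at_vector_derivative[OF U(6) \<delta>] U(7) g0 \<delta>(1) by (simp_all add: \<gamma>_def[abs_def])
  have "\<forall>\<^sub>F t in nhds 0. dist (\<delta> t) 0 < e"
  proof -
    have "filterlim \<delta> (nhds 0) (nhds 0)"
      using has_vector_derivative_continuous[OF \<delta>(2)] \<delta>(1) tendsto_at_iff_tendsto_nhds[of \<delta> 0]
      by (simp add: isCont_def)
    then show ?thesis using e by (rule tendstoD)
  qed
  then have "\<forall>\<^sub>F t in nhds 0. \<exists>k\<in>{()}. chart_act c h (\<gamma> t) = \<gamma> t"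
  proof eventually_elim
    case (elim t)
    have "\<delta> t \<in> ?WI" unfolding \<delta>_def using u by (rule subspace_scale[OF sWI])
    then have "\<delta> t \<in> B" using elim by (simp add: B_def dist_commute)
    then show ?case using fixB by (simp add: \<gamma>_def)
  qed
  from curve_finite_choice[OF _ C1_chart_act[OF oc h v] C1_at_ident \<gamma> this]
  show ?thesis by simp
qed

section \<open>The correspondence between the chart group and the kernel\<close>

definition rel :: "'h \<Rightarrow> (nat \<Rightarrow> complex) \<Rightarrow> bool"
  where "rel h z \<longleftrightarrow> h \<in> carrier (chart_group c) \<and> z \<in> (\<Pi>\<^sub>E i\<in>I. sphere 0 1) \<and>
    (\<forall>i\<in>I. \<forall>u\<in>V i. D h u = R i (z i) u)"

lemma R_V: "i \<in> I \<Longrightarrow> z \<in> sphere 0 1 \<Longrightarrow> u \<in> V i \<Longrightarrow> R i z u \<in> V i"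
  by (rule plane_rotation.commuting_preserves_V[OF rot plane_rotation.linear_R[OF rot]])
     (auto intro!: plane_rotation.R_commute[OF rot])

lemma R_diff_V: "i \<in> I \<Longrightarrow> z \<in> sphere 0 1 \<Longrightarrow> R i z u - u \<in> V i"
proof -
  assume i: "i \<in> I" and z: "z \<in> sphere 0 1"
  let ?w = "u - pV i u"
  have "R i z ?w = ?w" using plane_rotation.R_fixes_W[OF rot[OF i] z plane_rotation.diff_proj_V[OF rot[OF i]]] .
  then have "R i z u - u = R i z (pV i u) - pV i u"
    using linear_diff[OF plane_rotation.linear_R[OF rot[OF i] z], of u "pV i u"] by (simp add: algebra_simps)
  then show ?thesis
    using subspace_diff[OF plane_rotation.subspace_V[OF rot[OF i]] R_V[OF i z pV_in[OF i]] pV_in[OF i]] by simp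
qed

text \<open>The derivative of the composite is additive in the deviations
  \<open>R i (z i) u - u\<close>: each lies in \<open>V i\<close>, which is contained in
  \<open>W j\<close> for \<open>j \<noteq> i\<close> and so is untouched by the other
  rotations.\<close>

lemma product_lift:
  assumes "F \<subseteq> I" and z: "\<And>i. i \<in> F \<Longrightarrow> z i \<in> sphere 0 1"
  shows "\<exists>f. fixlift c v (finprod torus_group (\<lambda>i. \<rho> i (z i)) F) f \<and>
    (\<forall>u. deriv_at f v u = u + (\<Sum>i\<in>F. R i (z i) u - u))"
proof -
  interpret T: comm_group "torus_group :: (complex ^ 'n) monoid" by (rule comm_group_torus)
  have "finite F" using assms(1) finite_I finite_subset by blast
  then show ?thesis using assms
  proof (induction F)
    case empty
    have "fixlift c v 1 (\<lambda>w. w)" using is_lift_id[OF oc v] by (simp add: fixlift_def)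
    then show ?case by (intro exI[of _ "\<lambda>w. w"]) simp
  next
    case (insert i F)
    then obtain f where f: "fixlift c v (finprod torus_group (\<lambda>i. \<rho> i (z i)) F) f"
      "\<And>u. deriv_at f v u = u + (\<Sum>i\<in>F. R i (z i) u - u)" by auto
    have i: "i \<in> I" "z i \<in> sphere 0 1" using insert.prems by auto
    note g = circle_liftD(5)[OF G[OF i(1)] i(2)] and lin = circle_liftD(9)[OF G[OF i(1)] i(2)]
    have cl: "\<rho> j (z j) \<in> carrier torus_group" if j: "j \<in> insert i F" for j
      by (rule hom_circle_torusD(1)[OF \<rho>_hom[OF I_range[OF subsetD[OF insert.prems(1) j]]] insert.prems(2)[OF j]])
    have fp: "finprod torus_group (\<lambda>i. \<rho> i (z i)) (insert i F) = \<rho> i (z i) * finprod torus_group (\<lambda>i. \<rho> i (z i)) F"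
      using T.finprod_insert[OF insert.hyps, of "\<lambda>i. \<rho> i (z i)"] cl by auto
    note comp = fixlift_compose[OF f(1) g]
    have fix_j: "R i (z i) (R j (z j) u - u) = R j (z j) u - u" if j: "j \<in> F" for j u
    proof -
      have "j \<in> I" "j \<noteq> i" "z j \<in> sphere 0 1" using j insert by auto
      then have "R j (z j) u - u \<in> W i" using R_diff_V V_sub_W[OF _ i(1)] by blast
      then show ?thesis by (rule plane_rotation.R_fixes_W[OF rot[OF i(1)] i(2)])
    qed
    have "deriv_at (\<lambda>w. G i (z i) (f w)) v u = u + (\<Sum>i\<in>insert i F. R i (z i) u - u)" for u
    proof -
      have "deriv_at (\<lambda>w. G i (z i) (f w)) v u = R i (z i) u + (\<Sum>j\<in>F. R i (z i) (R j (z j) u - u))"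
        unfolding comp(2) f(2) by (simp only: linear_add[OF lin] linear_sum[OF lin])
      also have "(\<Sum>j\<in>F. R i (z i) (R j (z j) u - u)) = (\<Sum>j\<in>F. R j (z j) u - u)"
        by (rule sum.cong[OF refl fix_j])
      finally show ?thesis using insert.hyps by simp
    qed
    then show ?case using comp(1) fp by (intro exI[of _ "\<lambda>w. G i (z i) (f w)"]) simp
  qed
qed

text \<open>Supplies the torsion hypothesis of \<open>torsion_fixlift_eq_one\<close>, without which
  a trivial derivative says nothing about the torus element.\<close>

lemma finprod_torsion:
  assumes "F \<subseteq> I" "\<And>i. i \<in> F \<Longrightarrow> z i \<in> sphere 0 1" "\<And>i. i \<in> F \<Longrightarrow> z i ^ M = 1"
  shows "finprod torus_group (\<lambda>i. \<rho> i (z i)) F ^ M = 1"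
proof -
  interpret T: comm_group "torus_group :: (complex ^ 'n) monoid" by (rule comm_group_torus)
  have "finite F" using assms(1) finite_I finite_subset by blast
  then show ?thesis using assms
  proof (induction F)
    case (insert i F)
    have cl: "\<rho> j (z j) \<in> carrier torus_group" if j: "j \<in> insert i F" for j
      by (rule hom_circle_torusD(1)[OF \<rho>_hom[OF I_range[OF subsetD[OF insert.prems(1) j]]] insert.prems(2)[OF j]])
    have fp: "finprod torus_group (\<lambda>i. \<rho> i (z i)) (insert i F) = \<rho> i (z i) * finprod torus_group (\<lambda>i. \<rho> i (z i)) F"
      using T.finprod_insert[OF insert.hyps, of "\<lambda>i. \<rho> i (z i)"] cl by auto
    have i: "i \<in> {1..d}" "z i \<in> sphere 0 1" "z i ^ M = 1" using insert.prems I by auto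
    have "\<rho> i (z i) ^ M = 1" using hom_circle_torusD(3,4)[OF \<rho>_hom[OF i(1)]] i by metis
    then show ?case using fp insert by (simp add: power_mult_distrib)
  qed simp
qed

lemma product_deriv:
  assumes "fixlift c v t f" and f: "\<And>u. deriv_at f v u = u + (\<Sum>i\<in>I. R i (z i) u - u)"
    and z: "\<And>i. i \<in> I \<Longrightarrow> z i \<in> sphere 0 1"
  shows "linear (deriv_at f v)" "u \<in> (\<Inter>i\<in>I. W i) \<Longrightarrow> deriv_at f v u = u"
    "j \<in> I \<Longrightarrow> u \<in> V j \<Longrightarrow> deriv_at f v u = R j (z j) u"
proof -
  show "linear (deriv_at f v)" using fixlift_linear[OF assms(1)] .
  show "deriv_at f v u = u" if "u \<in> (\<Inter>i\<in>I. W i)"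
    unfolding f using plane_rotation.R_fixes_W[OF rot z] that by (simp add: sum.neutral)
  show "deriv_at f v u = R j (z j) u" if j: "j \<in> I" "u \<in> V j"
  proof -
    have "R i (z i) u - u = (if i = j then R j (z j) u - u else 0)" if i: "i \<in> I" for i
      using plane_rotation.R_fixes_W[OF rot[OF i] z[OF i]] V_sub_W[OF j(1) i] j(2) by auto
    then have "(\<Sum>i\<in>I. R i (z i) u - u) = (\<Sum>i\<in>I. if i = j then R j (z j) u - u else 0)" by (rule sum.cong[OF refl])
    then show ?thesis unfolding f using j(1) finite_I by simp
  qed
qed

lemma rel_exists:
  assumes h: "h \<in> carrier (chart_group c)" shows "\<exists>z. rel h z"
proof -
  have "\<exists>z. z \<in> sphere 0 1 \<and> (\<forall>u\<in>V i. D h u = R i z u)" if i: "i \<in> I" for i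
  proof -
    obtain z where "z \<in> sphere 0 1" "\<And>u. u \<in> V i \<Longrightarrow> D h u = R i z u"
      using plane_rotation.commuting_finite_order[OF rot[OF i] linear_D[OF h] circle_lift_commute[OF G[OF i] fixlift_h[OF h]]
          chart_act_finite_order(2)[OF oc h v] deriv_chart_act_finite_order[OF oc h v stab[OF h]]] by blast
    then show ?thesis by blast
  qed
  then obtain z where "\<And>i. i \<in> I \<Longrightarrow> z i \<in> sphere 0 1 \<and> (\<forall>u\<in>V i. D h u = R i (z i) u)" by metis
  then have "rel h (restrict z I)" using h by (simp add: rel_def)
  then show ?thesis by blast
qed

lemma rel_unique_right: "rel h z \<Longrightarrow> rel h z' \<Longrightarrow> z = z'"
proof -
  assume z: "rel h z" "rel h z'"
  have "z i = z' i" if i: "i \<in> I" for i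
    by (rule plane_rotation.R_eq_on_V[OF rot[OF i]]) (use z i in \<open>auto simp: rel_def\<close>)
  then show "z = z'" using z unfolding rel_def by (intro PiE_ext[of z I _ z']) auto
qed

lemma D_mult:
  assumes h: "h \<in> carrier (chart_group c)" "h' \<in> carrier (chart_group c)"
  shows "D (h \<otimes>\<^bsub>chart_group c\<^esub> h') u = D h (D h' u)"
proof -
  note comp = fixlift_compose[OF fixlift_h[OF h(2)] fixlift_h[OF h(1)]]
  have C: "C1_at (\<lambda>w. chart_act c h (chart_act c h' w)) v"
    using comp(1) is_liftD(2) unfolding fixlift_def by blast
  have "\<forall>\<^sub>F w in nhds v. chart_act c h (chart_act c h' w) = chart_act c (h \<otimes>\<^bsub>chart_group c\<^esub> h') w"
    using eventually_cover[OF oc v] by eventually_elim (use chart_act_mult[OF oc h] in auto)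
  from C1_at_cong(2)[OF C this] show ?thesis unfolding comp(2)[symmetric] by simp
qed

text \<open>Both elements fix the intersection of the \<open>W i\<close> and rotate each
  \<open>V i\<close> alike, so their quotient has trivial derivative and is the unit by
  effectivity.\<close>

lemma rel_unique_left: "rel h z \<Longrightarrow> rel h' z \<Longrightarrow> h = h'"
proof -
  assume r: "rel h z" "rel h' z"
  have h: "h \<in> carrier (chart_group c)" "h' \<in> carrier (chart_group c)" using r by (auto simp: rel_def)
  let ?k = "inv\<^bsub>chart_group c\<^esub> h'"
  have k: "?k \<in> carrier (chart_group c)" using chart_inv_closed[OF oc h(2)] .
  have eq: "D h u = D h' u" for u
    by (rule linear_eq_decomp[OF linear_D[OF h(1)] linear_D[OF h(2)]])
       (use group_fixes_tangent h r in \<open>auto simp: rel_def\<close>)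
  have kh: "?k \<otimes>\<^bsub>chart_group c\<^esub> h \<in> carrier (chart_group c)" using chart_mult_closed[OF oc k h(1)] .
  have "D (?k \<otimes>\<^bsub>chart_group c\<^esub> h) u = u" for u
    unfolding D_mult[OF k h(1)] eq using deriv_chart_act_inv[OF oc h(2) v, of u] unfolding stab[OF h(2)] .
  then have "deriv_at (chart_act c (?k \<otimes>\<^bsub>chart_group c\<^esub> h)) v = (\<lambda>u. u)" by blast
  then have "?k \<otimes>\<^bsub>chart_group c\<^esub> h = \<one>\<^bsub>chart_group c\<^esub>"
    using chart_act_effective[OF cA v kh stab[OF kh]] by blast
  then show "h = h'"
    using group.inv_equality[OF chart_group_group[OF oc] _ h(1) k] group.inv_inv[OF chart_group_group[OF oc] h(1)]
      group.inv_inv[OF chart_group_group[OF oc] h(2)] by metis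
qed

lemma rel_mult:
  assumes "rel h z" "rel h' z'"
  shows "rel (h \<otimes>\<^bsub>chart_group c\<^esub> h') (\<lambda>i\<in>I. z i * z' i)"
proof -
  have h: "h \<in> carrier (chart_group c)" "h' \<in> carrier (chart_group c)"
    and z: "\<And>i. i \<in> I \<Longrightarrow> z i \<in> sphere 0 1" "\<And>i. i \<in> I \<Longrightarrow> z' i \<in> sphere 0 1"
    using assms by (auto simp: rel_def)
  have hh: "h \<otimes>\<^bsub>chart_group c\<^esub> h' \<in> carrier (chart_group c)" using chart_mult_closed[OF oc h] .
  have "D (h \<otimes>\<^bsub>chart_group c\<^esub> h') u = R i (z i * z' i) u" if i: "i \<in> I" "u \<in> V i" for i u
  proof -
    have "D h' u = R i (z' i) u" "R i (z' i) u \<in> V i" using assms(2) i R_V[OF i(1) z(2)[OF i(1)] i(2)] by (auto simp: rel_def)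
    then show ?thesis
      using D_mult[OF h, of u] assms(1) i(1) circle_liftD(6)[OF G[OF i(1)] z(1)[OF i(1)] z(2)[OF i(1)]] by (auto simp: rel_def)
  qed
  then show ?thesis using hh z by (auto simp: rel_def norm_mult)
qed

text \<open>The product lift of \<open>z\<close> has the same derivative as \<open>h\<close>;
  divided by \<open>h\<close> it still lifts the same torus element but has trivial derivative. The
  finite order of \<open>h\<close> makes every \<open>z i\<close> a root of unity, so that element
  is torsion and therefore 1.\<close>

lemma rel_kernel: 
  assumes r: "rel h z" shows "finprod torus_group (\<lambda>i. \<rho> i (z i)) I = 1"
proof -
  have h: "h \<in> carrier (chart_group c)" and z: "\<And>i. i \<in> I \<Longrightarrow> z i \<in> sphere 0 1"
    using r by (auto simp: rel_def)
  let ?t = "finprod torus_group (\<lambda>i. \<rho> i (z i)) I"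
  obtain f where f: "fixlift c v ?t f" "\<And>u. deriv_at f v u = u + (\<Sum>i\<in>I. R i (z i) u - u)"
    using product_lift[OF subset_refl, of z] z by blast
  note fd = product_deriv[OF f z]
  have eq: "deriv_at f v u = D h u" for u
    by (rule linear_eq_decomp[OF fd(1) linear_D[OF h]]) (use fd group_fixes_tangent[OF h] r in \<open>auto simp: rel_def\<close>)
  let ?k = "inv\<^bsub>chart_group c\<^esub> h"
  have k: "?k \<in> carrier (chart_group c)" using chart_inv_closed[OF oc h] .
  note comp = fixlift_compose[OF f(1) fixlift_h[OF k]]
  have 1: "deriv_at (\<lambda>w. chart_act c ?k (f w)) v u = u" for u
    unfolding comp(2) eq using deriv_chart_act_inv[OF oc h v, of u] stab[OF h] by simp
  let ?M = "order (chart_group c)"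
  have M: "?M > 0" using chart_act_finite_order(2)[OF oc h v] .
  have "z i ^ ?M = 1" if i: "i \<in> I" for i
  proof (rule plane_rotation.R_eq_on_V[OF rot[OF i]])
    show "z i ^ ?M \<in> sphere 0 1" using z[OF i] by (simp add: norm_power)
    fix u assume u: "u \<in> V i"
    have "(D h ^^ n) u = (R i (z i) ^^ n) u \<and> (R i (z i) ^^ n) u \<in> V i" for n
      by (induction n) (use u r i R_V[OF i z[OF i]] in \<open>auto simp: rel_def\<close>)
    then have "(R i (z i) ^^ ?M) u = u" using deriv_chart_act_finite_order[OF oc h v stab[OF h], of u] by metis
    then show "R i (z i ^ ?M) u = R i 1 u"
      using circle_lift_power[OF G[OF i] z[OF i], of ?M] circle_liftD(7)[OF G[OF i], of u] by simp
  qed simp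
  then have "?t ^ ?M = 1" using finprod_torsion[OF subset_refl, of z ?M] z by blast
  then show ?thesis using torsion_fixlift_eq_one[OF oc _ _ M 1, of ?t] comp(1) by simp
qed

text \<open>If the product is 1, its lift covers the identity and so has the derivative of a chart
  group element, which is the required \<open>h\<close>.\<close>

lemma kernel_rel:
  assumes z: "z \<in> (\<Pi>\<^sub>E i\<in>I. sphere 0 1)" and t: "finprod torus_group (\<lambda>i. \<rho> i (z i)) I = 1"
  shows "\<exists>h. rel h z"
proof -
  have z': "\<And>i. i \<in> I \<Longrightarrow> z i \<in> sphere 0 1" using z by auto
  obtain f where f: "fixlift c v 1 f" "\<And>u. deriv_at f v u = u + (\<Sum>i\<in>I. R i (z i) u - u)"
    using product_lift[OF subset_refl, of z] z' t by auto
  note fd = product_deriv[OF f z']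
  obtain h where h: "h \<in> carrier (chart_group c)" "deriv_at f v = D h" using fixlift_one_jet[OF oc f(1)] by metis
  then have "rel h z" using z fd(3) unfolding rel_def by simp
  then show ?thesis by blast
qed

lemma chart_group_iso_kernel: "chart_group c \<cong> kernel_group \<rho> I"
proof -
  define \<Theta> where "\<Theta> h = (SOME z. rel h z)" for h
  have \<Theta>: "rel h (\<Theta> h)" if "h \<in> carrier (chart_group c)" for h
    unfolding \<Theta>_def using rel_exists[OF that] by (rule someI_ex)
  have K: "carrier (kernel_group \<rho> I) = {z \<in> (\<Pi>\<^sub>E i\<in>I. sphere 0 1). finprod torus_group (\<lambda>i. \<rho> i (z i)) I = 1}"
    by (auto simp: kernel_group_def kernel_def in_cover_torus_iff cover_torus_hom_def)
  have m: "mult (kernel_group \<rho> I) x y = (\<lambda>i\<in>I. x i * y i)" for x y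
    by (simp add: kernel_group_def cover_torus_def product_group_def)
  have "\<Theta> \<in> iso (chart_group c) (kernel_group \<rho> I)"
  proof (rule isoI)
    show "\<Theta> \<in> hom (chart_group c) (kernel_group \<rho> I)"
    proof (rule homI)
      fix h h' assume h: "h \<in> carrier (chart_group c)" "h' \<in> carrier (chart_group c)"
      show "\<Theta> h \<in> carrier (kernel_group \<rho> I)" using \<Theta>[OF h(1)] rel_kernel[OF \<Theta>[OF h(1)]] unfolding K rel_def by blast
      show "\<Theta> (h \<otimes>\<^bsub>chart_group c\<^esub> h') = \<Theta> h \<otimes>\<^bsub>kernel_group \<rho> I\<^esub> \<Theta> h'"
        unfolding m by (rule rel_unique_right[OF \<Theta>[OF chart_mult_closed[OF oc h]] rel_mult[OF \<Theta>[OF h(1)] \<Theta>[OF h(2)]]])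
    qed
    then have sub: "\<Theta> ` carrier (chart_group c) \<subseteq> carrier (kernel_group \<rho> I)" by (auto simp: hom_def)
    have "inj_on \<Theta> (carrier (chart_group c))"
      using rel_unique_left \<Theta> by (intro inj_onI) metis
    moreover have "carrier (kernel_group \<rho> I) \<subseteq> \<Theta> ` carrier (chart_group c)"
    proof
      fix z assume "z \<in> carrier (kernel_group \<rho> I)"
      then obtain h where h: "rel h z" using kernel_rel unfolding K by blast
      then have "h \<in> carrier (chart_group c)" by (simp add: rel_def)
      moreover have "z = \<Theta> h" by (rule rel_unique_right[OF h \<Theta>]) fact
      ultimately show "z \<in> \<Theta> ` carrier (chart_group c)" by blast
    qed
    ultimately show "bij_betw \<Theta> (carrier (chart_group c)) (carrier (kernel_group \<rho> I))"
      using sub by (auto simp: bij_betw_def)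
  qed
  then show ?thesis by (auto simp: is_iso_def)
qed

end

theorem lemma12p3:
  fixes A :: "('x::t2_space, real ^ 'm, 'h) ochart set"
    and ori :: "('x, real ^ 'm, 'h) ochart \<Rightarrow> real ^ 'm \<Rightarrow> real"
    and act :: "complex ^ 'n \<Rightarrow> 'x \<Rightarrow> 'x"
    and d :: nat
    and Mc :: "nat \<Rightarrow> 'x set"
    and Sc :: "nat \<Rightarrow> (complex ^ 'n) set"
    and \<nu> :: "nat \<Rightarrow> ('x, real ^ 'm, 'h) ochart \<Rightarrow> real ^ 'm \<Rightarrow> real ^ 'm \<Rightarrow> real ^ 'm \<Rightarrow> real"
    and \<rho> :: "nat \<Rightarrow> complex \<Rightarrow> complex ^ 'n"
    and I :: "nat set" and k :: nat and x :: 'x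
  assumes "torus_orbifold A ori act d Mc Sc \<nu>"
    and "min_multiplicity A = 1"
    and "\<And>i. i \<in> {1..d} \<Longrightarrow> minimal_lifting_covering A act (Mc i) (Sc i) (\<rho> i)"
    and "I \<in> Sigma_k act d Mc k"
    and "x \<in> principal_stratum A (M_inter Mc I)"
  shows "isotropy_group A x \<cong> kernel_group \<rho> I"
proof -
  interpret M: torus_orbifold A ori act d Mc Sc \<nu> by fact
  have "inj_on act (carrier torus_group)"
    using M.effective by (rule faithful_action.faithful)
  then interpret characteristic_setup A act d Mc Sc \<rho>
    using M.orbifold M.smooth_action M.connected_space M.characteristic M.circles assms(2,3)
    by unfold_locales blast+
  \<comment> \<open>In a reduced chart the stabilizer of the point above \<open>x\<close> is the
    whole chart group, as \<open>reduced_setup\<close> demands.\<close>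
  obtain c where c: "reduced_chart A x c" using reduced_chart_exists[OF M.orbifold] by blast
  then have cA: "c \<in> charts A" and xb: "x \<in> base c" by (auto simp: reduced_chart_def)
  obtain v where v: "v \<in> cover c" and px: "proj c v = x" using proj_image[OF chartsD[OF cA]] xb by (metis imageE)
  have grp: "stab_group c v = chart_group c" by (rule reduced_chart_stab_group[OF c v px])
  then have "carrier (stab_group c v) = carrier (chart_group c)" by simp
  then have stab: "chart_act c h v = v" if "h \<in> carrier (chart_group c)" for h
    using that by (auto simp: stabilizer_def)
  have xI: "x \<in> M_inter Mc I" "multiplicity A x = (INF y \<in> connected_component_set (M_inter Mc I) x. multiplicity A y)"
    using assms(5) by (auto simp: principal_stratum_def)
  interpret reduced_setup A act d Mc Sc \<rho> I c v
  proof unfold_locales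
    show "I \<subseteq> {1..d}" using assms(4) by (auto simp: Sigma_k_def Sigma_set_def)
    show "proj c v \<in> Mc i" if "i \<in> I" for i using xI(1) px that by (simp add: M_inter_def)
    show "multiplicity A (proj c v) = (INF y \<in> connected_component_set (M_inter Mc I) (proj c v). multiplicity A y)"
      using xI(2) px by simp
  qed (fact cA v stab)+
  have "isotropy_group A x \<cong> stab_group c v" using isotropy_group_iso[OF M.orbifold cA v] px by simp
  also have "stab_group c v \<cong> kernel_group \<rho> I" unfolding grp by (rule chart_group_iso_kernel)
  finally show ?thesis .
qed

end
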